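(* Let $(\mathcal{A},\varphi)$ be a $W^*$-probability space with faithful normal tracial state $\varphi$. Let $U,V\in\mathcal{A}$ be free with $0\le U<1$ and $V\ge0$ ($V$ bounded). Let $\omega_1,\omega_2$ be the subordination functions of the pair $(U,V)$; they satisfy $M_{UV}(z)=M_V(\omega_1(z))=M_U(\omega_2(z))$. Then for all $z$ in some neighbourhood of $0$ $$\mathbb{E}_V\left[(1-U)^{-1}U^{1/2}\,\Psi_{U^{1/2}VU^{1/2}}(z)\,U^{1/2}(1-U)^{-1}\right]=B(z)+z\,A(z)^2\,V\left(1+\Psi_V(\omega_1(z))\right),$$ where $$A(z)=\frac{\eta_U(\omega_2(z))-\eta_U(1)}{\omega_2(z)-1}\,\varphi\left((1-U)^{-1}\right),$$ $$B(z)=\frac{\omega_2(z)\left(\eta_U(\omega_2(z))-\eta_U(1)-(\omega_2(z)-1)\,\eta_U'(1)\right)}{(\omega_2(z)-1)^2}\,\left[\varphi\left((1-U)^{-1}\right)\right]^2 .$$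
   Context: $\mathcal{A}$ is a finite von Neumann algebra with faithful normal tracial state $\varphi$. $0\le U<1$ means that $U$ is self-adjoint with spectrum contained in $[0,1)$, so $(1-U)^{-1}\in\mathcal{A}$. $\mathbb{E}_X$ denotes the $\varphi$-preserving conditional expectation onto the von Neumann subalgebra generated by $X$ and $1_{\mathcal{A}}$. Set $\Psi_X(z)=zX(1-zX)^{-1}$, $M_X(z)=\varphi(\Psi_X(z))$ for positive $X$, $M_{UV}=M_{U^{1/2}VU^{1/2}}=M_{V^{1/2}UV^{1/2}}$, and $\eta_X(z)=\frac{M_X(z)}{1+M_X(z)}$; $\eta_U(1)$ and $\eta_U'(1)$ are the value and derivative of $\eta_U$ at $1$. The subordination functions $\omega_1,\omega_2$ are defined by $$\mathbb{E}_V\,\Psi_{V^{1/2}UV^{1/2}}(z)=\Psi_V(\omega_1(z)),\qquad \mathbb{E}_U\,\Psi_{U^{1/2}VU^{1/2}}(z)=\Psi_U(\omega_2(z));$$ near $0$ they are analytic with $\omega_1(z)=\sum_{k\ge1}\beta_{2k-1}(U,V,U,\ldots,V,U)z^k$ and $\omega_2(z)=\sum_{k\ge1}\beta_{2k-1}(V,U,V,\ldots,U,V)z^k$ (arguments alternating). Here the Boolean cumulants $\beta_n$ are defined recursively by $\varphi(X_1\cdots X_m)=\sum_{\pi\in Int(m)}\prod_{B\in\pi}\beta_{|B|}(X_i;\,i\in B)$, $m\ge1$, with $Int(m)$ the set of partitions of $\{1,\dots,m\}$ into blocks of consecutive integers. *)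

theory Defs
  imports "HOL-Analysis.Analysis"
begin

section \<open>Complex Hilbert spaces\<close>

class scaleC =
  fixes scaleC :: "complex \<Rightarrow> 'a \<Rightarrow> 'a"  (infixr "*\<^sub>C" 75)

class complex_vector = scaleC + real_vector +
  assumes scaleC_add_right: "a *\<^sub>C (x + y) = a *\<^sub>C x + a *\<^sub>C y"
    and scaleC_add_left: "(a + b) *\<^sub>C x = a *\<^sub>C x + b *\<^sub>C x"
    and scaleC_scaleC: "a *\<^sub>C (b *\<^sub>C x) = (a * b) *\<^sub>C x"
    and scaleC_of_real: "complex_of_real r *\<^sub>C x = r *\<^sub>R x"

text \<open>The inner product is linear in the second argument. Its real part is the real inner product
  underlying the norm. The zero space is excluded; it carries no algebra with a state anyway.\<close>

class chilbert_space = complex_vector + real_inner + banach +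
  fixes cinner :: "'a \<Rightarrow> 'a \<Rightarrow> complex"
  assumes cinner_commute: "cinner x y = cnj (cinner y x)"
    and cinner_add_right: "cinner x (y + z) = cinner x y + cinner x z"
    and cinner_scaleC_right: "cinner x (c *\<^sub>C y) = c * cinner x y"
    and Re_cinner: "Re (cinner x y) = x \<bullet> y"
    and nontrivial: "\<exists>x::'a. x \<noteq> 0"

lemma cinner_same: "cinner x x = complex_of_real ((norm x)\<^sup>2)"
proof -
  have "Im (cinner x x) = 0"
    using arg_cong[OF cinner_commute[of x x], of Im] by simp
  then show ?thesis
    by (simp add: complex_eq_iff Re_cinner power2_norm_eq_inner)
qed

lemma norm_scaleC: "norm (c *\<^sub>C x) = cmod c * norm x" for x :: "'a::chilbert_space"
proof -
  have "cinner (c *\<^sub>C x) (c *\<^sub>C x) = c * cnj c * cinner x x"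
    unfolding cinner_scaleC_right
    by (subst cinner_commute) (simp add: cinner_scaleC_right cinner_commute[of x x, symmetric])
  also have "\<dots> = complex_of_real ((cmod c * norm x)\<^sup>2)"
    by (simp add: cinner_same complex_norm_square[symmetric] power_mult_distrib)
  finally have "(norm (c *\<^sub>C x))\<^sup>2 = (cmod c * norm x)\<^sup>2"
    unfolding cinner_same of_real_eq_iff .
  then show ?thesis
    by (rule power2_eq_imp_eq) simp_all
qed

lemma bounded_linear_scaleC: "bounded_linear (\<lambda>x::'a::chilbert_space. c *\<^sub>C x)"
proof (rule bounded_linear_intro[where K = "cmod c"])
  show "c *\<^sub>C (r *\<^sub>R x) = r *\<^sub>R (c *\<^sub>C x)" for r and x :: 'a
    by (simp add: scaleC_of_real[symmetric] scaleC_scaleC mult.commute)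
qed (simp_all add: scaleC_add_right norm_scaleC mult.commute)


section \<open>The algebra of bounded operators\<close>

typedef (overloaded) ('h::chilbert_space) cop =
  "{T :: 'h \<Rightarrow>\<^sub>L 'h. \<forall>c x. blinfun_apply T (c *\<^sub>C x) = c *\<^sub>C blinfun_apply T x}"
  morphisms blinfun_of_cop Abs_cop
  by (rule exI[of _ id_blinfun]) simp

setup_lifting type_definition_cop

lift_definition cop_apply :: "'h::chilbert_space cop \<Rightarrow> 'h \<Rightarrow> 'h" is blinfun_apply .

lemma cop_eqI: "(\<And>x. cop_apply A x = cop_apply B x) \<Longrightarrow> A = B"
  by transfer (rule blinfun_eqI)

instantiation cop :: (chilbert_space) "{ring, monoid_mult, real_normed_vector, scaleC}"
begin

lift_definition zero_cop :: "'a cop" is 0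
  using scaleC_add_right[of _ "0::'a" 0] by simp

lift_definition one_cop :: "'a cop" is id_blinfun by simp

lift_definition plus_cop :: "'a cop \<Rightarrow> 'a cop \<Rightarrow> 'a cop" is "(+)"
  by (simp add: blinfun.add_left scaleC_add_right)

lift_definition uminus_cop :: "'a cop \<Rightarrow> 'a cop" is uminus
  by (simp add: blinfun.minus_left
      linear_neg[OF bounded_linear.linear[OF bounded_linear_scaleC]])

lift_definition minus_cop :: "'a cop \<Rightarrow> 'a cop \<Rightarrow> 'a cop" is "(-)"
  by (simp add: blinfun.diff_left
      linear_diff[OF bounded_linear.linear[OF bounded_linear_scaleC]])

lift_definition times_cop :: "'a cop \<Rightarrow> 'a cop \<Rightarrow> 'a cop" is "(o\<^sub>L)"
  by simp

lift_definition scaleC_cop :: "complex \<Rightarrow> 'a cop \<Rightarrow> 'a cop" is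
  "\<lambda>c T. Blinfun (\<lambda>x. c *\<^sub>C x) o\<^sub>L T"
  by (simp add: bounded_linear_Blinfun_apply bounded_linear_scaleC scaleC_scaleC mult.commute)

lift_definition scaleR_cop :: "real \<Rightarrow> 'a cop \<Rightarrow> 'a cop" is "(*\<^sub>R)"
  by (simp add: blinfun.scaleR_left scaleC_scaleC mult.commute flip: scaleC_of_real)

lift_definition norm_cop :: "'a cop \<Rightarrow> real" is norm .

definition sgn_cop :: "'a cop \<Rightarrow> 'a cop" where "sgn_cop A = scaleR (inverse (norm A)) A"
definition dist_cop :: "'a cop \<Rightarrow> 'a cop \<Rightarrow> real" where "dist_cop A B = norm (A - B)"
definition [code del]: "(uniformity :: ('a cop \<times> 'a cop) filter)
  = (INF e\<in>{0<..}. principal {(x, y). dist x y < e})"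
definition open_cop :: "'a cop set \<Rightarrow> bool" where [code del]:
  "open_cop S = (\<forall>x\<in>S. \<forall>\<^sub>F (x', y) in uniformity. x' = x \<longrightarrow> y \<in> S)"

instance
proof
  fix A B C :: "'a cop" and r s :: real and S :: "'a cop set"
  show "A + B + C = A + (B + C)" by transfer simp
  show "A + B = B + A" by transfer simp
  show "0 + A = A" by transfer simp
  show "- A + A = 0" by transfer simp
  show "A - B = A + - B" by transfer simp
  show "A * B * C = A * (B * C)" by transfer (auto intro: blinfun_eqI)
  show "(A + B) * C = A * C + B * C"
    by transfer (auto intro: blinfun_eqI simp: blinfun.add_left)
  show "A * (B + C) = A * B + A * C"
    by transfer (auto intro: blinfun_eqI simp: blinfun.add_left blinfun.add_right)
  show "1 * A = A" by transfer (auto intro: blinfun_eqI)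
  show "A * 1 = A" by transfer (auto intro: blinfun_eqI)
  show "r *\<^sub>R (A + B) = r *\<^sub>R A + r *\<^sub>R B" by transfer (simp add: scaleR_add_right)
  show "(r + s) *\<^sub>R A = r *\<^sub>R A + s *\<^sub>R A" by transfer (simp add: scaleR_add_left)
  show "r *\<^sub>R s *\<^sub>R A = (r * s) *\<^sub>R A" by transfer simp
  show "1 *\<^sub>R A = A" by transfer simp
  show "(norm A = 0) = (A = 0)" by transfer simp
  show "norm (A + B) \<le> norm A + norm B" by transfer (rule norm_triangle_ineq)
  show "norm (r *\<^sub>R A) = \<bar>r\<bar> * norm A" by transfer simp
  show "sgn A = inverse (norm A) *\<^sub>R A" by (rule sgn_cop_def)
  show "dist A B = norm (A - B)" by (rule dist_cop_def)
  show "(uniformity :: ('a cop \<times> 'a cop) filter)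
    = (INF e\<in>{0<..}. principal {(x, y). dist x y < e})" by (rule uniformity_cop_def)
  show "open S = (\<forall>x\<in>S. \<forall>\<^sub>F (x', y) in uniformity. x' = x \<longrightarrow> y \<in> S)"
    by (rule open_cop_def)
qed

end

lemma cop_apply_simps [simp]:
  "cop_apply 0 x = 0" "cop_apply 1 x = x" "cop_apply (A + B) x = cop_apply A x + cop_apply B x"
  "cop_apply (A - B) x = cop_apply A x - cop_apply B x" "cop_apply (- A) x = - cop_apply A x"
  "cop_apply (A * B) x = cop_apply A (cop_apply B x)"
  "cop_apply (c *\<^sub>C A) x = c *\<^sub>C cop_apply A x" "cop_apply (r *\<^sub>R A) x = r *\<^sub>R cop_apply A x"
  "cop_apply A (c *\<^sub>C x) = c *\<^sub>C cop_apply A x"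
  by (transfer; simp add: blinfun.add_left blinfun.diff_left blinfun.minus_left
      blinfun.scaleR_left bounded_linear_Blinfun_apply bounded_linear_scaleC)+

instance cop :: (chilbert_space) complex_vector
  by standard (auto intro!: cop_eqI simp: scaleC_add_right scaleC_add_left scaleC_scaleC scaleC_of_real)

instance cop :: (chilbert_space) real_normed_algebra_1
proof
  fix A B :: "'a cop" and r :: real
  show "(0::'a cop) \<noteq> 1"
  proof
    assume "(0::'a cop) = 1"
    then have "cop_apply 0 x = cop_apply 1 x" for x :: 'a by (rule arg_cong)
    then have "x = 0" for x :: 'a by simp
    then show False using nontrivial[where 'a = 'a] by blast
  qed
  show "r *\<^sub>R A * B = r *\<^sub>R (A * B)" by (rule cop_eqI) simp
  show "A * r *\<^sub>R B = r *\<^sub>R (A * B)"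
    by transfer (auto intro: blinfun_eqI simp: blinfun.scaleR_left blinfun.scaleR_right)
  show "norm (A * B) \<le> norm A * norm B" by transfer (rule norm_blinfun_compose)
  obtain x :: 'a where x: "x \<noteq> 0" using nontrivial by blast
  have "norm (id_blinfun :: 'a \<Rightarrow>\<^sub>L 'a) = 1"
  proof (rule antisym)
    show "norm (id_blinfun :: 'a \<Rightarrow>\<^sub>L 'a) \<le> 1" by (rule norm_blinfun_bound) auto
    show "1 \<le> norm (id_blinfun :: 'a \<Rightarrow>\<^sub>L 'a)"
      using norm_blinfun[of "id_blinfun :: 'a \<Rightarrow>\<^sub>L 'a" x] x by simp
  qed
  then show "norm (1::'a cop) = 1" by transfer
qed

instance cop :: (chilbert_space) banach
proof
  fix X :: "nat \<Rightarrow> 'a cop"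
  assume "Cauchy X"
  have dist_eq: "dist A B = dist (blinfun_of_cop A) (blinfun_of_cop B)" for A B :: "'a cop"
    by (simp add: dist_norm norm_cop.rep_eq minus_cop.rep_eq)
  from \<open>Cauchy X\<close> have "Cauchy (\<lambda>n. blinfun_of_cop (X n))"
    by (simp add: Cauchy_def dist_eq)
  then obtain T where T: "(\<lambda>n. blinfun_of_cop (X n)) \<longlonglongrightarrow> T"
    by (auto simp: Cauchy_convergent_iff convergent_def)
  have "blinfun_apply T (c *\<^sub>C x) = c *\<^sub>C blinfun_apply T x" for c x
  proof (rule LIMSEQ_unique)
    show "(\<lambda>n. blinfun_apply (blinfun_of_cop (X n)) (c *\<^sub>C x)) \<longlonglongrightarrow> blinfun_apply T (c *\<^sub>C x)"
      by (intro blinfun.tendsto T tendsto_const)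
    have "(\<lambda>n. c *\<^sub>C blinfun_apply (blinfun_of_cop (X n)) x) \<longlonglongrightarrow> c *\<^sub>C blinfun_apply T x"
      by (intro bounded_linear.tendsto[OF bounded_linear_scaleC] blinfun.tendsto T tendsto_const)
    then show "(\<lambda>n. blinfun_apply (blinfun_of_cop (X n)) (c *\<^sub>C x)) \<longlonglongrightarrow> c *\<^sub>C blinfun_apply T x"
      unfolding cop_apply.rep_eq[symmetric] cop_apply_simps .
  qed
  then have "T = blinfun_of_cop (Abs_cop T)"
    by (simp add: Abs_cop_inverse)
  with T have "X \<longlonglongrightarrow> Abs_cop T"
    unfolding tendsto_iff dist_eq by metis
  then show "convergent X" by (rule convergentI)
qed

definition adj :: "'h::chilbert_space cop \<Rightarrow> 'h cop" where
  "adj A = (THE B. \<forall>x y. cinner (cop_apply B x) y = cinner x (cop_apply A y))"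

definition self_adjoint :: "'h::chilbert_space cop \<Rightarrow> bool" where
  "self_adjoint A \<longleftrightarrow> adj A = A"

definition positive_op :: "'h::chilbert_space cop \<Rightarrow> bool" where
  "positive_op A \<longleftrightarrow> (\<forall>x. cinner x (cop_apply A x) \<in> \<real>\<^sub>\<ge>\<^sub>0)"

definition op_invertible :: "'h::chilbert_space cop \<Rightarrow> bool" where
  "op_invertible A \<longleftrightarrow> (\<exists>B. A * B = 1 \<and> B * A = 1)"

definition op_inv :: "'h::chilbert_space cop \<Rightarrow> 'h cop" where
  "op_inv A = (THE B. A * B = 1 \<and> B * A = 1)"

definition op_spectrum :: "'h::chilbert_space cop \<Rightarrow> complex set" where
  "op_spectrum A = {c. \<not> op_invertible (A - c *\<^sub>C 1)}"

definition op_sqrt :: "'h::chilbert_space cop \<Rightarrow> 'h cop" where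
  "op_sqrt A = (THE R. positive_op R \<and> R * R = A)"


section \<open>Tracial von Neumann algebras\<close>

definition commutant :: "'h::chilbert_space cop set \<Rightarrow> 'h cop set" where
  "commutant S = {T. \<forall>A\<in>S. T * A = A * T}"

definition von_neumann_algebra :: "'h::chilbert_space cop set \<Rightarrow> bool" where
  "von_neumann_algebra M \<longleftrightarrow> (\<forall>A\<in>M. adj A \<in> M) \<and> commutant (commutant M) = M"

text \<open>Von Neumann algebras in the above sense contain the identity of the Hilbert space.\<close>

definition vn_generated :: "'h::chilbert_space cop set \<Rightarrow> 'h cop set" where
  "vn_generated S = \<Inter>{N. von_neumann_algebra N \<and> S \<subseteq> N}"

text \<open>Functionals on \<open>M\<close> are functions on all operators whose values outside \<open>M\<close> are irrelevant.\<close>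

definition state_on :: "'h::chilbert_space cop set \<Rightarrow> ('h cop \<Rightarrow> complex) \<Rightarrow> bool" where
  "state_on M \<phi> \<longleftrightarrow>
     (\<forall>A\<in>M. \<forall>B\<in>M. \<phi> (A + B) = \<phi> A + \<phi> B) \<and>
     (\<forall>c. \<forall>A\<in>M. \<phi> (c *\<^sub>C A) = c * \<phi> A) \<and>
     (\<forall>A\<in>M. \<phi> (adj A * A) \<in> \<real>\<^sub>\<ge>\<^sub>0) \<and>
     \<phi> 1 = 1"

text \<open>Normality is ultraweak (\<open>\<sigma>\<close>-weak) continuity: the ultraweakly continuous functionals are those
  of the form \<open>A \<mapsto> \<Sum>n. \<langle>y\<^sub>n, A x\<^sub>n\<rangle>\<close> with square-summable sequences of vectors.\<close>

definition normal_on :: "'h::chilbert_space cop set \<Rightarrow> ('h cop \<Rightarrow> complex) \<Rightarrow> bool" where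
  "normal_on M \<phi> \<longleftrightarrow>
     (\<exists>x y :: nat \<Rightarrow> 'h. summable (\<lambda>n. (norm (x n))\<^sup>2) \<and> summable (\<lambda>n. (norm (y n))\<^sup>2) \<and>
        (\<forall>A\<in>M. (\<lambda>n. cinner (y n) (cop_apply A (x n))) sums \<phi> A))"

definition faithful_on :: "'h::chilbert_space cop set \<Rightarrow> ('h cop \<Rightarrow> complex) \<Rightarrow> bool" where
  "faithful_on M \<phi> \<longleftrightarrow> (\<forall>A\<in>M. \<phi> (adj A * A) = 0 \<longrightarrow> A = 0)"

definition tracial_on :: "'h::chilbert_space cop set \<Rightarrow> ('h cop \<Rightarrow> complex) \<Rightarrow> bool" where
  "tracial_on M \<phi> \<longleftrightarrow> (\<forall>A\<in>M. \<forall>B\<in>M. \<phi> (A * B) = \<phi> (B * A))"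

text \<open>Finiteness of the algebra is implied by the existence of a faithful tracial state.\<close>

definition tracial_W_star_prob_space ::
    "'h::chilbert_space cop set \<Rightarrow> ('h cop \<Rightarrow> complex) \<Rightarrow> bool" where
  "tracial_W_star_prob_space M \<phi> \<longleftrightarrow>
     von_neumann_algebra M \<and> state_on M \<phi> \<and> normal_on M \<phi> \<and> faithful_on M \<phi> \<and> tracial_on M \<phi>"

definition conditional_expectation ::
    "'h::chilbert_space cop set \<Rightarrow> ('h cop \<Rightarrow> complex) \<Rightarrow> 'h cop set \<Rightarrow> ('h cop \<Rightarrow> 'h cop) \<Rightarrow> bool" where
  "conditional_expectation M \<phi> N E \<longleftrightarrow>
     (\<forall>A\<in>M. E A \<in> N) \<and>
     (\<forall>A\<in>M. \<forall>B\<in>M. E (A + B) = E A + E B) \<and>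
     (\<forall>c. \<forall>A\<in>M. E (c *\<^sub>C A) = c *\<^sub>C E A) \<and>
     (\<forall>A\<in>M. positive_op A \<longrightarrow> positive_op (E A)) \<and>
     (\<forall>B\<in>N. E B = B) \<and>
     (\<forall>A\<in>M. \<forall>B\<in>N. \<forall>C\<in>N. E (B * A * C) = B * E A * C) \<and>
     (\<forall>A\<in>M. \<phi> (E A) = \<phi> A)"


section \<open>Freeness\<close>

inductive_set unital_algebra :: "'h::chilbert_space cop set \<Rightarrow> 'h cop set" for S where
  gen: "A \<in> S \<Longrightarrow> A \<in> unital_algebra S"
| one: "1 \<in> unital_algebra S"
| add: "A \<in> unital_algebra S \<Longrightarrow> B \<in> unital_algebra S \<Longrightarrow> A + B \<in> unital_algebra S"
| scale: "A \<in> unital_algebra S \<Longrightarrow> c *\<^sub>C A \<in> unital_algebra S"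
| mult: "A \<in> unital_algebra S \<Longrightarrow> B \<in> unital_algebra S \<Longrightarrow> A * B \<in> unital_algebra S"

definition alternates_in :: "'a set \<Rightarrow> 'a set \<Rightarrow> 'a list \<Rightarrow> bool" where
  "alternates_in P Q Xs \<longleftrightarrow> (\<forall>i<length Xs. Xs ! i \<in> (if even i then P else Q))"

definition free_algebras ::
    "('h::chilbert_space cop \<Rightarrow> complex) \<Rightarrow> 'h cop set \<Rightarrow> 'h cop set \<Rightarrow> bool" where
  "free_algebras \<phi> P Q \<longleftrightarrow>
     (\<forall>Xs. Xs \<noteq> [] \<and> (alternates_in P Q Xs \<or> alternates_in Q P Xs) \<and> (\<forall>X\<in>set Xs. \<phi> X = 0)
        \<longrightarrow> \<phi> (prod_list Xs) = 0)"

definition free_elements ::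
    "('h::chilbert_space cop \<Rightarrow> complex) \<Rightarrow> 'h cop \<Rightarrow> 'h cop \<Rightarrow> bool" where
  "free_elements \<phi> X Y \<longleftrightarrow> free_algebras \<phi> (unital_algebra {X}) (unital_algebra {Y})"


section \<open>Boolean cumulants\<close>

text \<open>An interval partition of the positions of a list is a way to write the list as a concatenation
  of nonempty lists.\<close>

definition interval_partitions :: "'a list \<Rightarrow> 'a list list set" where
  "interval_partitions Xs = {bs. concat bs = Xs \<and> [] \<notin> set bs}"

lemma interval_partitions_length:
  assumes "bs \<in> interval_partitions Xs" "bs \<noteq> [Xs]" "b \<in> set bs"
  shows "length b < length Xs"
proof -
  from \<open>b \<in> set bs\<close> obtain us vs where bs: "bs = us @ b # vs"
    by (auto simp: in_set_conv_decomp)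
  have Xs: "Xs = concat us @ b @ concat vs" and ne: "[] \<notin> set us" "[] \<notin> set vs"
    using assms(1) by (auto simp: interval_partitions_def bs)
  have "concat us \<noteq> [] \<or> concat vs \<noteq> []"
  proof (rule ccontr)
    assume "\<not> ?thesis"
    moreover from this ne have "us = []" "vs = []"
      by (cases us; cases vs; auto)+
    ultimately show False using assms(2) bs Xs by simp
  qed
  then show ?thesis using Xs by auto
qed

lemma finite_interval_partitions: "finite (interval_partitions Xs)"
proof -
  have len: "length bs \<le> length (concat bs)" if "[] \<notin> set bs" for bs :: "'a list list"
    using that
  proof (induction bs)
    case (Cons b bs)
    then show ?case by (cases b) auto
  qed simp
  let ?L = "{ys. set ys \<subseteq> set Xs \<and> length ys \<le> length Xs}"
  have "interval_partitions Xs \<subseteq> {bs. set bs \<subseteq> ?L \<and> length bs \<le> length Xs}"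
  proof
    fix bs assume bs: "bs \<in> interval_partitions Xs"
    have "b \<in> ?L" if "b \<in> set bs" for b
    proof -
      have "length b \<le> length Xs"
        using interval_partitions_length[OF bs _ that] that by (cases "bs = [Xs]") auto
      moreover have "set b \<subseteq> set Xs"
        using bs that by (auto simp: interval_partitions_def)
      ultimately show ?thesis by simp
    qed
    then show "bs \<in> {bs. set bs \<subseteq> ?L \<and> length bs \<le> length Xs}"
      using bs len by (auto simp: interval_partitions_def)
  qed
  moreover have "finite {bs. set bs \<subseteq> ?L \<and> length bs \<le> length Xs}"
    by (intro finite_lists_length_le) simp_all
  ultimately show ?thesis by (rule finite_subset)
qed

function boolean_cumulant ::
    "('h::chilbert_space cop \<Rightarrow> complex) \<Rightarrow> 'h cop list \<Rightarrow> complex" where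
  "boolean_cumulant \<phi> Xs = \<phi> (prod_list Xs)
     - (\<Sum>bs\<in>interval_partitions Xs - {[Xs]}. \<Prod>b\<leftarrow>bs. boolean_cumulant \<phi> b)"
  by auto
termination
  by (relation "Wellfounded.measure (\<lambda>(\<phi>, Xs). length Xs)") (auto intro: interval_partitions_length)

declare boolean_cumulant.simps [simp del]

lemma moment_boolean_cumulant:
  assumes "Xs \<noteq> []"
  shows "\<phi> (prod_list Xs) = (\<Sum>bs\<in>interval_partitions Xs. \<Prod>b\<leftarrow>bs. boolean_cumulant \<phi> b)"
proof -
  have "[Xs] \<in> interval_partitions Xs"
    using assms by (simp add: interval_partitions_def)
  then have "(\<Sum>bs\<in>interval_partitions Xs. \<Prod>b\<leftarrow>bs. boolean_cumulant \<phi> b)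
    = boolean_cumulant \<phi> Xs
      + (\<Sum>bs\<in>interval_partitions Xs - {[Xs]}. \<Prod>b\<leftarrow>bs. boolean_cumulant \<phi> b)"
    by (simp add: sum.remove finite_interval_partitions)
  then show ?thesis by (simp add: boolean_cumulant.simps[of \<phi> Xs])
qed

definition alternating_list :: "'a \<Rightarrow> 'a \<Rightarrow> nat \<Rightarrow> 'a list" where
  "alternating_list X Y n = map (\<lambda>i. if even i then X else Y) [0..<n]"


section \<open>Moment transforms and subordination\<close>

definition Psi :: "'h::chilbert_space cop \<Rightarrow> complex \<Rightarrow> 'h cop" where
  "Psi X z = z *\<^sub>C X * op_inv (1 - z *\<^sub>C X)"

definition moment_transform ::
    "('h::chilbert_space cop \<Rightarrow> complex) \<Rightarrow> 'h cop \<Rightarrow> complex \<Rightarrow> complex" where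
  "moment_transform \<phi> X z = \<phi> (Psi X z)"

definition eta :: "('h::chilbert_space cop \<Rightarrow> complex) \<Rightarrow> 'h cop \<Rightarrow> complex \<Rightarrow> complex" where
  "eta \<phi> X z = moment_transform \<phi> X z / (1 + moment_transform \<phi> X z)"

definition sandwich :: "'h::chilbert_space cop \<Rightarrow> 'h cop \<Rightarrow> 'h cop" where
  "sandwich X Y = op_sqrt X * Y * op_sqrt X"

text \<open>Here \<open>EU\<close> and \<open>EV\<close> are the conditional expectations onto the von Neumann algebras generated by
  \<open>U\<close> and \<open>V\<close>. The series expansions fix \<open>\<omega>1\<close> (\<open>\<omega>2\<close>) also if \<open>V = 0\<close> (\<open>U = 0\<close>), where the
  corresponding equation is void.\<close>

definition subordination_functions ::
    "('h::chilbert_space cop \<Rightarrow> complex) \<Rightarrow> ('h cop \<Rightarrow> 'h cop) \<Rightarrow> ('h cop \<Rightarrow> 'h cop) \<Rightarrow>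
     'h cop \<Rightarrow> 'h cop \<Rightarrow> (complex \<Rightarrow> complex) \<Rightarrow> (complex \<Rightarrow> complex) \<Rightarrow> bool" where
  "subordination_functions \<phi> EU EV U V \<omega>1 \<omega>2 \<longleftrightarrow>
     (\<forall>\<^sub>F z in nhds 0.
        EV (Psi (sandwich V U) z) = Psi V (\<omega>1 z) \<and>
        EU (Psi (sandwich U V) z) = Psi U (\<omega>2 z) \<and>
        (\<lambda>k. boolean_cumulant \<phi> (alternating_list U V (2 * k + 1)) * z ^ (k + 1)) sums \<omega>1 z \<and>
        (\<lambda>k. boolean_cumulant \<phi> (alternating_list V U (2 * k + 1)) * z ^ (k + 1)) sums \<omega>2 z)"

end

theory Submission
  imports Defs
begin

text \<open>
  Write \<open>a = (1 - w\<^sub>2 U)\<^sup>-\<^sup>1\<close>, \<open>b = (1 - w\<^sub>1 V)\<^sup>-\<^sup>1\<close>, \<open>p = U a\<close>, \<open>q = V b\<close>, and let \<open>p\<^sub>0\<close>, \<open>q\<^sub>0\<close> be the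
  centered parts of \<open>p\<close>, \<open>q\<close>. If \<open>\<phi>(a) = \<phi>(b) = m\<close>, \<open>m w\<^sub>1 = z \<phi>(p)\<close> and \<open>m w\<^sub>2 = z \<phi>(q)\<close>, then all terms
  linear in \<open>p\<^sub>0\<close> and \<open>q\<^sub>0\<close> cancel in
  \<open>a (1 - z U V) b = m (1 - \<kappa> p\<^sub>0 q\<^sub>0)\<close>, where \<open>\<kappa> = z / m\<^sup>2\<close>. With \<open>g = a / m\<close> this turns into
  \<open>V (1 - z U V)\<^sup>-\<^sup>1 = \<phi>(q) g + g S g\<close>, where \<open>S = \<Sum>\<^sub>n \<kappa>\<^sup>n q\<^sub>0 (p\<^sub>0 q\<^sub>0)\<^sup>n\<close>. Since the words in \<open>S\<close> alternate in
  centered free elements, \<open>\<phi>(h r S r') = \<phi>(r) \<phi>(r') \<phi>(h q\<^sub>0)\<close> for \<open>h\<close> in the algebra of \<open>V\<close> and \<open>r\<close>, \<open>r'\<close> in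
  that of \<open>U\<close>. This gives all moments \<open>\<phi>(V\<^sup>k L)\<close> of the element \<open>L\<close> whose conditional expectation is
  sought, and these determine it by normality. For small \<open>z\<close>, Brouwer's theorem provides \<open>w\<^sub>1\<close> and \<open>w\<^sub>2\<close>, and
  \<open>w\<^sub>i = \<omega>\<^sub>i(z)\<close> because \<open>M\<^sub>U\<close> and \<open>M\<^sub>V\<close> are injective near \<open>0\<close> unless \<open>U\<close> or \<open>V\<close> vanishes. The
  Boolean cumulants matter only through \<open>\<omega>\<^sub>i(z) \<longlonglongrightarrow> 0\<close>.
\<close>

section \<open>Operators on a Hilbert space\<close>

text \<open>A minimizing sequence for the distance from \<open>x\<close> to \<open>S\<close> is
  Cauchy by the parallelogram law. Its limit \<open>p\<close> is the foot of the perpendicular,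
  since moving \<open>p\<close> inside \<open>S\<close> cannot shorten the distance. Only the real
  inner product enters, so the result also serves \<open>ell2\<close>.\<close>

lemma orthogonal_decomposition:
  fixes S :: "'a::{real_inner,complete_space} set"
  assumes "closed S" "subspace S"
  obtains p where "p \<in> S" "\<And>s. s \<in> S \<Longrightarrow> (x - p) \<bullet> s = 0"
proof -
  define D where "D = (INF s\<in>S. (norm (x - s))\<^sup>2)"
  have ne: "S \<noteq> {}" using assms(2) subspace_0 by blast
  have bdd: "bdd_below ((\<lambda>s. (norm (x - s))\<^sup>2) ` S)" by (intro bdd_belowI[of _ 0]) auto
  have D_le: "D \<le> (norm (x - s))\<^sup>2" if "s \<in> S" for s
    unfolding D_def by (rule cINF_lower[OF bdd that])
  have "\<exists>s\<in>S. (norm (x - s))\<^sup>2 < D + inverse (real (Suc n))" for n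
    using cINF_less_iff[OF ne bdd, of "D + inverse (real (Suc n))"] D_def by simp
  then obtain s where s: "\<And>n. s n \<in> S" "\<And>n. (norm (x - s n))\<^sup>2 < D + inverse (real (Suc n))"
    by metis
  have diff: "(norm (s m - s n))\<^sup>2 \<le> 2 * inverse (real (Suc m)) + 2 * inverse (real (Suc n))" for m n
  proof -
    \<comment> \<open>The midpoint of two members of \<open>S\<close> is in \<open>S\<close>, so its
      distance to \<open>x\<close> bounds the last term of the parallelogram law from below.\<close>
    have "(1/2) *\<^sub>R (s m + s n) \<in> S"
      by (intro subspace_scale subspace_add assms s)
    from D_le[OF this] have 1: "4 * D \<le> 4 * (norm (x - (1/2) *\<^sub>R (s m + s n)))\<^sup>2" by simp
    have "(norm (s m - s n))\<^sup>2 = 2 * (norm (x - s m))\<^sup>2 + 2 * (norm (x - s n))\<^sup>2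
      - 4 * (norm (x - (1/2) *\<^sub>R (s m + s n)))\<^sup>2"
      by (simp add: power2_norm_eq_inner inner_simps inner_commute field_simps)
    then show ?thesis using 1 s(2)[of m] s(2)[of n] by linarith
  qed
  have "Cauchy s"
  proof (rule metric_CauchyI)
    fix e :: real assume e: "e > 0"
    obtain N where N: "inverse (real (Suc N)) < e\<^sup>2 / 4"
      using reals_Archimedean[of "e\<^sup>2 / 4"] e by auto
    have "dist (s m) (s n) < e" if "m \<ge> N" "n \<ge> N" for m n
    proof -
      have "inverse (real (Suc m)) \<le> inverse (real (Suc N))"
        "inverse (real (Suc n)) \<le> inverse (real (Suc N))"
        using that by (auto intro!: le_imp_inverse_le)
      then have "(norm (s m - s n))\<^sup>2 < e\<^sup>2" using diff[of m n] N by linarith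
      then show ?thesis using e by (simp add: dist_norm power2_less_imp_less)
    qed
    then show "\<exists>N. \<forall>m\<ge>N. \<forall>n\<ge>N. dist (s m) (s n) < e" by blast
  qed
  then obtain p where p: "s \<longlonglongrightarrow> p" by (auto simp: Cauchy_convergent_iff convergent_def)
  have pS: "p \<in> S" using closed_sequentially[OF assms(1) _ p] s(1) by blast
  have "(norm (x - p))\<^sup>2 \<le> D + 0"
  proof (rule LIMSEQ_le)
    show "(\<lambda>n. (norm (x - s n))\<^sup>2) \<longlonglongrightarrow> (norm (x - p))\<^sup>2" by (intro tendsto_intros p)
    show "(\<lambda>n. D + inverse (real (Suc n))) \<longlonglongrightarrow> D + 0"
      by (intro tendsto_intros LIMSEQ_inverse_real_of_nat)
    show "\<exists>N. \<forall>n\<ge>N. (norm (x - s n))\<^sup>2 \<le> D + inverse (real (Suc n))"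
      using s(2) less_imp_le by blast
  qed
  then have min: "(norm (x - p))\<^sup>2 \<le> (norm (x - s))\<^sup>2" if "s \<in> S" for s
    using D_le[OF that] by linarith
  have "(x - p) \<bullet> s = 0" if "s \<in> S" for s
  proof (rule ccontr)
    define v where "v = x - p"
    assume "(x - p) \<bullet> s \<noteq> 0"
    then have c: "v \<bullet> s \<noteq> 0" and s0: "s \<bullet> s > 0" by (auto simp: v_def)
    \<comment> \<open>\<open>?t\<close> minimizes the quadratic polynomial
      \<open>t \<mapsto> (norm (v - t *\<^sub>R s))\<^sup>2\<close>.\<close>
    let ?t = "(v \<bullet> s) / (s \<bullet> s)"
    have "p + ?t *\<^sub>R s \<in> S" using pS that assms(2) by (intro subspace_add subspace_scale)
    from min[OF this] have "(norm v)\<^sup>2 \<le> (norm (v - ?t *\<^sub>R s))\<^sup>2" by (simp add: v_def algebra_simps)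
    also have "\<dots> = (norm v)\<^sup>2 - 2 * ?t * (v \<bullet> s) + ?t\<^sup>2 * (s \<bullet> s)"
      by (simp only: power2_norm_eq_inner inner_diff_left inner_diff_right inner_commute[of s v]
          inner_scaleR_left inner_scaleR_right) (simp add: power2_eq_square)
    also have "\<dots> = (norm v)\<^sup>2 - (v \<bullet> s)\<^sup>2 / (s \<bullet> s)"
      using s0 by (simp add: power2_eq_square field_simps)
    finally show False using c s0 by (simp add: field_simps)
  qed
  with pS show thesis by (rule that)
qed

text \<open>For \<open>f \<noteq> 0\<close>, the component \<open>e\<close> of some
  \<open>x0\<close> with \<open>f x0 \<noteq> 0\<close> orthogonal to the kernel spans the
  complement of the kernel, because \<open>y - (f y / f e) *\<^sub>R e\<close> lies in the
  kernel.\<close>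

lemma riesz_representation:
  fixes f :: "'a::{real_inner,complete_space} \<Rightarrow> real"
  assumes "bounded_linear f"
  obtains z where "\<And>y. f y = z \<bullet> y"
proof (cases "\<forall>y. f y = 0")
  case True
  then show thesis using that[of 0] by simp
next
  case False
  interpret f: bounded_linear f by fact
  obtain x0 where x0: "f x0 \<noteq> 0" using False by blast
  have "closed {y. f y = 0}"
    by (intro closed_Collect_eq continuous_intros f.continuous_on)
  moreover have "subspace {y. f y = 0}"
    by (auto simp: subspace_def f.add f.scaleR f.zero)
  ultimately obtain p where p: "f p = 0" "\<And>s. f s = 0 \<Longrightarrow> (x0 - p) \<bullet> s = 0"
    by (metis (mono_tags, lifting) mem_Collect_eq orthogonal_decomposition)
  define e where "e = x0 - p"
  have e: "f s = 0 \<Longrightarrow> e \<bullet> s = 0" for s using p(2) unfolding e_def .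
  have fe: "f e \<noteq> 0" using x0 p(1) by (simp add: e_def f.diff)
  have e0: "e \<bullet> e \<noteq> 0" using fe f.zero by auto
  have "f y = ((f e / (e \<bullet> e)) *\<^sub>R e) \<bullet> y" for y
  proof -
    have "f (y - (f y / f e) *\<^sub>R e) = 0" using fe by (simp add: f.diff f.scaleR)
    from e[OF this] have "e \<bullet> y = (f y / f e) * (e \<bullet> e)"
      by (simp add: inner_diff_right)
    then show ?thesis using fe e0 by (simp add: field_simps)
  qed
  then show thesis by (rule that)
qed

section \<open>The complex inner product recovered from its real part\<close>

lemma inner_scaleC_left: "(c *\<^sub>C x) \<bullet> y = x \<bullet> (cnj c *\<^sub>C y)" for x :: "'h::chilbert_space"
proof -
  have "cinner (c *\<^sub>C x) y = cinner x (cnj c *\<^sub>C y)"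
    by (simp add: cinner_scaleC_right cinner_commute[of "c *\<^sub>C x"] cinner_commute[of y x])
  then show ?thesis by (metis Re_cinner)
qed

lemma Im_cinner: "Im (cinner x y) = - (x \<bullet> (\<i> *\<^sub>C y))"
  by (simp add: Re_cinner[symmetric] cinner_scaleC_right)

text \<open>The imaginary part is the real inner product with \<open>\<i> *\<^sub>C f y\<close> up
  to sign, and homogeneity turns this vector into \<open>f (\<i> *\<^sub>C y)\<close>. Identities
  can therefore be checked in the real inner product.\<close>

lemma cinner_eqI:
  assumes "\<And>y. x \<bullet> f y = x' \<bullet> f' y" "\<And>c y. f (c *\<^sub>C y) = c *\<^sub>C f y" "\<And>c y. f' (c *\<^sub>C y) = c *\<^sub>C f' y"
  shows "cinner x (f y) = cinner x' (f' y)"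
  using assms(1)[of y] assms(1)[of "\<i> *\<^sub>C y"]
  by (simp add: complex_eq_iff Re_cinner Im_cinner assms(2,3))

lemma scaleC_simps [simp]:
  fixes x y :: "'a::complex_vector"
  shows "1 *\<^sub>C x = x" "0 *\<^sub>C x = 0" "c *\<^sub>C (0::'a) = 0" "(- c) *\<^sub>C x = - (c *\<^sub>C x)"
    "c *\<^sub>C (- x) = - (c *\<^sub>C x)"
proof -
  show one: "1 *\<^sub>C x = x" using scaleC_of_real[of 1 x] by simp
  show zero: "0 *\<^sub>C x = 0" using scaleC_of_real[of 0 x] by simp
  show z2: "c *\<^sub>C (0::'a) = 0" using scaleC_add_right[of c "0::'a" 0] by simp
  show "(- c) *\<^sub>C x = - (c *\<^sub>C x)"
    using scaleC_add_left[of "- c" c x] zero by (simp add: eq_neg_iff_add_eq_0)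
  show "c *\<^sub>C (- x) = - (c *\<^sub>C x)"
    using scaleC_add_right[of c "- x" x] z2 by (simp add: eq_neg_iff_add_eq_0)
qed

lemma scaleC_diff_right: "c *\<^sub>C (x - y) = c *\<^sub>C x - c *\<^sub>C y" for x :: "'a::complex_vector"
  using scaleC_add_right[of c x "- y"] by simp

lemma scaleC_diff_left: "(c - d) *\<^sub>C x = c *\<^sub>C x - d *\<^sub>C x" for x :: "'a::complex_vector"
  using scaleC_add_left[of c "- d" x] by simp

lemma scaleR_scaleC_commute: "r *\<^sub>R c *\<^sub>C x = c *\<^sub>C r *\<^sub>R x" for x :: "'a::complex_vector"
  by (simp add: scaleC_of_real[symmetric] scaleC_scaleC mult.commute)

lemma bounded_linear_cop_apply: "bounded_linear (cop_apply A)"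
  by transfer (rule blinfun.bounded_linear_right)

lemma norm_cop_apply: "norm (cop_apply A x) \<le> norm A * norm x"
  by transfer (rule norm_blinfun)

lemma norm_cop_bound: "0 \<le> b \<Longrightarrow> (\<And>x. norm (cop_apply A x) \<le> b * norm x) \<Longrightarrow> norm A \<le> b"
  by transfer (rule norm_blinfun_bound)

lemma cop_exists:
  fixes f :: "'h::chilbert_space \<Rightarrow> 'h"
  assumes add: "\<And>x y. f (x + y) = f x + f y" and scale: "\<And>c x. f (c *\<^sub>C x) = c *\<^sub>C f x"
    and bound: "\<And>x. norm (f x) \<le> K * norm x"
  obtains T where "cop_apply T = f"
proof -
  have "bounded_linear f"
    by (rule bounded_linear_intro[where K = K])
       (use add scale bound in \<open>auto simp: mult.commute simp flip: scaleC_of_real\<close>)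
  then have "blinfun_apply (Blinfun f) = f" by (rule bounded_linear_Blinfun_apply)
  then have "cop_apply (Abs_cop (Blinfun f)) = f"
    using scale by (simp add: cop_apply.rep_eq Abs_cop_inverse)
  then show thesis by (rule that)
qed

lemma cop_scale_mult [simp]:
  fixes A B :: "'h::chilbert_space cop"
  shows "(c *\<^sub>C A) * B = c *\<^sub>C (A * B)" "A * (c *\<^sub>C B) = c *\<^sub>C (A * B)"
  by (rule cop_eqI, simp)+

lemma norm_cop_scaleC: "norm (c *\<^sub>C A) = cmod c * norm A" for A :: "'h::chilbert_space cop"
proof -
  have le: "norm (c *\<^sub>C A) \<le> cmod c * norm A" for c and A :: "'h cop"
    by (rule norm_cop_bound) (auto simp: norm_scaleC mult.assoc intro!: mult_left_mono norm_cop_apply)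
  show ?thesis
  proof (cases "c = 0")
    case False
    have "norm (inverse c *\<^sub>C (c *\<^sub>C A)) \<le> cmod (inverse c) * norm (c *\<^sub>C A)" by (rule le)
    then have "cmod c * norm A \<le> norm (c *\<^sub>C A)"
      using False by (simp add: scaleC_scaleC norm_inverse norm_divide field_simps)
    with le[of c A] show ?thesis by simp
  qed simp
qed

lemma bounded_linear_scaleC_left: "bounded_linear (\<lambda>c. c *\<^sub>C A)" for A :: "'h::chilbert_space cop"
proof (rule bounded_linear_intro[where K = "norm A"])
  show "(r *\<^sub>R c) *\<^sub>C A = r *\<^sub>R c *\<^sub>C A" for r c
    by (simp only: scaleR_conv_of_real[of r c] scaleC_scaleC[symmetric] scaleC_of_real)
qed (auto simp: scaleC_add_left norm_cop_scaleC)

lemma bounded_linear_scaleC_cop: "bounded_linear (\<lambda>A::'h::chilbert_space cop. c *\<^sub>C A)"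
  by (rule bounded_linear_intro[where K = "cmod c"])
     (auto simp: scaleC_add_right norm_cop_scaleC mult.commute scaleR_scaleC_commute)

lemma tendsto_scaleC [tendsto_intros]:
  fixes g :: "'b \<Rightarrow> 'h::chilbert_space cop"
  assumes "(f \<longlongrightarrow> c) F" "(g \<longlongrightarrow> A) F"
  shows "((\<lambda>x. f x *\<^sub>C g x) \<longlongrightarrow> c *\<^sub>C A) F"
proof -
  have eq: "d *\<^sub>C B = (d *\<^sub>C 1) * B" for d and B :: "'h cop" by simp
  have "((\<lambda>x. (f x *\<^sub>C 1) * g x) \<longlongrightarrow> (c *\<^sub>C 1) * A) F"
    by (intro tendsto_mult assms bounded_linear.tendsto[OF bounded_linear_scaleC_left])
  then show ?thesis by simp
qed

section \<open>Adjoints\<close>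

text \<open>The value at \<open>x\<close> is the Riesz vector of
  \<open>y \<mapsto> x \<bullet> cop_apply A y\<close>. Testing against all vectors gives complex
  linearity, and Cauchy-Schwarz gives the bound.\<close>

lemma adj_exists:
  fixes A :: "'h::chilbert_space cop"
  obtains B where "\<And>x y. cop_apply B x \<bullet> y = x \<bullet> cop_apply A y"
proof -
  have "\<exists>z. \<forall>y. x \<bullet> cop_apply A y = z \<bullet> y" for x
    by (metis riesz_representation
        bounded_linear_compose[OF bounded_linear_inner_right bounded_linear_cop_apply])
  then obtain b where b: "\<And>x y. x \<bullet> cop_apply A y = b x \<bullet> y" by metis
  have "b (x + x') = b x + b x'" for x x'
    by (rule vector_eq_rdot[THEN iffD1]) (simp add: b[symmetric] inner_add_left)
  moreover have "b (c *\<^sub>C x) = c *\<^sub>C b x" for c x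
    by (rule vector_eq_rdot[THEN iffD1]) (simp add: b[symmetric] inner_scaleC_left)
  moreover have "norm (b x) \<le> norm A * norm x" for x
  proof -
    have "norm (b x) * norm (b x) = x \<bullet> cop_apply A (b x)"
      by (simp add: b power2_norm_eq_inner[symmetric] power2_eq_square)
    also have "\<dots> \<le> norm x * norm (cop_apply A (b x))" by (rule norm_cauchy_schwarz)
    also have "\<dots> \<le> norm x * (norm A * norm (b x))" by (intro mult_left_mono norm_cop_apply) simp
    finally have "norm (b x) * norm (b x) \<le> (norm A * norm x) * norm (b x)" by (simp add: ac_simps)
    then show ?thesis
      by (cases "norm (b x) = 0") (simp, metis mult_right_le_imp_le norm_ge_zero less_eq_real_def)
  qed
  ultimately obtain B where "cop_apply B = b" by (rule cop_exists)
  then show thesis using that[of B] b by simp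
qed

text \<open>Existence and uniqueness for the definite description in \<open>adj\<close>, which is
  phrased with \<open>cinner\<close>, are obtained from the real inner product.\<close>

lemma adj_inner: "cop_apply (adj A) x \<bullet> y = x \<bullet> cop_apply A y"
proof -
  obtain B where B: "\<And>x y. cop_apply B x \<bullet> y = x \<bullet> cop_apply A y" using adj_exists[of A] by blast
  have "cinner (cop_apply B x) (id y) = cinner x (cop_apply A y)" for x y
    by (rule cinner_eqI) (simp_all add: B)
  then have "\<forall>x y. cinner (cop_apply B x) y = cinner x (cop_apply A y)" by simp
  moreover have "C = B" if "\<forall>x y. cinner (cop_apply C x) y = cinner x (cop_apply A y)" for C
    by (rule cop_eqI) (metis that B Re_cinner vector_eq_rdot)
  ultimately have "adj A = B" unfolding adj_def by (rule the_equality)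
  with B show ?thesis by simp
qed

lemma adj_eqI: "(\<And>x y. cop_apply B x \<bullet> y = x \<bullet> cop_apply A y) \<Longrightarrow> adj A = B"
  by (rule cop_eqI) (metis adj_inner vector_eq_rdot)

lemma adj_adj [simp]: "adj (adj A) = A"
  by (rule adj_eqI) (metis adj_inner inner_commute)

lemma adj_mult: "adj (A * B) = adj B * adj A"
  by (rule adj_eqI) (simp add: adj_inner)

lemma self_adjoint_iff: "self_adjoint A \<longleftrightarrow> (\<forall>x y. cop_apply A x \<bullet> y = x \<bullet> cop_apply A y)"
  unfolding self_adjoint_def using adj_eqI adj_inner by metis

section \<open>Positive operators\<close>

text \<open>Complex positivity forces self-adjointness:
  \<open>x \<bullet> (\<i> *\<^sub>C cop_apply A x)\<close> is an imaginary part up to sign and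
  vanishes, and its polarization, taken at \<open>(- \<i>) *\<^sub>C y\<close>, is the symmetry of
  \<open>A\<close>.\<close>

lemma positive_op_iff:
  "positive_op A \<longleftrightarrow> self_adjoint A \<and> (\<forall>x. 0 \<le> x \<bullet> cop_apply A x)"
proof
  assume pos: "positive_op A"
  have nonneg: "0 \<le> x \<bullet> cop_apply A x" and im: "x \<bullet> (\<i> *\<^sub>C cop_apply A x) = 0" for x
    using pos Im_cinner[of x "cop_apply A x"]
    by (auto simp: positive_op_def complex_nonneg_Reals_iff Re_cinner)
  have "cop_apply A x \<bullet> y = x \<bullet> cop_apply A y" for x y
  proof -
    have skew: "x \<bullet> (\<i> *\<^sub>C cop_apply A y) = - (y \<bullet> (\<i> *\<^sub>C cop_apply A x))" for x y
      using im[of "x + y"] im[of x] im[of y]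
      by (simp add: bounded_linear.linear[OF bounded_linear_cop_apply, THEN linear_add]
          scaleC_add_right inner_simps)
    have "x \<bullet> (\<i> *\<^sub>C cop_apply A ((- \<i>) *\<^sub>C y)) = x \<bullet> cop_apply A y"
      by (simp only: cop_apply_simps scaleC_scaleC) simp
    moreover have "((- \<i>) *\<^sub>C y) \<bullet> (\<i> *\<^sub>C cop_apply A x) = - (y \<bullet> cop_apply A x)"
      by (simp only: inner_scaleC_left scaleC_scaleC) simp
    ultimately show ?thesis using skew[of x "(- \<i>) *\<^sub>C y"] by (simp add: inner_commute)
  qed
  with nonneg show "self_adjoint A \<and> (\<forall>x. 0 \<le> x \<bullet> cop_apply A x)"
    by (simp add: self_adjoint_iff)
next
  assume A: "self_adjoint A \<and> (\<forall>x. 0 \<le> x \<bullet> cop_apply A x)"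
  have "x \<bullet> (\<i> *\<^sub>C cop_apply A x) = 0" for x
  proof -
    have "x \<bullet> (\<i> *\<^sub>C cop_apply A x) = x \<bullet> cop_apply A (\<i> *\<^sub>C x)" by simp
    also have "\<dots> = (\<i> *\<^sub>C x) \<bullet> cop_apply A x"
      using A unfolding self_adjoint_iff by (metis inner_commute)
    also have "\<dots> = - (x \<bullet> (\<i> *\<^sub>C cop_apply A x))" by (simp add: inner_scaleC_left)
    finally show ?thesis by simp
  qed
  then show "positive_op A"
    using A by (simp add: positive_op_def complex_nonneg_Reals_iff Re_cinner Im_cinner)
qed

text \<open>The form of \<open>A\<close> along the line \<open>x + t *\<^sub>R y\<close> is a
  nonnegative polynomial of degree at most two in \<open>t\<close>, so its discriminant is not
  positive.\<close>

lemma positive_cauchy_schwarz: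
  assumes "positive_op A"
  shows "(x \<bullet> cop_apply A y)\<^sup>2 \<le> (x \<bullet> cop_apply A x) * (y \<bullet> cop_apply A y)"
proof -
  let ?a = "x \<bullet> cop_apply A x" and ?b = "x \<bullet> cop_apply A y" and ?c = "y \<bullet> cop_apply A y"
  have sym: "y \<bullet> cop_apply A x = ?b"
    using assms by (metis positive_op_iff self_adjoint_iff inner_commute)
  have quad: "0 \<le> ?a + 2 * t * ?b + t\<^sup>2 * ?c" for t
  proof -
    have "0 \<le> (x + t *\<^sub>R y) \<bullet> cop_apply A (x + t *\<^sub>R y)" using assms positive_op_iff by blast
    also have "\<dots> = ?a + 2 * t * ?b + t\<^sup>2 * ?c"
      using sym by (simp add: bounded_linear.linear[OF bounded_linear_cop_apply, THEN linear_add]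
          bounded_linear.linear[OF bounded_linear_cop_apply, THEN linear_scale]
          inner_simps power2_eq_square algebra_simps)
    finally show ?thesis .
  qed
  show ?thesis
  proof (cases "?c = 0")
    case True
    have "?b = 0"
    proof (rule ccontr)
      assume "?b \<noteq> 0"
      \<comment> \<open>At this argument the polynomial, which is affine here, has the value
        -1.\<close>
      then show False using quad[of "- (?a + 1) / (2 * ?b)"] True by (simp add: field_simps)
    qed
    then show ?thesis using True by simp
  next
    case False
    then have c: "?c > 0" using assms positive_op_iff[of A] by (metis order_le_less)
    have "0 \<le> ?c * (?a + 2 * (- ?b / ?c) * ?b + (- ?b / ?c)\<^sup>2 * ?c)"
      by (rule mult_nonneg_nonneg[OF less_imp_le[OF c] quad])
    also have "\<dots> = ?a * ?c - ?b\<^sup>2" using c by (simp add: field_simps power2_eq_square)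
    finally show ?thesis by simp
  qed
qed

text \<open>Cauchy-Schwarz for the form of \<open>A\<close> at \<open>cop_apply A x\<close> and
  \<open>x\<close> bounds the fourth power of \<open>norm (cop_apply A x)\<close> by a product of
  two values of the form.\<close>

lemma norm_positive_le:
  fixes A :: "'h::chilbert_space cop"
  assumes "positive_op A" "0 \<le> c" "\<And>x. x \<bullet> cop_apply A x \<le> c * (norm x)\<^sup>2"
  shows "norm A \<le> c"
proof (rule norm_cop_bound)
  fix x :: 'h
  let ?y = "cop_apply A x"
  have "(norm ?y)\<^sup>2 * (norm ?y)\<^sup>2 = (?y \<bullet> ?y)\<^sup>2"
    by (simp add: dot_square_norm power2_eq_square)
  also have "\<dots> \<le> (?y \<bullet> cop_apply A ?y) * (x \<bullet> ?y)" by (rule positive_cauchy_schwarz[OF assms(1)])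
  also have "\<dots> \<le> (c * (norm ?y)\<^sup>2) * (c * (norm x)\<^sup>2)"
    using assms positive_op_iff[of A] by (intro mult_mono assms(3)) auto
  finally have "(norm ?y)\<^sup>2 * (norm ?y)\<^sup>2 \<le> (c * norm x)\<^sup>2 * (norm ?y)\<^sup>2"
    by (simp add: power2_eq_square ac_simps)
  then have "(norm ?y)\<^sup>2 \<le> (c * norm x)\<^sup>2 \<or> norm ?y = 0"
    by (metis mult_right_le_imp_le zero_less_power2)
  then show "norm ?y \<le> c * norm x"
    using assms(2) by (auto intro: power2_le_imp_le)
qed fact

lemma op_inv_eq: "A * B = 1 \<Longrightarrow> B * A = 1 \<Longrightarrow> op_inv A = B"
  unfolding op_inv_def by (rule the_equality) (simp, metis mult.assoc mult_1 mult_1_right)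

section \<open>Numerical range, spectrum and norm\<close>

text \<open>\<open>m\<close> is the infimum of the numerical range. If the positive operator
  \<open>A - m\<close> were invertible, its form would be bounded below by some \<epsilon> > 0, and
  \<open>m\<close> could be enlarged.\<close>

lemma lower_bound_spectrum:
  fixes A :: "'h::chilbert_space cop"
  assumes "self_adjoint A"
  obtains m where "complex_of_real m \<in> op_spectrum A" "\<And>x. m * (norm x)\<^sup>2 \<le> x \<bullet> cop_apply A x"
proof -
  define S where "S = {c. \<forall>x. c * (norm x)\<^sup>2 \<le> x \<bullet> cop_apply A x}"
  have abs: "\<bar>x \<bullet> cop_apply A x\<bar> \<le> norm A * (norm x)\<^sup>2" for x
  proof -
    have "\<bar>x \<bullet> cop_apply A x\<bar> \<le> norm x * norm (cop_apply A x)" by (rule Cauchy_Schwarz_ineq2)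
    also have "\<dots> \<le> norm x * (norm A * norm x)" by (intro mult_left_mono norm_cop_apply) simp
    finally show ?thesis by (simp add: power2_eq_square ac_simps)
  qed
  have "- norm A \<in> S" unfolding S_def using abs by (auto simp: abs_le_iff) (metis minus_le_iff)
  then have ne: "S \<noteq> {}" by blast
  obtain e :: 'h where e: "e \<noteq> 0" using nontrivial by blast
  have "c \<le> norm A" if "c \<in> S" for c
  proof -
    have "c * (norm e)\<^sup>2 \<le> norm A * (norm e)\<^sup>2"
      using that abs[of e] unfolding S_def by (smt (verit) mem_Collect_eq)
    then show ?thesis using e by simp
  qed
  then have bdd: "bdd_above S" by (meson bdd_aboveI)
  define m where "m = Sup S"
  have low: "m * (norm x)\<^sup>2 \<le> x \<bullet> cop_apply A x" for x
  proof (cases "x = 0")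
    case False
    have "m \<le> (x \<bullet> cop_apply A x) / (norm x)\<^sup>2"
      unfolding m_def using False by (intro cSup_least ne) (auto simp: S_def field_simps)
    then show ?thesis using False by (simp add: field_simps)
  qed simp
  have "\<not> op_invertible (A - complex_of_real m *\<^sub>C 1)"
  proof
    let ?T = "A - complex_of_real m *\<^sub>C 1"
    assume "op_invertible ?T"
    then obtain B where B: "B * ?T = 1" unfolding op_invertible_def by blast
    have Tx: "cop_apply ?T x = cop_apply A x - m *\<^sub>R x" for x by (simp add: scaleC_of_real)
    have T: "positive_op ?T"
      using assms low unfolding positive_op_iff self_adjoint_iff Tx
      by (simp add: inner_simps power2_norm_eq_inner)
    have B0: "norm B > 0" "norm ?T > 0" using B by auto
    \<comment> \<open>The constant combines \<open>norm x \<le> norm B * norm ?y\<close> with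
      \<open>(norm ?y)\<^sup>2 \<le> norm ?T * (x \<bullet> ?y)\<close> for
      \<open>?y = cop_apply ?T x\<close>.\<close>
    define \<epsilon> where "\<epsilon> = 1 / ((norm B)\<^sup>2 * norm ?T)"
    have \<epsilon>: "\<epsilon> > 0" unfolding \<epsilon>_def using B0 by simp
    have "\<epsilon> * (norm x)\<^sup>2 \<le> x \<bullet> cop_apply ?T x" for x
    proof -
      let ?y = "cop_apply ?T x"
      have "((norm ?y)\<^sup>2)\<^sup>2 = (?y \<bullet> ?y)\<^sup>2" by (simp add: power2_norm_eq_inner)
      also have "\<dots> \<le> (?y \<bullet> cop_apply ?T ?y) * (x \<bullet> ?y)" by (rule positive_cauchy_schwarz[OF T])
      also have "?y \<bullet> cop_apply ?T ?y \<le> norm ?T * (norm ?y)\<^sup>2"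
      proof -
        have "?y \<bullet> cop_apply ?T ?y \<le> norm ?y * (norm ?T * norm ?y)"
          by (meson norm_cauchy_schwarz norm_cop_apply mult_left_mono norm_ge_zero order_trans)
        then show ?thesis by (simp add: power2_eq_square ac_simps)
      qed
      finally have "(norm ?y)\<^sup>2 * (norm ?y)\<^sup>2 \<le> (norm ?T * (x \<bullet> ?y)) * (norm ?y)\<^sup>2"
        using T[unfolded positive_op_iff] by (simp add: power2_eq_square ac_simps mult_right_mono)
      moreover have "0 \<le> norm ?T * (x \<bullet> ?y)" using T[unfolded positive_op_iff] by simp
      ultimately have y: "(norm ?y)\<^sup>2 \<le> norm ?T * (x \<bullet> ?y)"
        by (metis mult_right_le_imp_le norm_eq_zero zero_less_power2 power_zero_numeral)
      have "x = cop_apply B ?y" using arg_cong[OF B, of "\<lambda>T. cop_apply T x"] by simp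
      then have "norm x \<le> norm B * norm ?y" using norm_cop_apply by metis
      then have "(norm x)\<^sup>2 \<le> (norm B)\<^sup>2 * (norm ?y)\<^sup>2"
        by (metis power_mono norm_ge_zero power_mult_distrib)
      also have "\<dots> \<le> (norm B)\<^sup>2 * (norm ?T * (x \<bullet> ?y))" by (intro mult_left_mono y) simp
      finally show ?thesis unfolding \<epsilon>_def using B0 by (simp add: field_simps del: cop_apply_simps)
    qed
    then have "m + \<epsilon> \<in> S"
      unfolding S_def Tx by (simp add: inner_simps power2_norm_eq_inner algebra_simps)
    then have "m + \<epsilon> \<le> m" unfolding m_def by (rule cSup_upper[OF _ bdd])
    with \<epsilon> show False by simp
  qed
  then have "complex_of_real m \<in> op_spectrum A" by (simp add: op_spectrum_def)
  then show thesis using low by (rule that)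
qed

lemma op_invertible_minus: "op_invertible A \<Longrightarrow> op_invertible (- A)"
  unfolding op_invertible_def by (metis minus_mult_minus)

text \<open>By \<open>lower_bound_spectrum\<close> for \<open>U\<close> and \<open>- U\<close>, the
  bounds \<open>m\<close> and \<open>- l\<close> of the form of \<open>U\<close> are themselves
  spectral values. Hence \<open>- l < 1\<close>, which makes the norm bound strict.\<close>

lemma spectrum_unit_interval:
  fixes U :: "'h::chilbert_space cop"
  assumes "self_adjoint U" "op_spectrum U \<subseteq> complex_of_real ` {0..<1}"
  shows "positive_op U" "norm U < 1"
proof -
  obtain m where m: "complex_of_real m \<in> op_spectrum U" "\<And>x. m * (norm x)\<^sup>2 \<le> x \<bullet> cop_apply U x"
    using lower_bound_spectrum[OF assms(1)] by blast
  have "m \<ge> 0" using m(1) assms(2) by auto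
  then have "0 \<le> x \<bullet> cop_apply U x" for x using m(2)[of x] by (meson mult_nonneg_nonneg zero_le_power2 order_trans)
  then show pos: "positive_op U" using assms(1) by (simp add: positive_op_iff)
  have "self_adjoint (- U)" using assms(1) by (simp add: self_adjoint_iff)
  then obtain l where l: "complex_of_real l \<in> op_spectrum (- U)" "\<And>x. l * (norm x)\<^sup>2 \<le> x \<bullet> cop_apply (- U) x"
    using lower_bound_spectrum by blast
  have "complex_of_real (- l) \<in> op_spectrum U"
    using l(1) op_invertible_minus[of "U - (- complex_of_real l) *\<^sub>C 1"]
    unfolding op_spectrum_def by auto
  then have l2: "0 \<le> - l" "- l < 1" using assms(2) by (force simp flip: of_real_minus)+
  have "x \<bullet> cop_apply U x \<le> - l * (norm x)\<^sup>2" for x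
  proof -
    have "l * (norm x)\<^sup>2 \<le> - (x \<bullet> cop_apply U x)" using l(2)[of x] by simp
    then show ?thesis by linarith
  qed
  then have "norm U \<le> - l" using l2 by (intro norm_positive_le pos) auto
  then show "norm U < 1" using l2 by simp
qed


section \<open>Norm-closed algebras of operators and square roots\<close>

text \<open>Closure under adjoints is not included, so that commutants of arbitrary sets and norm
  closures of generated algebras qualify as well as von Neumann algebras.\<close>

definition closed_subalgebra :: "'h::chilbert_space cop set \<Rightarrow> bool" where
  "closed_subalgebra S \<longleftrightarrow> 1 \<in> S \<and> (\<forall>A\<in>S. \<forall>B\<in>S. A + B \<in> S \<and> A * B \<in> S) \<and>
     (\<forall>c. \<forall>A\<in>S. c *\<^sub>C A \<in> S) \<and> closed S"

context
  fixes S :: "'h::chilbert_space cop set"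
  assumes S: "closed_subalgebra S"
begin

lemma subalgebra_one: "1 \<in> S"
  and subalgebra_add: "A \<in> S \<Longrightarrow> B \<in> S \<Longrightarrow> A + B \<in> S"
  and subalgebra_mult: "A \<in> S \<Longrightarrow> B \<in> S \<Longrightarrow> A * B \<in> S"
  and subalgebra_scaleC: "A \<in> S \<Longrightarrow> c *\<^sub>C A \<in> S"
  and subalgebra_closed: "closed S"
  using S unfolding closed_subalgebra_def by auto

lemma subalgebra_scaleR: "A \<in> S \<Longrightarrow> r *\<^sub>R A \<in> S"
  using subalgebra_scaleC[of A "complex_of_real r"] by (simp add: scaleC_of_real)

lemma subalgebra_zero: "0 \<in> S"
  using subalgebra_scaleC[OF subalgebra_one, of 0] by simp

lemma subalgebra_diff: "A \<in> S \<Longrightarrow> B \<in> S \<Longrightarrow> A - B \<in> S"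
  using subalgebra_add[of A "(- 1) *\<^sub>C B"] subalgebra_scaleC[of B "- 1"] by simp

lemma subalgebra_power: "A \<in> S \<Longrightarrow> A ^ n \<in> S"
  by (induction n) (auto intro: subalgebra_one subalgebra_mult)

lemma subalgebra_suminf:
  assumes "summable f" "\<And>n. f n \<in> S"
  shows "suminf f \<in> S"
proof (rule closed_sequentially[OF subalgebra_closed])
  show "(\<lambda>n. \<Sum>i<n. f i) \<longlonglongrightarrow> suminf f" by (rule summable_LIMSEQ[OF assms(1)])
  show "(\<Sum>i<n. f i) \<in> S" for n
    by (induction n) (auto intro: subalgebra_zero subalgebra_add assms)
qed

end

lemmas subalgebra_intros = subalgebra_one subalgebra_add subalgebra_mult subalgebra_scaleC
  subalgebra_diff subalgebra_power subalgebra_zero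

section \<open>Neumann series and commutants\<close>

lemma neumann_series:
  fixes A :: "'h::chilbert_space cop"
  assumes "norm A < 1"
  shows "(1 - A) * op_inv (1 - A) = 1" "op_inv (1 - A) * (1 - A) = 1"
    "op_inv (1 - A) = (\<Sum>n. A ^ n)" "norm (op_inv (1 - A)) \<le> 1 / (1 - norm A)"
proof -
  have sum: "summable (\<lambda>n. A ^ n)" using assms by (rule complete_algebra_summable_geometric)
  have shift: "(\<Sum>n. A ^ n) = 1 + (\<Sum>n. A ^ Suc n)" using suminf_split_head[OF sum] by simp
  have 1: "(1 - A) * (\<Sum>n. A ^ n) = 1"
    using shift suminf_mult[OF sum, of A] by (simp add: algebra_simps)
  have 2: "(\<Sum>n. A ^ n) * (1 - A) = 1"
    using shift suminf_mult2[OF sum, of A] by (simp add: algebra_simps power_commutes)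
  show "op_inv (1 - A) = (\<Sum>n. A ^ n)" by (rule op_inv_eq[OF 1 2])
  with 1 2 show "(1 - A) * op_inv (1 - A) = 1" "op_inv (1 - A) * (1 - A) = 1" by simp_all
  have sr: "summable (\<lambda>n. norm A ^ n)" using assms by (intro summable_geometric) simp
  have "norm (\<Sum>n. A ^ n) \<le> (\<Sum>n. norm (A ^ n))"
    by (intro summable_norm summable_comparison_test'[OF sr, of 0]) (simp add: norm_power_ineq)
  also have "\<dots> \<le> (\<Sum>n. norm A ^ n)"
    by (intro suminf_le norm_power_ineq sr summable_comparison_test'[OF sr, of 0]) (simp add: norm_power_ineq)
  also have "\<dots> = 1 / (1 - norm A)" using assms by (intro suminf_geometric) simp
  finally show "norm (op_inv (1 - A)) \<le> 1 / (1 - norm A)"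
    using \<open>op_inv (1 - A) = _\<close> by simp
qed

lemma subalgebra_op_inv:
  assumes "closed_subalgebra S" "A \<in> S" "norm A < 1"
  shows "op_inv (1 - A) \<in> S"
  using assms by (auto simp: neumann_series(3) intro!: subalgebra_suminf subalgebra_power
      complete_algebra_summable_geometric)

text \<open>Each condition \<open>T * A = A * T\<close> is closed in norm. For
  \<open>commutant {Q}\<close> this lets a square root inherit commutation with
  \<open>Q\<close>.\<close>

lemma closed_subalgebra_commutant: "closed_subalgebra (commutant S)"
proof -
  have "commutant S = (\<Inter>A\<in>S. {T. T * A = A * T})" by (auto simp: commutant_def)
  moreover have "closed {T. T * A = A * T}" for A :: "'a cop"
    by (intro closed_Collect_eq continuous_intros)
  ultimately have "closed (commutant S)" by auto
  moreover have "A * B * C = C * (A * B)" if "A * C = C * A" "B * C = C * B" for A B C :: "'a cop"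
    using that by (metis mult.assoc)
  ultimately show ?thesis
    by (auto simp: closed_subalgebra_def commutant_def distrib_left distrib_right)
qed

text \<open>The iteration \<open>Y \<mapsto> (1 - A + Y\<^sup>2) / 2\<close> converges in norm to \<open>1 - sqrt A\<close>, since its increments are
  dominated by those of the scalar iteration \<open>y \<mapsto> (1 + y\<^sup>2) / 2\<close>.\<close>

lemma contraction_sqrt_exists:
  fixes A :: "'h::chilbert_space cop"
  assumes pos: "positive_op A" and A1: "norm A \<le> 1"
  obtains R where "positive_op R" "R * R = A" "\<And>S. closed_subalgebra S \<Longrightarrow> A \<in> S \<Longrightarrow> R \<in> S"
proof -
  have sym: "cop_apply A x \<bullet> y = x \<bullet> cop_apply A y" for x y
    using pos by (simp add: positive_op_iff self_adjoint_iff)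
  have le: "x \<bullet> cop_apply A x \<le> (norm x)\<^sup>2" for x
  proof -
    have "x \<bullet> cop_apply A x \<le> norm x * (norm A * norm x)"
      by (meson norm_cauchy_schwarz norm_cop_apply mult_left_mono norm_ge_zero order_trans)
    also have "\<dots> \<le> norm x * (1 * norm x)" by (intro mult_left_mono mult_right_mono A1) auto
    finally show ?thesis by (simp add: power2_eq_square)
  qed
  have X1: "norm (1 - A) \<le> 1"
    using le pos by (intro norm_positive_le) (auto simp: positive_op_iff self_adjoint_iff inner_simps
        power2_norm_eq_inner)
  define Y where "Y = rec_nat (0::'h cop) (\<lambda>_ T. (1/2) *\<^sub>R (1 - A + T * T))"
  define y where "y = rec_nat (0::real) (\<lambda>_ t. (1 + t * t) / 2)"
  have Y: "Y 0 = 0" "\<And>n. Y (Suc n) = (1/2) *\<^sub>R (1 - A + Y n * Y n)" by (simp_all add: Y_def)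
  have y: "y 0 = 0" "\<And>n. y (Suc n) = (1 + y n * y n) / 2" by (simp_all add: y_def)
  have y01: "0 \<le> y n \<and> y n \<le> 1" for n
  proof (induction n)
    case (Suc n)
    then have "y n * y n \<le> 1 * 1" by (intro mult_mono) auto
    then show ?case by (simp add: y)
  qed (simp add: y)
  have ynorm: "norm (Y n) \<le> y n" for n
  proof (induction n)
    case (Suc n)
    have "norm (1 - A + Y n * Y n) \<le> 1 + y n * y n"
      using Suc y01 by (intro order_trans[OF norm_triangle_ineq] add_mono X1
          order_trans[OF norm_mult_ineq] mult_mono) auto
    then show ?case by (simp add: Y y)
  qed (simp add: Y y)
  have step: "norm (Y (Suc n) - Y n) \<le> y (Suc n) - y n" for n
  proof (induction n)
    case 0
    then show ?case using X1 by (simp add: Y y)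
  next
    case (Suc n)
    let ?d = "Y (Suc n) - Y n" and ?e = "y (Suc n) - y n"
    \<comment> \<open>\<open>C * C - D * D = C * (C - D) + (C - D) * D\<close> holds without
      commutativity.\<close>
    have "Y (Suc (Suc n)) - Y (Suc n) = (1/2) *\<^sub>R (Y (Suc n) * ?d + ?d * Y n)"
      using arg_cong2[where f = minus, OF Y(2)[of "Suc n"] Y(2)[of n]]
      by (simp only: scaleR_diff_right[symmetric]) (simp add: algebra_simps)
    then have "norm (Y (Suc (Suc n)) - Y (Suc n)) = norm (Y (Suc n) * ?d + ?d * Y n) / 2" by simp
    also have "\<dots> \<le> (y (Suc n) * ?e + ?e * y n) / 2"
      using ynorm Suc y01 order_trans[OF norm_ge_zero Suc] by (intro divide_right_mono order_trans[OF norm_triangle_ineq] add_mono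
          order_trans[OF norm_mult_ineq] mult_mono) (auto intro: order_trans[OF norm_ge_zero])
    also have "\<dots> = y (Suc (Suc n)) - y (Suc n)"
      using arg_cong2[where f = minus, OF y(2)[of "Suc n"] y(2)[of n]] by (simp add: field_simps)
    finally show ?case .
  qed
  have "incseq y"
    by (intro incseq_SucI) (metis step norm_ge_zero order_trans diff_ge_0_iff_ge)
  moreover have "bdd_above (range y)" using y01 by (intro bdd_aboveI[of _ 1]) auto
  ultimately have "convergent y"
    by (metis LIMSEQ_incseq_SUP convergentI)
  then have "summable (\<lambda>n. y (Suc n) - y n)"
    by (metis convergent_def telescope_summable)
  then have "summable (\<lambda>n. Y (Suc n) - Y n)"
    by (rule summable_comparison_test'[of _ 0]) (rule step)
  then have "convergent (\<lambda>n. \<Sum>i<n. Y (Suc i) - Y i)" by (simp add: summable_iff_convergent)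
  then have "convergent Y" by (simp add: sum_lessThan_telescope Y(1))
  then obtain T where T: "Y \<longlonglongrightarrow> T" by (auto simp: convergent_def)
  have "(\<lambda>n. Y (Suc n)) \<longlonglongrightarrow> (1/2) *\<^sub>R (1 - A + T * T)"
    unfolding Y(2) by (intro tendsto_intros T)
  then have fixp: "T = (1/2) *\<^sub>R (1 - A + T * T)"
    using LIMSEQ_unique[OF LIMSEQ_Suc[OF T]] by blast
  \<comment> \<open>The fixed point equation says \<open>(1 - T) * (1 - T) = A\<close>. The root
    \<open>1 - T\<close> is positive because \<open>T\<close> is symmetric of norm at most
    1.\<close>
  have "2 *\<^sub>R T = 2 *\<^sub>R ((1/2) *\<^sub>R (1 - A + T * T))" using fixp by (rule arg_cong)
  then have "T + T = 1 - A + T * T" by (simp add: scaleR_2)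
  then have sq: "(1 - T) * (1 - T) = A" by (simp add: algebra_simps)
  have mem: "1 - T \<in> S" if S: "closed_subalgebra S" "A \<in> S" for S
  proof -
    have "Y n \<in> S" for n
      by (induction n) (auto simp: Y intro!: subalgebra_intros[OF S(1)] subalgebra_scaleR[OF S(1)] S(2))
    then have "T \<in> S" by (rule closed_sequentially[OF subalgebra_closed[OF S(1)] _ T])
    then show ?thesis by (intro subalgebra_intros[OF S(1)])
  qed
  have Ysym: "cop_apply (Y n) x \<bullet> w = x \<bullet> cop_apply (Y n) w" for n x w
    by (induction n arbitrary: x w) (simp_all add: Y inner_simps sym)
  have app: "(\<lambda>n. cop_apply (Y n) x) \<longlonglongrightarrow> cop_apply T x" for x
  proof -
    have "(\<lambda>n. norm (Y n - T) * norm x) \<longlonglongrightarrow> 0"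
      using T by (intro tendsto_mult_left_zero) (simp add: tendsto_norm_zero_iff LIM_zero_iff)
    then have "(\<lambda>n. cop_apply (Y n - T) x) \<longlonglongrightarrow> 0"
      by (rule Lim_null_comparison[rotated]) (intro always_eventually allI norm_cop_apply)
    then show ?thesis by (simp add: LIM_zero_iff)
  qed
  have Tsym: "cop_apply T x \<bullet> w = x \<bullet> cop_apply T w" for x w
    by (rule LIMSEQ_unique[of "\<lambda>n. cop_apply (Y n) x \<bullet> w"])
       (use tendsto_inner[OF app tendsto_const] tendsto_inner[OF tendsto_const app] Ysym in simp_all)
  have "norm T \<le> 1"
    by (rule LIMSEQ_le_const2[OF tendsto_norm[OF T]]) (meson ynorm y01 order_trans)
  have "x \<bullet> cop_apply T x \<le> x \<bullet> x" for x
  proof -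
    have "x \<bullet> cop_apply T x \<le> norm x * (norm T * norm x)"
      by (meson norm_cauchy_schwarz norm_cop_apply mult_left_mono norm_ge_zero order_trans)
    also have "\<dots> \<le> norm x * (1 * norm x)"
      by (intro mult_left_mono mult_right_mono \<open>norm T \<le> 1\<close>) auto
    finally show ?thesis by (simp add: power2_eq_square flip: power2_norm_eq_inner)
  qed
  then have "positive_op (1 - T)"
    by (simp add: positive_op_iff self_adjoint_iff inner_simps Tsym)
  then show thesis using sq mem by (rule that)
qed

lemma positive_scaleR: "positive_op A \<Longrightarrow> 0 \<le> c \<Longrightarrow> positive_op (c *\<^sub>R A)"
  by (simp add: positive_op_iff self_adjoint_iff)

lemma sqrt_exists:
  fixes A :: "'h::chilbert_space cop"
  assumes "positive_op A"
  obtains R where "positive_op R" "R * R = A" "\<And>S. closed_subalgebra S \<Longrightarrow> A \<in> S \<Longrightarrow> R \<in> S"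
proof -
  define c where "c = norm A + 1"
  have c: "c > 0" "norm A \<le> c" by (auto simp: c_def add_pos_nonneg add.commute)
  have "positive_op ((1/c) *\<^sub>R A)" "norm ((1/c) *\<^sub>R A) \<le> 1"
    using c assms by (auto intro!: positive_scaleR simp: field_simps)
  then obtain R where R: "positive_op R" "R * R = (1/c) *\<^sub>R A"
    "\<And>S. closed_subalgebra S \<Longrightarrow> (1/c) *\<^sub>R A \<in> S \<Longrightarrow> R \<in> S"
    using contraction_sqrt_exists by blast
  show thesis
  proof (rule that[of "sqrt c *\<^sub>R R"])
    show "positive_op (sqrt c *\<^sub>R R)" using R(1) c by (intro positive_scaleR) auto
    show "(sqrt c *\<^sub>R R) * (sqrt c *\<^sub>R R) = A" using R(2) c by simp
    show "sqrt c *\<^sub>R R \<in> S" if "closed_subalgebra S" "A \<in> S" for S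
      using R(3)[OF that(1)] that by (auto intro: subalgebra_scaleR)
  qed
qed

lemma positive_inner_zero:
  assumes "positive_op A" "x \<bullet> cop_apply A x = 0"
  shows "cop_apply A x = 0"
  using positive_cauchy_schwarz[OF assms(1), of "cop_apply A x" x] assms(2) by simp

text \<open>A competing root \<open>Q\<close> commutes with \<open>A\<close>, hence with the
  constructed root \<open>R\<close>, which lies in every closed algebra containing \<open>A\<close>.
  Then \<open>(R + Q) * (R - Q) = 0\<close>, and positivity makes both \<open>R\<close> and
  \<open>Q\<close> vanish on the range of \<open>R - Q\<close>.\<close>

lemma op_sqrt:
  fixes A :: "'h::chilbert_space cop"
  assumes "positive_op A"
  shows "positive_op (op_sqrt A)" "op_sqrt A * op_sqrt A = A"
    "closed_subalgebra S \<Longrightarrow> A \<in> S \<Longrightarrow> op_sqrt A \<in> S"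
proof -
  obtain R where R: "positive_op R" "R * R = A" "\<And>S. closed_subalgebra S \<Longrightarrow> A \<in> S \<Longrightarrow> R \<in> S"
    using sqrt_exists[OF assms] by blast
  have unique: "Q = R" if Q: "positive_op Q" "Q * Q = A" for Q
  proof -
    have "A \<in> commutant {Q}" using Q(2) by (auto simp: commutant_def mult.assoc)
    then have "R * Q = Q * R" using R(3)[OF closed_subalgebra_commutant] by (auto simp: commutant_def)
    then have zero: "(R + Q) * (R - Q) = 0" using R(2) Q(2) by (simp add: algebra_simps)
    show ?thesis
    proof (rule cop_eqI)
      fix x
      let ?y = "cop_apply R x - cop_apply Q x"
      have sum0: "cop_apply R ?y + cop_apply Q ?y = 0"
        using arg_cong[OF zero, of "\<lambda>T. cop_apply T x"] by simp
      have "?y \<bullet> cop_apply R ?y + ?y \<bullet> cop_apply Q ?y = 0"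
        using arg_cong[OF sum0, of "\<lambda>v. ?y \<bullet> v"] by (simp only: inner_add_right inner_zero_right)
      moreover have "0 \<le> ?y \<bullet> cop_apply R ?y" "0 \<le> ?y \<bullet> cop_apply Q ?y"
        using R(1) Q(1) unfolding positive_op_iff by blast+
      ultimately have "cop_apply R ?y = 0" "cop_apply Q ?y = 0"
        using positive_inner_zero R(1) Q(1) by (metis add_nonneg_eq_0_iff)+
      \<comment> \<open>\<open>?y\<close> is the image of \<open>x\<close> under the symmetric
        operator \<open>R - Q\<close>, so this difference equals
        \<open>?y \<bullet> ?y\<close>.\<close>
      then have "x \<bullet> cop_apply R ?y - x \<bullet> cop_apply Q ?y = 0" by simp
      then have "?y \<bullet> ?y = 0"
        using R(1) Q(1) unfolding positive_op_iff self_adjoint_iff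
        by (metis inner_diff_left)
      then show "cop_apply Q x = cop_apply R x" by simp
    qed
  qed
  have "op_sqrt A = R"
    unfolding op_sqrt_def by (rule the_equality) (use R(1,2) unique in blast)+
  with R show "positive_op (op_sqrt A)" "op_sqrt A * op_sqrt A = A"
    "closed_subalgebra S \<Longrightarrow> A \<in> S \<Longrightarrow> op_sqrt A \<in> S" by auto
qed

section \<open>Amplification and the density of polynomials\<close>

text \<open>The Hilbert space \<open>\<ell>\<^sup>2 \<otimes> 'h\<close>, on which normal functionals become vector functionals.\<close>

typedef (overloaded) ('h::chilbert_space) ell2 = "{x :: nat \<Rightarrow> 'h. summable (\<lambda>n. (norm (x n))\<^sup>2)}"
  morphisms ell2_nth Abs_ell2
  by (rule exI[of _ "\<lambda>_. 0"]) simp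

setup_lifting type_definition_ell2

lemma summable_norm_sq_add:
  fixes x y :: "nat \<Rightarrow> 'h::real_inner"
  assumes "summable (\<lambda>n. (norm (x n))\<^sup>2)" "summable (\<lambda>n. (norm (y n))\<^sup>2)"
  shows "summable (\<lambda>n. (norm (x n + y n))\<^sup>2)"
proof (rule summable_comparison_test'[of "\<lambda>n. 2 * (norm (x n))\<^sup>2 + 2 * (norm (y n))\<^sup>2" 0])
  show "summable (\<lambda>n. 2 * (norm (x n))\<^sup>2 + 2 * (norm (y n))\<^sup>2)"
    by (intro summable_add summable_mult assms)
  show "norm ((norm (x n + y n))\<^sup>2) \<le> 2 * (norm (x n))\<^sup>2 + 2 * (norm (y n))\<^sup>2" for n
  proof -
    have "(norm (x n + y n))\<^sup>2 + (norm (x n - y n))\<^sup>2 = 2 * (norm (x n))\<^sup>2 + 2 * (norm (y n))\<^sup>2"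
      by (simp add: power2_norm_eq_inner inner_simps inner_commute)
    then show ?thesis by (smt (verit) real_norm_def zero_le_power2)
  qed
qed

lemma summable_norm_sq_diff:
  fixes x y :: "nat \<Rightarrow> 'h::real_inner"
  assumes "summable (\<lambda>n. (norm (x n))\<^sup>2)" "summable (\<lambda>n. (norm (y n))\<^sup>2)"
  shows "summable (\<lambda>n. (norm (x n - y n))\<^sup>2)"
  using summable_norm_sq_add[of x "\<lambda>n. - y n"] assms by simp

lemma summable_inner:
  fixes x y :: "nat \<Rightarrow> 'h::real_inner"
  assumes "summable (\<lambda>n. (norm (x n))\<^sup>2)" "summable (\<lambda>n. (norm (y n))\<^sup>2)"
  shows "summable (\<lambda>n. x n \<bullet> y n)"
proof (rule summable_comparison_test'[of "\<lambda>n. (norm (x n))\<^sup>2 + (norm (y n))\<^sup>2" 0])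
  show "summable (\<lambda>n. (norm (x n))\<^sup>2 + (norm (y n))\<^sup>2)" by (intro summable_add assms)
  show "norm (x n \<bullet> y n) \<le> (norm (x n))\<^sup>2 + (norm (y n))\<^sup>2" for n
  proof -
    have "0 \<le> norm (x n) * norm (y n)" by simp
    then show ?thesis
      using Cauchy_Schwarz_ineq2[of "x n" "y n"] sum_squares_bound[of "norm (x n)" "norm (y n)"]
      by (simp only: real_norm_def)
  qed
qed

instantiation ell2 :: (chilbert_space) real_inner
begin

lift_definition zero_ell2 :: "'a ell2" is "\<lambda>_. 0" by simp
lift_definition plus_ell2 :: "'a ell2 \<Rightarrow> 'a ell2 \<Rightarrow> 'a ell2" is "\<lambda>x y n. x n + y n"
  by (rule summable_norm_sq_add)
lift_definition uminus_ell2 :: "'a ell2 \<Rightarrow> 'a ell2" is "\<lambda>x n. - x n" by simp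
lift_definition minus_ell2 :: "'a ell2 \<Rightarrow> 'a ell2 \<Rightarrow> 'a ell2" is "\<lambda>x y n. x n - y n"
  by (rule summable_norm_sq_diff)
lift_definition scaleR_ell2 :: "real \<Rightarrow> 'a ell2 \<Rightarrow> 'a ell2" is "\<lambda>r x n. r *\<^sub>R x n"
  by (simp add: power_mult_distrib summable_mult)
lift_definition inner_ell2 :: "'a ell2 \<Rightarrow> 'a ell2 \<Rightarrow> real" is "\<lambda>x y. \<Sum>n. x n \<bullet> y n" .

definition norm_ell2 :: "'a ell2 \<Rightarrow> real" where "norm_ell2 x = sqrt (inner x x)"
definition sgn_ell2 :: "'a ell2 \<Rightarrow> 'a ell2" where "sgn_ell2 x = scaleR (inverse (norm x)) x"
definition dist_ell2 :: "'a ell2 \<Rightarrow> 'a ell2 \<Rightarrow> real" where "dist_ell2 x y = norm (x - y)"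
definition "(uniformity :: ('a ell2 \<times> 'a ell2) filter)
  = (INF e\<in>{0<..}. principal {(x, y). dist x y < e})"
definition open_ell2 :: "'a ell2 set \<Rightarrow> bool" where
  "open_ell2 S = (\<forall>x\<in>S. \<forall>\<^sub>F (x', y) in uniformity. x' = x \<longrightarrow> y \<in> S)"

instance
proof
  fix x y z :: "'a ell2" and r s :: real and S :: "'a ell2 set"
  show "x + y + z = x + (y + z)" by transfer (simp add: add.assoc)
  show "x + y = y + x" by transfer (simp add: add.commute)
  show "0 + x = x" by transfer simp
  show "- x + x = 0" by transfer simp
  show "x - y = x + - y" by transfer simp
  show "r *\<^sub>R (x + y) = r *\<^sub>R x + r *\<^sub>R y" by transfer (simp add: scaleR_add_right)
  show "(r + s) *\<^sub>R x = r *\<^sub>R x + s *\<^sub>R x" by transfer (simp add: scaleR_add_left)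
  show "r *\<^sub>R s *\<^sub>R x = (r * s) *\<^sub>R x" by transfer simp
  show "1 *\<^sub>R x = x" by transfer simp
  show "sgn x = inverse (norm x) *\<^sub>R x" by (rule sgn_ell2_def)
  show "dist x y = norm (x - y)" by (rule dist_ell2_def)
  show "(uniformity :: ('a ell2 \<times> 'a ell2) filter)
    = (INF e\<in>{0<..}. principal {(x, y). dist x y < e})" by (rule uniformity_ell2_def)
  show "open S = (\<forall>x\<in>S. \<forall>\<^sub>F (x', y) in uniformity. x' = x \<longrightarrow> y \<in> S)" by (rule open_ell2_def)
  show "x \<bullet> y = y \<bullet> x" by transfer (simp add: inner_commute)
  show "(x + y) \<bullet> z = x \<bullet> z + y \<bullet> z"
    by transfer (simp add: inner_add_left suminf_add summable_inner)
  show "(r *\<^sub>R x) \<bullet> y = r * (x \<bullet> y)"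
    by transfer (simp add: suminf_mult summable_inner)
  show "0 \<le> x \<bullet> x" by transfer (simp add: suminf_nonneg summable_inner)
  show "(x \<bullet> x = 0) = (x = 0)"
    by transfer (subst suminf_eq_zero_iff, auto simp: summable_inner)
  show "norm x = sqrt (x \<bullet> x)" by (rule norm_ell2_def)
qed

end

lemma ell2_nth_simps [simp]:
  "ell2_nth 0 n = 0" "ell2_nth (x + y) n = ell2_nth x n + ell2_nth y n"
  "ell2_nth (x - y) n = ell2_nth x n - ell2_nth y n" "ell2_nth (r *\<^sub>R x) n = r *\<^sub>R ell2_nth x n"
  by (transfer; simp)+

lemma summable_ell2: "summable (\<lambda>n. (norm (ell2_nth x n))\<^sup>2)"
  using ell2_nth[of x] by simp

lemma ell2_nth_Abs: "summable (\<lambda>n. (norm (f n))\<^sup>2) \<Longrightarrow> ell2_nth (Abs_ell2 f) = f"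
  by (simp add: Abs_ell2_inverse)

lemma inner_ell2_sums: "(\<lambda>n. ell2_nth x n \<bullet> ell2_nth y n) sums (x \<bullet> y)"
  unfolding inner_ell2.rep_eq by (intro summable_sums summable_inner summable_ell2)

lemma norm_ell2_sq: "(norm x)\<^sup>2 = (\<Sum>n. (norm (ell2_nth x n))\<^sup>2)"
  by (simp add: power2_norm_eq_inner inner_ell2.rep_eq)

lemma sum_le_norm_ell2: "(\<Sum>n<K. (norm (ell2_nth x n))\<^sup>2) \<le> (norm x)\<^sup>2"
  unfolding norm_ell2_sq by (rule sum_le_suminf[OF summable_ell2]) auto

lemma norm_ell2_nth: "norm (ell2_nth x n) \<le> norm x"
proof -
  have "(norm (ell2_nth x n))\<^sup>2 \<le> (\<Sum>i<Suc n. (norm (ell2_nth x i))\<^sup>2)"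
    by (rule member_le_sum) auto
  also have "\<dots> \<le> (norm x)\<^sup>2" by (rule sum_le_norm_ell2)
  finally show ?thesis by (rule power2_le_imp_le) simp
qed

text \<open>Coordinates are contractions and therefore converge. The Cauchy estimate passes to the
  limit in finite partial sums, uniformly in their length \<open>K\<close>.\<close>

instance ell2 :: (chilbert_space) complete_space
proof
  fix X :: "nat \<Rightarrow> 'a ell2"
  assume C: "Cauchy X"
  have "Cauchy (\<lambda>m. ell2_nth (X m) k)" for k
  proof (rule metric_CauchyI)
    fix e :: real assume "e > 0"
    then obtain N where N: "\<forall>m\<ge>N. \<forall>n\<ge>N. dist (X m) (X n) < e"
      using C metric_CauchyD by blast
    have "dist (ell2_nth (X m) k) (ell2_nth (X n) k) \<le> dist (X m) (X n)" for m n
      using norm_ell2_nth[of "X m - X n" k] by (simp add: dist_norm)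
    with N show "\<exists>N. \<forall>m\<ge>N. \<forall>n\<ge>N. dist (ell2_nth (X m) k) (ell2_nth (X n) k) < e"
      by (meson le_less_trans)
  qed
  then obtain l where l: "\<And>k. (\<lambda>m. ell2_nth (X m) k) \<longlonglongrightarrow> l k"
    unfolding Cauchy_convergent_iff convergent_def by metis
  have tail: "\<exists>N. \<forall>m\<ge>N. \<forall>K. (\<Sum>k<K. (norm (ell2_nth (X m) k - l k))\<^sup>2) \<le> e\<^sup>2" if "e > 0" for e :: real
  proof -
    obtain N where N: "\<And>m n. m \<ge> N \<Longrightarrow> n \<ge> N \<Longrightarrow> dist (X m) (X n) < e"
      using C \<open>e > 0\<close> metric_CauchyD by blast
    have "(\<Sum>k<K. (norm (ell2_nth (X m) k - l k))\<^sup>2) \<le> e\<^sup>2" if "m \<ge> N" for m K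
    proof (rule LIMSEQ_le_const2)
      show "(\<lambda>n. \<Sum>k<K. (norm (ell2_nth (X m) k - ell2_nth (X n) k))\<^sup>2)
          \<longlonglongrightarrow> (\<Sum>k<K. (norm (ell2_nth (X m) k - l k))\<^sup>2)"
        by (intro tendsto_intros l)
      have "(\<Sum>k<K. (norm (ell2_nth (X m) k - ell2_nth (X n) k))\<^sup>2) \<le> e\<^sup>2" if "n \<ge> N" for n
      proof -
        have "(\<Sum>k<K. (norm (ell2_nth (X m - X n) k))\<^sup>2) \<le> (norm (X m - X n))\<^sup>2"
          by (rule sum_le_norm_ell2)
        also have "\<dots> \<le> e\<^sup>2"
          using N[OF \<open>m \<ge> N\<close> that] by (intro power_mono) (auto simp: dist_norm)
        finally show ?thesis by simp
      qed
      then show "\<exists>N. \<forall>n\<ge>N. (\<Sum>k<K. (norm (ell2_nth (X m) k - ell2_nth (X n) k))\<^sup>2) \<le> e\<^sup>2" by blast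
    qed
    then show ?thesis by blast
  qed
  have sum_diff: "summable (\<lambda>k. (norm (ell2_nth (X m) k - l k))\<^sup>2)"
    if "\<forall>K. (\<Sum>k<K. (norm (ell2_nth (X m) k - l k))\<^sup>2) \<le> e\<^sup>2" for m e
    using that by (intro summableI_nonneg_bounded) auto
  obtain N1 where N1: "\<forall>m\<ge>N1. \<forall>K. (\<Sum>k<K. (norm (ell2_nth (X m) k - l k))\<^sup>2) \<le> 1\<^sup>2"
    using tail[of 1] by auto
  \<comment> \<open>\<open>l\<close> is written as a difference of two square-summable
    sequences.\<close>
  have "summable (\<lambda>k. (norm (ell2_nth (X N1) k - (ell2_nth (X N1) k - l k)))\<^sup>2)"
    by (rule summable_norm_sq_diff[OF summable_ell2 sum_diff[of N1 1]]) (use N1 in blast)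
  then have L: "ell2_nth (Abs_ell2 l) = l" by (simp add: ell2_nth_Abs)
  have "X \<longlonglongrightarrow> Abs_ell2 l"
  proof (rule metric_LIMSEQ_I)
    fix r :: real assume "r > 0"
    then obtain N where N: "\<forall>m\<ge>N. \<forall>K. (\<Sum>k<K. (norm (ell2_nth (X m) k - l k))\<^sup>2) \<le> (r/2)\<^sup>2"
      using tail[of "r/2"] by auto
    have "dist (X m) (Abs_ell2 l) < r" if "m \<ge> N" for m
    proof -
      have "(norm (X m - Abs_ell2 l))\<^sup>2 \<le> (r/2)\<^sup>2"
        unfolding norm_ell2_sq using N that sum_diff[of m "r/2"]
        by (intro suminf_le_const) (auto simp: L)
      then have "norm (X m - Abs_ell2 l) \<le> r/2"
        by (rule power2_le_imp_le) (use \<open>r > 0\<close> in simp)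
      then show ?thesis using \<open>r > 0\<close> by (simp add: dist_norm)
    qed
    then show "\<exists>N. \<forall>m\<ge>N. dist (X m) (Abs_ell2 l) < r" by blast
  qed
  then show "convergent X" by (rule convergentI)
qed

section \<open>Coordinate vectors and amplified operators\<close>

lift_definition ell2_single :: "nat \<Rightarrow> 'h \<Rightarrow> 'h::chilbert_space ell2" is
  "\<lambda>j h n. if n = j then h else 0"
  by (rule summable_finite[of "{_}"]) auto

lemma ell2_nth_single [simp]: "ell2_nth (ell2_single j h) n = (if n = j then h else 0)"
  by transfer simp

lemma ell2_eqI: "(\<And>n. ell2_nth x n = ell2_nth y n) \<Longrightarrow> x = y"
  by (simp add: ell2_nth_inject[symmetric] fun_eq_iff)

lemma norm_ell2_single [simp]: "norm (ell2_single j h) = norm h"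
proof -
  have "(norm (ell2_single j h))\<^sup>2 = (\<Sum>n\<in>{j}. (norm (ell2_nth (ell2_single j h) n))\<^sup>2)"
    unfolding norm_ell2_sq by (rule suminf_finite) auto
  then show ?thesis by simp
qed

lemma ell2_nth_sum: "ell2_nth (\<Sum>i\<in>I. f i) n = (\<Sum>i\<in>I. ell2_nth (f i) n)"
  by (induction I rule: infinite_finite_induct) auto

text \<open>The squared norm of the remainder is a tail of the convergent series of squared
  coordinate norms.\<close>

lemma ell2_single_sums: "(\<lambda>j. ell2_single j (ell2_nth x j)) sums x"
  unfolding sums_def
proof (rule LIM_zero_cancel, rule tendsto_norm_zero_cancel)
  let ?d = "\<lambda>n. (\<Sum>j<n. ell2_single j (ell2_nth x j)) - x"
  have nth: "ell2_nth (?d n) k = (if k < n then 0 else - ell2_nth x k)" for n k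
    by (auto simp: ell2_nth_sum sum.delta)
  have "(norm (?d n))\<^sup>2 = (norm x)\<^sup>2 - (\<Sum>k<n. (norm (ell2_nth x k))\<^sup>2)" for n
  proof -
    have "(norm (?d n))\<^sup>2 = (\<Sum>k. (norm (ell2_nth (?d n) (k + n)))\<^sup>2)
        + (\<Sum>k<n. (norm (ell2_nth (?d n) k))\<^sup>2)"
      unfolding norm_ell2_sq by (rule suminf_split_initial_segment[OF summable_ell2])
    also have "\<dots> = (\<Sum>k. (norm (ell2_nth x (k + n)))\<^sup>2)"
      unfolding nth by (simp add: sum.neutral)
    also have "\<dots> = (norm x)\<^sup>2 - (\<Sum>k<n. (norm (ell2_nth x k))\<^sup>2)"
      unfolding norm_ell2_sq by (rule suminf_minus_initial_segment[OF summable_ell2])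
    finally show ?thesis .
  qed
  moreover have "(\<lambda>n. (norm x)\<^sup>2 - (\<Sum>k<n. (norm (ell2_nth x k))\<^sup>2)) \<longlonglongrightarrow> (norm x)\<^sup>2 - (norm x)\<^sup>2"
    unfolding norm_ell2_sq[of x] by (intro tendsto_intros summable_LIMSEQ summable_ell2)
  ultimately have "(\<lambda>n. (norm (?d n))\<^sup>2) \<longlonglongrightarrow> 0" by simp
  then have "(\<lambda>n. sqrt ((norm (?d n))\<^sup>2)) \<longlonglongrightarrow> sqrt 0" by (rule tendsto_real_sqrt)
  then show "(\<lambda>n. norm (?d n)) \<longlonglongrightarrow> 0" by simp
qed

lemma bounded_linear_ell2_eqI:
  assumes "bounded_linear F" "bounded_linear G" "\<And>j h. F (ell2_single j h) = G (ell2_single j h)"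
  shows "F x = G x"
proof (rule sums_unique2)
  show "(\<lambda>j. F (ell2_single j (ell2_nth x j))) sums F x"
    by (rule bounded_linear.sums[OF assms(1) ell2_single_sums])
  show "(\<lambda>j. F (ell2_single j (ell2_nth x j))) sums G x"
    unfolding assms(3) by (rule bounded_linear.sums[OF assms(2) ell2_single_sums])
qed

lemma summable_amplify:
  assumes "summable (\<lambda>n. (norm (x n))\<^sup>2)"
  shows "summable (\<lambda>n. (norm (cop_apply A (x n)))\<^sup>2)"
proof (rule summable_comparison_test'[of "\<lambda>n. (norm A)\<^sup>2 * (norm (x n))\<^sup>2" 0])
  show "norm ((norm (cop_apply A (x n)))\<^sup>2) \<le> (norm A)\<^sup>2 * (norm (x n))\<^sup>2" for n
    using power_mono[OF norm_cop_apply norm_ge_zero, of A "x n" 2] by (simp add: power_mult_distrib)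
qed (intro summable_mult assms)

text \<open>This is \<open>1 \<otimes> A\<close>. It is a plain function because \<open>ell2\<close>
  is given only its real Hilbert space structure; complex scalars act as
  \<open>amplify (c *\<^sub>C 1)\<close>.\<close>

lift_definition amplify :: "'h::chilbert_space cop \<Rightarrow> 'h ell2 \<Rightarrow> 'h ell2" is
  "\<lambda>A x n. cop_apply A (x n)"
  by (rule summable_amplify)

lemma ell2_nth_amplify [simp]: "ell2_nth (amplify A x) n = cop_apply A (ell2_nth x n)"
  by transfer simp

lemma norm_amplify: "norm (amplify A x) \<le> norm A * norm x"
proof (rule power2_le_imp_le)
  have "(norm (amplify A x))\<^sup>2 \<le> (\<Sum>n. (norm A)\<^sup>2 * (norm (ell2_nth x n))\<^sup>2)"
    unfolding norm_ell2_sq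
  proof (rule suminf_le[OF _ summable_ell2 summable_mult[OF summable_ell2]])
    show "(norm (ell2_nth (amplify A x) n))\<^sup>2 \<le> (norm A)\<^sup>2 * (norm (ell2_nth x n))\<^sup>2" for n
      using power_mono[OF norm_cop_apply norm_ge_zero, of A "ell2_nth x n" 2]
      by (simp add: power_mult_distrib)
  qed
  then show "(norm (amplify A x))\<^sup>2 \<le> (norm A * norm x)\<^sup>2"
    by (simp add: suminf_mult summable_ell2 norm_ell2_sq[of x] power_mult_distrib)
qed simp

lemma cop_apply_add: "cop_apply A (x + y) = cop_apply A x + cop_apply A y"
  and cop_apply_scaleR: "cop_apply A (r *\<^sub>R x) = r *\<^sub>R cop_apply A x"
  using bounded_linear_cop_apply[of A] by (simp_all add: linear_simps)

lemma bounded_linear_amplify: "bounded_linear (amplify A)"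
  by (rule bounded_linear_intro[where K = "norm A"])
     (use norm_amplify[of A] in
       \<open>auto intro!: ell2_eqI simp: cop_apply_add cop_apply_scaleR mult.commute\<close>)

lemma bounded_linear_amplify_left: "bounded_linear (\<lambda>A. amplify A x)"
  by (rule bounded_linear_intro[where K = "norm x"]) (auto intro!: ell2_eqI norm_amplify)

lemma amplify_adj: "amplify A x \<bullet> y = x \<bullet> amplify (adj A) y"
proof (rule sums_unique2[OF inner_ell2_sums])
  show "(\<lambda>n. ell2_nth (amplify A x) n \<bullet> ell2_nth y n) sums (x \<bullet> amplify (adj A) y)"
    using inner_ell2_sums[of x "amplify (adj A) y"] by (simp add: adj_inner inner_commute)
       (metis (no_types, lifting) adj_inner inner_commute sums_cong)
qed

lemma amplify_mult: "amplify (A * B) x = amplify A (amplify B x)"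
  by (rule ell2_eqI) simp

text \<open>The projection onto the orthogonal complement of the cyclic subspace of \<open>\<xi>\<close> commutes with the
  amplification of \<open>V\<close>. Its matrix entries therefore lie in the commutant of \<open>V\<close>, and it commutes
  with the amplification of \<open>D\<close>, too.\<close>

lemma bicommutant_orthogonal:
  fixes V D :: "'h::chilbert_space cop"
  assumes V: "self_adjoint V" and D: "D \<in> commutant (commutant {V})"
    and y: "\<And>c k. y \<bullet> amplify (c *\<^sub>C V ^ k) \<xi> = 0"
  shows "y \<bullet> amplify D \<xi> = 0"
proof -
  \<comment> \<open>\<open>Z\<close> is the orthogonal complement of the cyclic subspace; the scalar
    \<open>c\<close> makes real orthogonality amount to complex orthogonality.\<close>
  define Z where "Z = {z. \<forall>c k. z \<bullet> amplify (c *\<^sub>C V ^ k) \<xi> = 0}"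
  have "Z = (\<Inter>c. \<Inter>k. {z. z \<bullet> amplify (c *\<^sub>C V ^ k) \<xi> = 0})" by (auto simp: Z_def)
  moreover have "closed {z. z \<bullet> w = 0}" for w :: "'h ell2"
    by (intro closed_Collect_eq continuous_intros)
  ultimately have closed: "closed Z" by auto
  have sub: "subspace Z" by (auto simp: subspace_def Z_def inner_simps)
  have "\<exists>p. p \<in> Z \<and> (\<forall>s\<in>Z. (x - p) \<bullet> s = 0)" for x
    by (rule orthogonal_decomposition[OF closed sub, of x]) (intro exI conjI ballI; blast)
  then obtain Q where Q': "\<And>x. Q x \<in> Z \<and> (\<forall>s\<in>Z. (x - Q x) \<bullet> s = 0)"
    by metis
  have Q: "\<And>x. Q x \<in> Z" "\<And>x s. s \<in> Z \<Longrightarrow> (x - Q x) \<bullet> s = 0"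
    using Q' by blast+
  \<comment> \<open>\<open>Q\<close> is the projection onto \<open>Z\<close>. These two properties
    determine it, so the algebraic facts about \<open>Q\<close> follow by checking them for a
    candidate value.\<close>
  have Q_eq: "Q x = p" if "p \<in> Z" "\<And>s. s \<in> Z \<Longrightarrow> (x - p) \<bullet> s = 0" for x p
  proof -
    have d: "Q x - p \<in> Z" using Q(1) that(1) sub by (simp add: subspace_diff)
    have "(Q x - p) \<bullet> (Q x - p) = (x - p) \<bullet> (Q x - p) - (x - Q x) \<bullet> (Q x - p)"
      by (simp add: inner_diff_left)
    then show ?thesis using that(2)[OF d] Q(2)[OF d] by simp
  qed
  have Q_add: "Q (x + x') = Q x + Q x'" for x x'
  proof (rule Q_eq)
    show "Q x + Q x' \<in> Z" by (intro subspace_add sub Q)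
    show "(x + x' - (Q x + Q x')) \<bullet> s = 0" if "s \<in> Z" for s
      using Q(2)[OF that, of x] Q(2)[OF that, of x'] by (simp add: inner_simps)
  qed
  have Q_scale: "Q (r *\<^sub>R x) = r *\<^sub>R Q x" for r x
  proof (rule Q_eq)
    show "r *\<^sub>R Q x \<in> Z" by (intro subspace_scale sub Q)
    show "(r *\<^sub>R x - r *\<^sub>R Q x) \<bullet> s = 0" if "s \<in> Z" for s
      using Q(2)[OF that, of x] by (simp flip: scaleR_diff_right)
  qed
  have Q_norm: "norm (Q x) \<le> norm x" for x
  proof -
    have "norm (Q x) * norm (Q x) = x \<bullet> Q x"
      using Q(2)[OF Q(1), of x] by (simp add: inner_diff_left dot_square_norm power2_eq_square)
    also have "\<dots> \<le> norm x * norm (Q x)" by (rule norm_cauchy_schwarz)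
    finally show ?thesis
      by (metis mult_right_le_imp_le norm_ge_zero order_le_less)
  qed
  have Q_bl: "bounded_linear Q"
    by (rule bounded_linear_intro[where K = 1]) (auto simp: Q_add Q_scale Q_norm)
  \<comment> \<open>A subspace invariant under an operator and its adjoint reduces the operator, so
    the projection commutes with it.\<close>
  have Q_amplify: "Q (amplify T x) = amplify T (Q x)"
    if "\<And>s. s \<in> Z \<Longrightarrow> amplify T s \<in> Z" "\<And>s. s \<in> Z \<Longrightarrow> amplify (adj T) s \<in> Z" for T x
  proof (rule Q_eq)
    show "amplify T (Q x) \<in> Z" by (intro that Q)
    show "(amplify T x - amplify T (Q x)) \<bullet> s = 0" if s: "s \<in> Z" for s
    proof -
      have "(amplify T x - amplify T (Q x)) \<bullet> s = amplify T (x - Q x) \<bullet> s"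
        by (simp add: linear_diff[OF bounded_linear.linear[OF bounded_linear_amplify]])
      also have "\<dots> = 0" using Q(2)[OF \<open>s \<in> Z \<Longrightarrow> amplify (adj T) s \<in> Z\<close>[OF s]] by (simp add: amplify_adj)
      finally show ?thesis .
    qed
  qed
  have ZV: "amplify V s \<in> Z" if "s \<in> Z" for s
    unfolding Z_def
  proof (intro CollectI allI)
    fix c k
    have "amplify V s \<bullet> amplify (c *\<^sub>C V ^ k) \<xi> = s \<bullet> amplify (c *\<^sub>C V ^ Suc k) \<xi>"
      using V by (simp add: amplify_adj self_adjoint_def amplify_mult[symmetric])
    moreover have "s \<bullet> amplify (c *\<^sub>C V ^ Suc k) \<xi> = 0" using that unfolding Z_def by blast
    ultimately show "amplify V s \<bullet> amplify (c *\<^sub>C V ^ k) \<xi> = 0" by simp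
  qed
  have adj_scale: "adj (d *\<^sub>C 1) = (cnj d *\<^sub>C 1 :: 'h cop)" for d
    by (rule adj_eqI) (simp add: inner_scaleC_left)
  have ZC: "amplify (d *\<^sub>C 1) s \<in> Z" if "s \<in> Z" for d s
    unfolding Z_def
  proof (intro CollectI allI)
    fix c k
    have "amplify (d *\<^sub>C 1) s \<bullet> amplify (c *\<^sub>C V ^ k) \<xi> = s \<bullet> amplify ((c * cnj d) *\<^sub>C V ^ k) \<xi>"
      by (simp add: amplify_adj adj_scale amplify_mult[symmetric] scaleC_scaleC)
    then show "amplify (d *\<^sub>C 1) s \<bullet> amplify (c *\<^sub>C V ^ k) \<xi> = 0" using that unfolding Z_def by simp
  qed
  have QV: "Q (amplify V x) = amplify V (Q x)" for x
    using V by (intro Q_amplify) (simp_all add: self_adjoint_def ZV)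
  have QC: "Q (amplify (d *\<^sub>C 1) x) = amplify (d *\<^sub>C 1) (Q x)" for d x
    by (intro Q_amplify) (auto simp: adj_scale intro: ZC)
  have single_amplify: "amplify T (ell2_single j h) = ell2_single j (cop_apply T h)" for T :: "'h cop" and j h
    by (rule ell2_eqI) (simp add: linear_0[OF bounded_linear.linear[OF bounded_linear_cop_apply]])
  \<comment> \<open>The maps \<open>h \<mapsto> ell2_nth (Q (ell2_single j h)) i\<close> are the
    matrix entries of \<open>Q\<close>. They are complex linear, commute with \<open>V\<close>, and
    hence commute with \<open>D\<close>.\<close>
  have entry: "ell2_nth (Q (ell2_single j (cop_apply D h))) i = cop_apply D (ell2_nth (Q (ell2_single j h)) i)"
    for i j h
  proof -
    have "ell2_single j (h + h') = ell2_single j h + ell2_single j h'" for h h' :: 'h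
      by (rule ell2_eqI) simp
    then have 1: "ell2_nth (Q (ell2_single j (h + h'))) i
      = ell2_nth (Q (ell2_single j h)) i + ell2_nth (Q (ell2_single j h')) i" for h h'
      by (simp add: Q_add)
    have 2: "ell2_nth (Q (ell2_single j (c *\<^sub>C h))) i = c *\<^sub>C ell2_nth (Q (ell2_single j h)) i" for c h
      using arg_cong[OF QC[of c "ell2_single j h"], of "\<lambda>x. ell2_nth x i"]
      by (simp add: single_amplify)
    have 3: "norm (ell2_nth (Q (ell2_single j h)) i) \<le> 1 * norm h" for h
      using norm_ell2_nth[of "Q (ell2_single j h)" i] Q_norm[of "ell2_single j h"] by simp
    obtain T where T: "cop_apply T = (\<lambda>h. ell2_nth (Q (ell2_single j h)) i)"
      using cop_exists[OF 1 2 3] by blast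
    have "T * V = V * T"
      by (rule cop_eqI) (simp add: T QV single_amplify[symmetric])
    then have "D * T = T * D" using D by (simp add: commutant_def)
    from arg_cong[OF this, of "\<lambda>A. cop_apply A h"] show ?thesis by (simp add: T)
  qed
  have "Q (amplify D x) = amplify D (Q x)" for x
  proof (rule bounded_linear_ell2_eqI[of "\<lambda>x. Q (amplify D x)" "\<lambda>x. amplify D (Q x)"])
    show "Q (amplify D (ell2_single j h)) = amplify D (Q (ell2_single j h))" for j h
      by (rule ell2_eqI) (simp add: single_amplify entry)
  qed (intro bounded_linear_compose[OF Q_bl] bounded_linear_compose[OF bounded_linear_amplify]
      bounded_linear_amplify Q_bl)+
  \<comment> \<open>The vector \<xi> is the spanning vector with \<open>c = 1\<close> and
    \<open>k = 0\<close>, hence orthogonal to \<open>Z\<close>. Then \<open>Q\<close> also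
    annihilates \<open>amplify D \<xi>\<close>, which is thus orthogonal to
    \<open>y \<in> Z\<close>.\<close>
  moreover have "Q \<xi> = 0"
  proof (rule Q_eq)
    show "0 \<in> Z" by (rule subspace_0[OF sub])
    show "(\<xi> - 0) \<bullet> s = 0" if "s \<in> Z" for s
    proof -
      have "amplify (1 *\<^sub>C V ^ 0) \<xi> = \<xi>" by (rule ell2_eqI) simp
      moreover have "s \<bullet> amplify (1 *\<^sub>C V ^ 0) \<xi> = 0" using that unfolding Z_def by blast
      ultimately show ?thesis by (simp add: inner_commute)
    qed
  qed
  ultimately have "Q (amplify D \<xi>) = 0"
    by (simp add: linear_0[OF bounded_linear.linear[OF bounded_linear_amplify]])
  moreover have "y \<in> Z" using y by (simp add: Z_def)
  ultimately show ?thesis using Q(2)[of y "amplify D \<xi>"] by (simp add: inner_commute)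
qed


section \<open>Von Neumann algebras and normal functionals\<close>

lemma von_neumann_closed_subalgebra: "von_neumann_algebra M \<Longrightarrow> closed_subalgebra M"
  unfolding von_neumann_algebra_def by (metis closed_subalgebra_commutant)

lemma closed_subalgebra_Inter:
  "(\<And>S. S \<in> \<S> \<Longrightarrow> closed_subalgebra S) \<Longrightarrow> closed_subalgebra (\<Inter>\<S>)"
  unfolding closed_subalgebra_def by (auto intro: closed_Inter)

lemma closed_subalgebra_vn_generated: "closed_subalgebra (vn_generated S)"
  unfolding vn_generated_def
  by (rule closed_subalgebra_Inter) (auto intro: von_neumann_closed_subalgebra)

lemma vn_generated_superset: "S \<subseteq> vn_generated S"
  unfolding vn_generated_def by auto

lemma vn_generated_subset: "von_neumann_algebra M \<Longrightarrow> S \<subseteq> M \<Longrightarrow> vn_generated S \<subseteq> M"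
  unfolding vn_generated_def by auto

lemma vn_generated_adj: "A \<in> vn_generated S \<Longrightarrow> adj A \<in> vn_generated S"
  unfolding vn_generated_def von_neumann_algebra_def by auto

lemma commutant_triple: "commutant (commutant (commutant S)) = commutant S"
proof -
  have "S' \<subseteq> commutant (commutant S')" for S' :: "'a cop set"
    by (auto simp: commutant_def)
  moreover have "S1 \<subseteq> S2 \<Longrightarrow> commutant S2 \<subseteq> commutant S1" for S1 S2 :: "'a cop set"
    by (auto simp: commutant_def)
  ultimately show ?thesis by (metis subset_antisym)
qed

text \<open>The commutant of a self-adjoint operator is closed under adjoints, and so is its
  commutant; the bicommutant is therefore a von Neumann algebra containing \<open>V\<close>.\<close>

lemma vn_generated_bicommutant:
  assumes "self_adjoint V"
  shows "vn_generated {V} \<subseteq> commutant (commutant {V})"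
proof (rule vn_generated_subset)
  have comm: "adj A \<in> commutant {V}" if "A \<in> commutant {V}" for A
  proof -
    have "adj (A * V) = adj (V * A)" using that by (simp add: commutant_def)
    then show ?thesis using assms by (simp add: adj_mult self_adjoint_def commutant_def)
  qed
  have "adj T \<in> commutant (commutant {V})" if T: "T \<in> commutant (commutant {V})" for T
  proof -
    have "adj T * A = A * adj T" if A: "A \<in> commutant {V}" for A
    proof -
      have "T * adj A = adj A * T" using T comm[OF A] by (simp add: commutant_def)
      then have "adj (T * adj A) = adj (adj A * T)" by simp
      then show ?thesis by (simp add: adj_mult)
    qed
    then show ?thesis unfolding commutant_def[of "commutant {V}"] by blast
  qed
  moreover have "commutant (commutant (commutant (commutant {V}))) = commutant (commutant {V})"
    by (rule commutant_triple)
  ultimately show "von_neumann_algebra (commutant (commutant {V}))"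
    by (simp add: von_neumann_algebra_def)
  show "{V} \<subseteq> commutant (commutant {V})" by (auto simp: commutant_def)
qed

section \<open>Normal functionals\<close>

lemma normal_on_ell2:
  assumes "normal_on M \<phi>"
  shows "\<exists>X Y. \<forall>A\<in>M. Re (\<phi> A) = Y \<bullet> amplify A X \<and> Im (\<phi> A) = - (Y \<bullet> amplify (\<i> *\<^sub>C A) X)"
proof -
  obtain x y where x: "summable (\<lambda>n. (norm (x n))\<^sup>2)" and y: "summable (\<lambda>n. (norm (y n))\<^sup>2)"
    and s: "\<And>A. A \<in> M \<Longrightarrow> (\<lambda>n. cinner (y n) (cop_apply A (x n))) sums \<phi> A"
    using assms unfolding normal_on_def by blast
  note nth = ell2_nth_Abs[OF x] ell2_nth_Abs[OF y]
  show ?thesis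
  proof (intro exI ballI conjI)
    fix A assume A: "A \<in> M"
    show "Re (\<phi> A) = Abs_ell2 y \<bullet> amplify A (Abs_ell2 x)"
      using sums_Re[OF s[OF A]] inner_ell2_sums[of "Abs_ell2 y" "amplify A (Abs_ell2 x)"]
      by (simp add: nth Re_cinner sums_unique2)
    show "Im (\<phi> A) = - (Abs_ell2 y \<bullet> amplify (\<i> *\<^sub>C A) (Abs_ell2 x))"
      using sums_Im[OF s[OF A]] sums_minus[OF inner_ell2_sums[of "Abs_ell2 y" "amplify (\<i> *\<^sub>C A) (Abs_ell2 x)"]]
      by (simp add: nth Im_cinner sums_unique2)
  qed
qed

text \<open>The values of \<phi> outside \<open>M\<close> are arbitrary. Replacing \<phi> by a
  bounded complex linear functional on all operators frees later computations from membership
  conditions. It is rebuilt from the real part \<open>r\<close> by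
  \<open>\<psi> A = r A - \<i> * r (\<i> *\<^sub>C A)\<close>.\<close>

lemma normal_on_extension:
  fixes \<phi> :: "'h::chilbert_space cop \<Rightarrow> complex"
  assumes "normal_on M \<phi>"
  obtains \<psi> where "bounded_linear \<psi>" "\<And>c A. \<psi> (c *\<^sub>C A) = c * \<psi> A" "\<And>A. A \<in> M \<Longrightarrow> \<psi> A = \<phi> A"
proof -
  obtain X Y where XY: "\<forall>A\<in>M. Re (\<phi> A) = Y \<bullet> amplify A X \<and> Im (\<phi> A) = - (Y \<bullet> amplify (\<i> *\<^sub>C A) X)"
    using normal_on_ell2[OF assms] by blast
  define r where "r A = Y \<bullet> amplify A X" for A
  define \<psi> where "\<psi> A = complex_of_real (r A) - \<i> * complex_of_real (r (\<i> *\<^sub>C A))" for A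
  have r: "bounded_linear r"
    unfolding r_def
    by (rule bounded_linear_compose[OF bounded_linear_inner_right bounded_linear_amplify_left])
  have "bounded_linear \<psi>"
    unfolding \<psi>_def
    by (intro bounded_linear_sub bounded_linear_compose[OF bounded_linear_of_real]
        bounded_linear_compose[OF bounded_linear_mult_right]
        bounded_linear_compose[OF r bounded_linear_scaleC_cop] r)
  moreover have "\<psi> (c *\<^sub>C A) = c * \<psi> A" for c A
  proof -
    have split: "d *\<^sub>C A = Re d *\<^sub>R A + Im d *\<^sub>R (\<i> *\<^sub>C A)" for d
      by (simp only: scaleC_of_real[symmetric] scaleC_scaleC scaleC_add_left[symmetric])
         (simp add: complex_eq[of d, symmetric] mult.commute)
    have rd: "r (d *\<^sub>C A) = Re d * r A + Im d * r (\<i> *\<^sub>C A)" for d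
      unfolding split[of d] using r by (simp add: linear_simps)
    show ?thesis
      unfolding \<psi>_def by (simp only: scaleC_scaleC rd[of c] rd[of "\<i> * c"]) (simp add: complex_eq_iff)
  qed
  moreover have "\<psi> A = \<phi> A" if "A \<in> M" for A
    using XY that by (simp add: \<psi>_def r_def complex_eq_iff)
  ultimately show thesis by (rule that)
qed

text \<open>Polynomials in \<open>V\<close> need not be norm dense in the generated von Neumann
  algebra. Normality bridges this: in the vector form of \<phi> the vector \<open>Y\<close> is
  orthogonal to the cyclic subspace of \<open>amplify T X\<close>, and
  \<open>bicommutant_orthogonal\<close> carries this over to \<open>D\<close>.\<close>

lemma normal_on_vn_generated_zero:
  fixes V :: "'h::chilbert_space cop"
  assumes M: "closed_subalgebra M" and normal: "normal_on M \<phi>"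
    and scale: "\<And>c A. A \<in> M \<Longrightarrow> \<phi> (c *\<^sub>C A) = c * \<phi> A"
    and V: "self_adjoint V" "V \<in> M" and D: "D \<in> vn_generated {V}" "D \<in> M" and T: "T \<in> M"
    and zero: "\<And>k. \<phi> (V ^ k * T) = 0"
  shows "\<phi> (D * T) = 0"
proof -
  obtain X Y where "\<forall>A\<in>M. Re (\<phi> A) = Y \<bullet> amplify A X \<and> Im (\<phi> A) = - (Y \<bullet> amplify (\<i> *\<^sub>C A) X)"
    using normal_on_ell2[OF normal] by blast
  then have XY: "A \<in> M \<Longrightarrow> Re (\<phi> A) = Y \<bullet> amplify A X" for A by blast
  have re: "Re (\<phi> (E * T)) = 0" if E: "E \<in> vn_generated {V}" "E \<in> M" for E
  proof -
    have "Y \<bullet> amplify (c *\<^sub>C V ^ k) (amplify T X) = 0" for c k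
    proof -
      have "Y \<bullet> amplify (c *\<^sub>C V ^ k) (amplify T X) = Re (\<phi> (c *\<^sub>C (V ^ k * T)))"
        by (subst XY) (auto simp: amplify_mult[symmetric] intro!: subalgebra_intros[OF M] V T)
      also have "\<dots> = 0"
        by (subst scale) (auto simp: zero intro!: subalgebra_intros[OF M] V T)
      finally show ?thesis .
    qed
    from bicommutant_orthogonal[OF V(1) _ this] E(1) vn_generated_bicommutant[OF V(1)]
    have "Y \<bullet> amplify E (amplify T X) = 0" by blast
    then show ?thesis
      by (subst XY) (auto simp: amplify_mult intro!: subalgebra_intros[OF M] E T)
  qed
  \<comment> \<open>The imaginary part at \<open>D * T\<close> is, up to sign, the real part at
    \<open>\<i> *\<^sub>C D * T\<close>.\<close>
  have "Re (\<phi> (\<i> *\<^sub>C D * T)) = 0"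
    by (intro re subalgebra_intros[OF M] subalgebra_intros[OF closed_subalgebra_vn_generated] D)
  then have "Im (\<phi> (D * T)) = 0"
    using scale[of "D * T" \<i>] by (simp add: subalgebra_mult[OF M] D T)
  then show ?thesis using re[OF D] by (simp add: complex_eq_iff)
qed

section \<open>Resolvents\<close>

abbreviation resolvent :: "'h::chilbert_space cop \<Rightarrow> complex \<Rightarrow> 'h cop" where
  "resolvent X w \<equiv> op_inv (1 - w *\<^sub>C X)"

text \<open>Multiplying the intertwining relation by the inverses on both sides moves
  \<open>A\<close> past a resolvent, for example a square root out of a sandwiched product.\<close>

lemma intertwine_op_inv:
  assumes "norm X < 1" "norm Y < 1" "A * (1 - X) = (1 - Y) * A"
  shows "op_inv (1 - Y) * A = A * op_inv (1 - X)"
proof -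
  have "op_inv (1 - Y) * A = op_inv (1 - Y) * A * ((1 - X) * op_inv (1 - X))"
    by (simp add: neumann_series(1,2) assms)
  also have "\<dots> = op_inv (1 - Y) * (A * (1 - X)) * op_inv (1 - X)" by (simp add: mult.assoc)
  also have "\<dots> = op_inv (1 - Y) * (1 - Y) * A * op_inv (1 - X)"
    by (simp only: assms(3) mult.assoc)
  also have "\<dots> = A * op_inv (1 - X)" by (simp add: neumann_series(1,2) assms)
  finally show ?thesis .
qed

lemma resolvent_commute: "norm (w *\<^sub>C X) < 1 \<Longrightarrow> resolvent X w * X = X * resolvent X w"
  by (rule intertwine_op_inv) (simp_all add: algebra_simps)

lemma Psi_eq: "Psi X w = w *\<^sub>C (X * resolvent X w)"
  by (simp add: Psi_def)

lemma resolvent_eq_Psi: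
  assumes "norm (w *\<^sub>C X) < 1"
  shows "resolvent X w = 1 + Psi X w"
proof -
  have "(1 - w *\<^sub>C X) * resolvent X w = 1" by (rule neumann_series[OF assms])
  then show ?thesis by (simp add: Psi_eq algebra_simps)
qed

text \<open>This resolvent identity yields continuity, differentiability and local injectivity of
  the mean of the resolvent, and the comparison of the parameters \<open>w2\<close> and 1 in the
  final computation.\<close>

lemma resolvent_diff:
  assumes "norm (w *\<^sub>C X) < 1" "norm (v *\<^sub>C X) < 1"
  shows "resolvent X w - resolvent X v = (w - v) *\<^sub>C (resolvent X w * X * resolvent X v)"
proof -
  have "resolvent X w - resolvent X v
    = resolvent X w * ((1 - v *\<^sub>C X) * resolvent X v) - (resolvent X w * (1 - w *\<^sub>C X)) * resolvent X v"
    by (simp add: neumann_series(1,2) assms)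
  also have "\<dots> = resolvent X w * ((1 - v *\<^sub>C X) - (1 - w *\<^sub>C X)) * resolvent X v"
    by (simp only: algebra_simps)
  also have "(1 - v *\<^sub>C X) - (1 - w *\<^sub>C X) = (w - v) *\<^sub>C X" by (simp add: scaleC_diff_left)
  finally show ?thesis by simp
qed

lemma eventually_resolvent:
  fixes X :: "'h::chilbert_space cop"
  assumes "norm (w0 *\<^sub>C X) < 1"
  shows "\<forall>\<^sub>F w in nhds w0. norm (w *\<^sub>C X) < 1"
proof -
  have "((\<lambda>w. norm (w *\<^sub>C X)) \<longlongrightarrow> norm (w0 *\<^sub>C X)) (nhds w0)"
    by (intro tendsto_intros filterlim_ident)
  then show ?thesis using assms by (rule order_tendstoD)
qed

lemma tendsto_resolvent:
  fixes X :: "'h::chilbert_space cop"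
  assumes "norm (w0 *\<^sub>C X) < 1"
  shows "(resolvent X \<longlongrightarrow> resolvent X w0) (nhds w0)"
proof (rule LIM_zero_cancel, rule Lim_null_comparison)
  let ?b = "\<lambda>w. cmod (w - w0) * (1 / (1 - norm (w *\<^sub>C X)) * norm X * norm (resolvent X w0))"
  have "(?b \<longlongrightarrow> cmod (w0 - w0) * (1 / (1 - norm (w0 *\<^sub>C X)) * norm X * norm (resolvent X w0))) (nhds w0)"
    using assms by (intro tendsto_intros filterlim_ident) auto
  then show "(?b \<longlongrightarrow> 0) (nhds w0)" by simp
  show "\<forall>\<^sub>F w in nhds w0. norm (resolvent X w - resolvent X w0) \<le> ?b w"
    using eventually_resolvent[OF assms]
  proof eventually_elim
    case (elim w)
    have "norm (resolvent X w * X * resolvent X w0)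
      \<le> 1 / (1 - norm (w *\<^sub>C X)) * norm X * norm (resolvent X w0)"
      by (intro order_trans[OF norm_mult_ineq] mult_right_mono neumann_series elim) auto
    then show ?case
      unfolding resolvent_diff[OF elim assms] norm_cop_scaleC by (intro mult_left_mono) auto
  qed
qed

lemma continuous_on_resolvent:
  fixes X :: "'h::chilbert_space cop"
  assumes "\<And>w. w \<in> S \<Longrightarrow> norm (w *\<^sub>C X) < 1"
  shows "continuous_on S (resolvent X)"
  unfolding continuous_on_def
  using tendsto_resolvent[OF assms] tendsto_mono[OF at_within_le_nhds] by blast


section \<open>Freeness of norm-closed algebras\<close>

lemma alternates_in_Cons:
  "alternates_in P Q (X # Xs) \<longleftrightarrow> X \<in> P \<and> alternates_in Q P Xs"
proof
  assume a: "alternates_in P Q (X # Xs)"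
  have "X \<in> P" using a unfolding alternates_in_def by (auto dest: spec[of _ 0])
  moreover have "Xs ! i \<in> (if even i then Q else P)" if "i < length Xs" for i
    using a that unfolding alternates_in_def by (auto dest!: spec[of _ "Suc i"] split: if_splits)
  ultimately show "X \<in> P \<and> alternates_in Q P Xs" by (simp add: alternates_in_def)
qed (auto simp: alternates_in_def nth_Cons split: nat.split)

lemma tendsto_prod_list:
  fixes F :: "'i \<Rightarrow> nat \<Rightarrow> 'a::{real_normed_algebra_1}"
  assumes "\<And>i. i \<in> set is \<Longrightarrow> F i \<longlonglongrightarrow> G i"
  shows "(\<lambda>n. prod_list (map (\<lambda>i. F i n) is)) \<longlonglongrightarrow> prod_list (map G is)"
  using assms by (induction "is") (auto intro!: tendsto_mult)

text \<open>Freeness is given on polynomials, while resolvents are only norm limits of them. Each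
  factor is approximated, and subtracting the means of the approximants, which tend to 0, keeps them
  centered; products and \<open>\<psi>\<close> are continuous.\<close>

lemma closure_alternating_moments_zero:
  fixes \<psi> :: "'h::chilbert_space cop \<Rightarrow> complex"
  assumes \<psi>: "bounded_linear \<psi>" "\<And>c. \<psi> (c *\<^sub>C 1) = c"
    and PQ: "\<And>A c. A \<in> P \<Longrightarrow> A - c *\<^sub>C 1 \<in> P" "\<And>A c. A \<in> Q \<Longrightarrow> A - c *\<^sub>C 1 \<in> Q"
    and zero: "\<And>Xs. Xs \<noteq> [] \<Longrightarrow> alternates_in P Q Xs \<Longrightarrow> \<forall>X\<in>set Xs. \<psi> X = 0 \<Longrightarrow> \<psi> (prod_list Xs) = 0"
    and Xs: "Xs \<noteq> []" "alternates_in (closure P) (closure Q) Xs" "\<forall>X\<in>set Xs. \<psi> X = 0"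
  shows "\<psi> (prod_list Xs) = 0"
proof -
  let ?D = "\<lambda>i. if even i then P else Q"
  have "\<exists>f. (\<forall>n. f n \<in> ?D i \<and> \<psi> (f n) = 0) \<and> f \<longlonglongrightarrow> Xs ! i" if i: "i < length Xs" for i
  proof -
    have "Xs ! i \<in> closure (?D i)" using Xs(2) i by (auto simp: alternates_in_def)
    then obtain f where f: "\<And>n. f n \<in> ?D i" "f \<longlonglongrightarrow> Xs ! i" by (auto simp: closure_sequential)
    have "(\<lambda>n. f n - \<psi> (f n) *\<^sub>C 1) \<longlonglongrightarrow> Xs ! i - \<psi> (Xs ! i) *\<^sub>C 1"
      by (intro tendsto_intros f bounded_linear.tendsto[OF \<psi>(1)])
    moreover have "\<psi> (Xs ! i) = 0" using Xs(3) i by auto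
    moreover have "f n - \<psi> (f n) *\<^sub>C 1 \<in> ?D i" for n using f(1)[of n] PQ by auto
    moreover have "\<psi> (f n - \<psi> (f n) *\<^sub>C 1) = 0" for n
      by (simp add: linear_diff[OF bounded_linear.linear[OF \<psi>(1)]] \<psi>(2))
    ultimately show ?thesis by (intro exI[of _ "\<lambda>n. f n - \<psi> (f n) *\<^sub>C 1"]) auto
  qed
  then obtain F where F: "\<And>i. i < length Xs \<Longrightarrow> (\<forall>n. F i n \<in> ?D i \<and> \<psi> (F i n) = 0) \<and> F i \<longlonglongrightarrow> Xs ! i"
    by metis
  let ?Ys = "\<lambda>n. map (\<lambda>i. F i n) [0..<length Xs]"
  have "(\<lambda>n. \<psi> (prod_list (?Ys n))) \<longlonglongrightarrow> \<psi> (prod_list (map ((!) Xs) [0..<length Xs]))"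
    using F by (intro bounded_linear.tendsto[OF \<psi>(1)] tendsto_prod_list) auto
  moreover have "\<psi> (prod_list (?Ys n)) = 0" for n
    using F Xs(1) by (intro zero) (auto simp: alternates_in_def)
  ultimately show ?thesis by (simp add: map_nth LIMSEQ_const_iff)
qed

lemma free_algebras_closure:
  fixes \<psi> :: "'h::chilbert_space cop \<Rightarrow> complex"
  assumes "bounded_linear \<psi>" "\<And>c. \<psi> (c *\<^sub>C 1) = c"
    and "\<And>A c. A \<in> P \<Longrightarrow> A - c *\<^sub>C 1 \<in> P" "\<And>A c. A \<in> Q \<Longrightarrow> A - c *\<^sub>C 1 \<in> Q"
    and "free_algebras \<psi> P Q"
  shows "free_algebras \<psi> (closure P) (closure Q)"
  unfolding free_algebras_def
proof (intro allI impI, elim conjE disjE)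
  fix Xs :: "'h cop list"
  assume Xs: "Xs \<noteq> []" "\<forall>X\<in>set Xs. \<psi> X = 0"
  show "\<psi> (prod_list Xs) = 0" if "alternates_in (closure P) (closure Q) Xs"
    using assms(5) unfolding free_algebras_def
    by (intro closure_alternating_moments_zero[OF assms(1-4) _ Xs(1) that Xs(2)]) auto
  show "\<psi> (prod_list Xs) = 0" if "alternates_in (closure Q) (closure P) Xs"
    using assms(5) unfolding free_algebras_def
    by (intro closure_alternating_moments_zero[OF assms(1,2,4,3) _ Xs(1) that Xs(2)]) auto
qed

lemma closed_subalgebra_closure:
  fixes S :: "'h::chilbert_space cop set"
  shows "closed_subalgebra (closure (unital_algebra S))"
  unfolding closed_subalgebra_def
proof (intro conjI ballI allI)
  show "1 \<in> closure (unital_algebra S)" using closure_subset unital_algebra.one by blast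
  fix A B assume "A \<in> closure (unital_algebra S)" "B \<in> closure (unital_algebra S)"
  then obtain f g where f: "\<And>n. f n \<in> unital_algebra S" "f \<longlonglongrightarrow> A"
    and g: "\<And>n. g n \<in> unital_algebra S" "g \<longlonglongrightarrow> B" by (auto simp: closure_sequential)
  show "A + B \<in> closure (unital_algebra S)" unfolding closure_sequential
    by (intro exI[of _ "\<lambda>n. f n + g n"] conjI allI unital_algebra.add f g tendsto_add)
  show "A * B \<in> closure (unital_algebra S)" unfolding closure_sequential
    by (intro exI[of _ "\<lambda>n. f n * g n"] conjI allI unital_algebra.mult f g tendsto_mult)
next
  fix c A assume "A \<in> closure (unital_algebra S)"
  then obtain f where f: "\<And>n. f n \<in> unital_algebra S" "f \<longlonglongrightarrow> A" by (auto simp: closure_sequential)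
  show "c *\<^sub>C A \<in> closure (unital_algebra S)" unfolding closure_sequential
    by (intro exI[of _ "\<lambda>n. c *\<^sub>C f n"] conjI allI unital_algebra.scale f tendsto_intros)
qed simp

lemma unital_algebra_subset:
  assumes "closed_subalgebra M" "S \<subseteq> M"
  shows "closure (unital_algebra S) \<subseteq> M"
proof (rule closure_minimal[OF _ subalgebra_closed[OF assms(1)]], rule subsetI)
  fix A assume "A \<in> unital_algebra S"
  then show "A \<in> M" by induction (use assms in \<open>auto intro: subalgebra_intros\<close>)
qed

section \<open>Words alternating between two free algebras\<close>

locale free_pair =
  fixes M AU AV :: "'h::chilbert_space cop set" and \<psi> :: "'h cop \<Rightarrow> complex"
  assumes M: "closed_subalgebra M"
    and AU: "closed_subalgebra AU" "AU \<subseteq> M" and AV: "closed_subalgebra AV" "AV \<subseteq> M"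
    and bounded: "bounded_linear \<psi>" and scale [simp]: "\<psi> (c *\<^sub>C A) = c * \<psi> A"
    and one [simp]: "\<psi> 1 = 1"
    and trace: "A \<in> M \<Longrightarrow> B \<in> M \<Longrightarrow> \<psi> (A * B) = \<psi> (B * A)"
    and free: "free_algebras \<psi> AU AV"
begin

lemma psi_simps [simp]: "\<psi> (A + B) = \<psi> A + \<psi> B" "\<psi> (A - B) = \<psi> A - \<psi> B" "\<psi> 0 = 0"
  using bounded by (simp_all add: linear_simps)

definition alg :: "bool \<Rightarrow> 'h cop set" where "alg s = (if s then AU else AV)"

lemma alg: "closed_subalgebra (alg s)" by (simp add: alg_def AU AV)

definition centered :: "bool \<Rightarrow> 'h cop \<Rightarrow> bool" where
  "centered s A \<longleftrightarrow> A \<in> alg s \<and> \<psi> A = 0"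

lemma centered_diff: "A \<in> alg s \<Longrightarrow> centered s (A - \<psi> A *\<^sub>C 1)"
  by (auto simp: centered_def intro!: subalgebra_intros[OF alg])

text \<open>The flags record to which of the two algebras the first and the last factor belong.\<close>

inductive alternating :: "bool \<Rightarrow> bool \<Rightarrow> 'h cop \<Rightarrow> bool" where
  single: "centered s A \<Longrightarrow> alternating s s A"
| Cons: "centered (\<not> s) B \<Longrightarrow> alternating s t A \<Longrightarrow> alternating (\<not> s) t (B * A)"

lemma alternating_append:
  "alternating s t A \<Longrightarrow> alternating (\<not> t) u B \<Longrightarrow> alternating s u (A * B)"
proof (induction rule: alternating.induct)
  case (single s A)
  then show ?case using alternating.Cons[of "\<not> s" A u B] by simp
next
  case (Cons s C t A)
  then show ?case using alternating.Cons[of s C u "A * B"] by (simp add: mult.assoc)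
qed

text \<open>Freeness is stated for lists of factors; the induction recovers such a list from the
  inductive description of the word.\<close>

lemma alternating_zero:
  assumes "alternating s t A"
  shows "\<psi> A = 0"
proof -
  have "\<exists>Xs. Xs \<noteq> [] \<and> alternates_in (alg s) (alg (\<not> s)) Xs \<and> (\<forall>X\<in>set Xs. \<psi> X = 0) \<and> A = prod_list Xs"
    using assms
  proof induction
    case (single s A)
    then show ?case
      by (intro exI[of _ "[A]"]) (auto simp: centered_def alternates_in_def)
  next
    case (Cons s B t A)
    then obtain Xs where "Xs \<noteq> []" "alternates_in (alg s) (alg (\<not> s)) Xs" "\<forall>X\<in>set Xs. \<psi> X = 0"
      "A = prod_list Xs" by blast
    with Cons(1) show ?case
      by (intro exI[of _ "B # Xs"]) (auto simp: alternates_in_Cons centered_def)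
  qed
  then obtain Xs where Xs: "Xs \<noteq> []" "alternates_in (alg s) (alg (\<not> s)) Xs" "\<forall>X\<in>set Xs. \<psi> X = 0"
      "A = prod_list Xs" by blast
  then show ?thesis using free unfolding free_algebras_def alg_def by (cases s) auto
qed

text \<open>The mean of \<open>h\<close> contributes a multiple of \<open>\<psi> y = 0\<close>, and
  the centered part of \<open>h\<close> prolongs the word.\<close>

lemma mult_alternating_zero:
  assumes "h \<in> alg s" "alternating (\<not> s) t y"
  shows "\<psi> (h * y) = 0"
proof -
  have "alternating s t ((h - \<psi> h *\<^sub>C 1) * y)"
    using alternating.Cons[of "\<not> s" _ t y] centered_diff[OF assms(1)] assms(2) by simp
  from alternating_zero[OF this] alternating_zero[OF assms(2)] show ?thesis
    by (simp add: algebra_simps)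
qed

lemma mult_centered_alternating_zero:
  assumes "h \<in> alg s" "centered s B" "alternating (\<not> s) t y"
  shows "\<psi> (h * (B * y)) = 0"
proof -
  have "h * B \<in> alg s" using assms by (auto simp: centered_def intro: subalgebra_intros[OF alg])
  from mult_alternating_zero[OF this assms(3)] show ?thesis by (simp add: mult.assoc)
qed

lemma product_moment: "h \<in> AV \<Longrightarrow> f \<in> AU \<Longrightarrow> \<psi> (h * f) = \<psi> h * \<psi> f"
  using mult_alternating_zero[of h False True "f - \<psi> f *\<^sub>C 1"]
    alternating.single[OF centered_diff[of f True]]
  by (simp add: alg_def algebra_simps)

text \<open>Splitting \<open>r\<close> and \<open>r'\<close> into mean and centered part gives four
  terms. Only the product of the two means survives, since the other terms are an element of
  \<open>AV\<close> times a word starting in \<open>AU\<close>, after \<open>h\<close> has absorbed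
  a first letter from \<open>AV\<close> if there is one.\<close>

lemma sandwich_moment:
  assumes h: "h \<in> AV" and r: "r \<in> AU" "r' \<in> AU" and y: "alternating False False y"
  shows "\<psi> (h * r * y * r') = \<psi> r * \<psi> r' * \<psi> (h * y)"
proof -
  let ?r = "r - \<psi> r *\<^sub>C 1" and ?r' = "r' - \<psi> r' *\<^sub>C 1"
  have c: "centered True ?r" "centered True ?r'" using r by (auto intro: centered_diff simp: alg_def)
  have hF: "h \<in> alg False" using h by (simp add: alg_def)
  have ry: "alternating True False (?r * y)"
    using alternating.Cons[of False, OF _ y] c by simp
  have yr: "alternating False True (y * ?r')"
    using alternating_append[OF y] alternating.single[OF c(2)] by simp
  have "alternating True True (?r * (y * ?r'))"
    using alternating.Cons[of False, OF _ yr] c by simp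
  then have 1: "\<psi> (h * (?r * (y * ?r'))) = 0" using mult_alternating_zero[OF hF] by simp
  have 2: "\<psi> (h * (?r * y)) = 0" using mult_alternating_zero[OF hF] ry by simp
  \<comment> \<open>The flags at the two ends differ, so the word has at least two letters and its
    first one can be absorbed into \<open>h\<close>.\<close>
  have 3: "\<psi> (h * (y * ?r')) = 0"
    using yr
  proof cases
    case (Cons s B A)
    then show ?thesis using mult_centered_alternating_zero[OF hF] by simp
  qed simp
  have "h * r * y * r' = h * (?r * (y * ?r')) + \<psi> r *\<^sub>C (h * (y * ?r')) + \<psi> r' *\<^sub>C (h * (?r * y))
    + (\<psi> r * \<psi> r') *\<^sub>C (h * y)"
    by (simp add: algebra_simps scaleC_diff_right scaleC_scaleC)
  then have "\<psi> (h * r * y * r') = \<psi> (h * (?r * (y * ?r'))) + \<psi> r * \<psi> (h * (y * ?r'))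
    + \<psi> r' * \<psi> (h * (?r * y)) + \<psi> r * \<psi> r' * \<psi> (h * y)"
    by (simp only: psi_simps scale)
  then show ?thesis unfolding 1 2 3 by simp
qed

lemma alternating_power:
  assumes "centered True p" "centered False q"
  shows "alternating False False (q * (p * q) ^ n)"
proof (induction n)
  case 0
  then show ?case using alternating.single[OF assms(2)] by simp
next
  case (Suc n)
  have "alternating True False (p * (q * (p * q) ^ n))"
    using alternating.Cons[of False, OF _ Suc] assms by simp
  then have "alternating False False (q * (p * (q * (p * q) ^ n)))"
    using alternating.Cons[of True] assms by simp
  then show ?case by (simp add: mult.assoc)
qed

lemma power_scaleC: "(c *\<^sub>C A) ^ n = c ^ n *\<^sub>C A ^ n" for A :: "'h cop"
  by (induction n) (simp_all add: scaleC_scaleC mult.commute)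

text \<open>Only the term \<open>n = 0\<close> of the Neumann series contributes: for larger
  \<open>n\<close> the first \<open>q\<close> merges with \<open>h\<close>, and an alternating word
  starting with \<open>p\<close> remains.\<close>

lemma series_moment:
  assumes pq: "centered True p" "centered False q" and small: "norm (k *\<^sub>C (p * q)) < 1"
    and h: "h \<in> AV" and r: "r \<in> AU" "r' \<in> AU"
  shows "\<psi> (h * r * (q * op_inv (1 - k *\<^sub>C (p * q))) * r') = \<psi> r * \<psi> r' * \<psi> (h * q)"
proof -
  let ?F = "\<lambda>T. \<psi> (h * r * (q * T) * r')"
  have F: "bounded_linear ?F"
    by (intro bounded_linear_compose[OF bounded] bounded_linear_mult_const bounded_linear_const_mult
        bounded_linear_ident)
  have moments: "?F ((k *\<^sub>C (p * q)) ^ n) = (if n = 0 then \<psi> r * \<psi> r' * \<psi> (h * q) else 0)" for n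
  proof -
    have "?F ((k *\<^sub>C (p * q)) ^ n) = k ^ n * (\<psi> r * \<psi> r' * \<psi> (h * (q * (p * q) ^ n)))"
      using sandwich_moment[OF h r alternating_power[OF pq, of n]] by (simp add: power_scaleC)
    moreover have "\<psi> (h * (q * (p * q) ^ n)) = 0" if "n \<noteq> 0"
    proof -
      obtain l where n: "n = Suc l" using \<open>n \<noteq> 0\<close> by (cases n) auto
      have "alternating True False (p * (q * (p * q) ^ l))"
        using alternating.Cons[of False, OF _ alternating_power[OF pq]] pq by simp
      then show ?thesis
        using mult_centered_alternating_zero[of h False q False] h pq
        by (simp add: alg_def n mult.assoc)
    qed
    ultimately show ?thesis by auto
  qed
  have "?F (op_inv (1 - k *\<^sub>C (p * q))) = (\<Sum>n. ?F ((k *\<^sub>C (p * q)) ^ n))"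
    unfolding neumann_series(3)[OF small]
    by (rule bounded_linear.suminf[OF F complete_algebra_summable_geometric[OF small]])
  also have "\<dots> = (\<Sum>n\<in>{0}. \<psi> r * \<psi> r' * \<psi> (h * q))"
    unfolding moments by (subst suminf_finite[of "{0}"]) auto
  finally show ?thesis by simp
qed

end

section \<open>The subordination equations\<close>

context free_pair
begin

text \<open>For a fixed \<open>z\<close> these are the algebraic equations behind the cancellation
  in \<open>resolvent_factorization\<close>. The last condition makes the Neumann series in
  \<open>S\<close> converge.\<close>

definition subordinate :: "'h cop \<Rightarrow> 'h cop \<Rightarrow> complex \<Rightarrow> complex \<Rightarrow> complex \<Rightarrow> bool" where
  "subordinate U V z w1 w2 \<longleftrightarrow>
     norm (w1 *\<^sub>C V) < 1 \<and> norm (w2 *\<^sub>C U) < 1 \<and>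
     \<psi> (resolvent U w2) \<noteq> 0 \<and> \<psi> (resolvent V w1) = \<psi> (resolvent U w2) \<and>
     w1 * \<psi> (resolvent U w2) = z * \<psi> (U * resolvent U w2) \<and>
     w2 * \<psi> (resolvent U w2) = z * \<psi> (V * resolvent V w1) \<and>
     norm ((z / (\<psi> (resolvent U w2))\<^sup>2) *\<^sub>C
       ((U * resolvent U w2 - \<psi> (U * resolvent U w2) *\<^sub>C 1) *
        (V * resolvent V w1 - \<psi> (V * resolvent V w1) *\<^sub>C 1))) < 1"

lemma resolvent_eq:
  assumes "norm (w *\<^sub>C X) < 1"
  shows "resolvent X w = 1 + w *\<^sub>C (X * resolvent X w)"
  using resolvent_eq_Psi[OF assms] by (simp add: Psi_eq)

lemma psi_resolvent: "norm (w *\<^sub>C X) < 1 \<Longrightarrow> \<psi> (resolvent X w) = 1 + w * \<psi> (X * resolvent X w)"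
  by (subst resolvent_eq) simp_all

text \<open>With \<open>?F X w\<close> the quotient of the means of \<open>X * resolvent X w\<close>
  and \<open>resolvent X w\<close>, a solution is a fixed point of
  \<open>(w1, w2) \<mapsto> (z * ?F U w2, z * ?F V w1)\<close>, which for small \<open>z\<close>
  maps a product of two discs into itself.\<close>

lemma subordinate_exists:
  fixes U V :: "'h cop"
  assumes r: "r > 0"
  obtains \<delta> where "\<delta> > 0"
    "\<And>z. cmod z < \<delta> \<Longrightarrow> \<exists>w1 w2. cmod w1 \<le> r \<and> cmod w2 \<le> r \<and> subordinate U V z w1 w2"
proof -
  let ?m = "\<lambda>X w. \<psi> (resolvent X w)" and ?p = "\<lambda>X w. \<psi> (X * resolvent X w)"
  \<comment> \<open>At \<open>w = 0\<close> the resolvent has mean 1, so the denominators do not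
    vanish nearby.\<close>
  have near: "\<forall>\<^sub>F w in nhds 0. norm (w *\<^sub>C X) < 1 \<and> ?m X w \<noteq> 0" for X :: "'h cop"
  proof (intro eventually_conj eventually_resolvent)
    have "((\<lambda>w. ?m X w) \<longlongrightarrow> ?m X 0) (nhds 0)"
      by (intro bounded_linear.tendsto[OF bounded] tendsto_resolvent) simp
    moreover have "?m X 0 \<noteq> 0" using psi_resolvent[of 0 X] by simp
    ultimately show "\<forall>\<^sub>F w in nhds 0. ?m X w \<noteq> 0" by (rule tendsto_imp_eventually_ne)
  qed simp
  from near[of U] near[of V] have "\<forall>\<^sub>F w in nhds 0.
      norm (w *\<^sub>C U) < 1 \<and> ?m U w \<noteq> 0 \<and> norm (w *\<^sub>C V) < 1 \<and> ?m V w \<noteq> 0"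
    by eventually_elim auto
  then obtain d where d: "d > 0" "\<And>w. dist w 0 < d \<Longrightarrow>
      norm (w *\<^sub>C U) < 1 \<and> ?m U w \<noteq> 0 \<and> norm (w *\<^sub>C V) < 1 \<and> ?m V w \<noteq> 0"
    unfolding eventually_nhds_metric by blast
  define \<rho> where "\<rho> = min r (d / 2)"
  have \<rho>: "\<rho> > 0" "\<rho> \<le> r" using r d by (auto simp: \<rho>_def)
  have in_ball: "norm (w *\<^sub>C U) < 1" "?m U w \<noteq> 0" "norm (w *\<^sub>C V) < 1" "?m V w \<noteq> 0"
    if "w \<in> cball 0 \<rho>" for w
    using that d(2)[of w] d(1) by (auto simp: \<rho>_def)
  let ?F = "\<lambda>X w. ?p X w / ?m X w"
  let ?N = "\<lambda>X w. norm (X * resolvent X w - ?p X w *\<^sub>C 1) / cmod (?m X w)"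
  have cont: "continuous_on (cball 0 \<rho>) (?F X)" "continuous_on (cball 0 \<rho>) (?N X)"
    if "X = U \<or> X = V" for X
  proof -
    have X: "\<And>w. w \<in> cball 0 \<rho> \<Longrightarrow> norm (w *\<^sub>C X) < 1" "\<And>w. w \<in> cball 0 \<rho> \<Longrightarrow> ?m X w \<noteq> 0"
      using in_ball that by blast+
    note res = continuous_on_resolvent[OF X(1)]
    have p: "continuous_on (cball 0 \<rho>) (?p X)"
      by (intro bounded_linear.continuous_on[OF bounded] continuous_on_mult continuous_on_const res)
    have m: "continuous_on (cball 0 \<rho>) (?m X)"
      by (intro bounded_linear.continuous_on[OF bounded] res)
    show "continuous_on (cball 0 \<rho>) (?F X)" by (intro continuous_on_divide p m ballI X(2))
    show "continuous_on (cball 0 \<rho>) (?N X)"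
      using X(2) by (intro continuous_on_divide continuous_on_norm continuous_on_diff continuous_on_mult
          continuous_on_const res m bounded_linear.continuous_on[OF bounded_linear_scaleC_left] p) auto
  qed
  have bound: "\<exists>K. \<forall>w\<in>cball 0 \<rho>. norm (f w) \<le> K" if "continuous_on (cball 0 \<rho>) f"
    for f :: "complex \<Rightarrow> 'b::real_normed_vector"
    using compact_imp_bounded[OF compact_continuous_image[OF that compact_cball]]
    by (auto simp: bounded_iff)
  obtain K1 K2 K3 K4 where K: "\<forall>w\<in>cball 0 \<rho>. norm (?F U w) \<le> K1" "\<forall>w\<in>cball 0 \<rho>. norm (?F V w) \<le> K2"
    "\<forall>w\<in>cball 0 \<rho>. norm (?N U w) \<le> K3" "\<forall>w\<in>cball 0 \<rho>. norm (?N V w) \<le> K4"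
    using bound[OF cont(1)[of U]] bound[OF cont(1)[of V]] bound[OF cont(2)[of U]] bound[OF cont(2)[of V]]
    by blast
  define K where "K = 1 + \<bar>K1\<bar> + \<bar>K2\<bar> + \<bar>K3\<bar> + \<bar>K4\<bar>"
  have K0: "K > 0" by (simp add: K_def)
  have KF: "cmod (?F U w) \<le> K" "cmod (?F V w) \<le> K" "?N U w \<le> K" "?N V w \<le> K"
    if "w \<in> cball 0 \<rho>" for w
  proof -
    show "cmod (?F U w) \<le> K" "cmod (?F V w) \<le> K" using K(1,2) that unfolding K_def by fastforce+
    have "?N U w \<le> K3" "?N V w \<le> K4" using K(3,4) that by fastforce+
    then show "?N U w \<le> K" "?N V w \<le> K" unfolding K_def by linarith+
  qed
  \<comment> \<open>The first bound makes the map preserve the product of discs; the second gives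
    the last condition of \<open>subordinate\<close>.\<close>
  define \<delta> where "\<delta> = min (\<rho> / K) (1 / K\<^sup>2)"
  show thesis
  proof (rule that[of \<delta>])
    show "\<delta> > 0" using \<rho> K0 by (simp add: \<delta>_def)
    fix z assume z: "cmod z < \<delta>"
    have zK: "cmod z * K \<le> \<rho>" "cmod z * K\<^sup>2 < 1"
      using z K0 by (auto simp: \<delta>_def field_simps)
    let ?S = "cball (0::complex) \<rho> \<times> cball (0::complex) \<rho>"
    let ?f = "\<lambda>x. (z * ?F U (snd x), z * ?F V (fst x))"
    have zF: "cmod (z * c) \<le> \<rho>" if "cmod c \<le> K" for c
      using zK(1) mult_left_mono[OF that norm_ge_zero[of z]] by (simp add: norm_mult)
    have "\<exists>x\<in>?S. ?f x = x"
    proof (rule brouwer)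
      show "compact ?S" by (intro compact_Times compact_cball)
      show "convex ?S" by (intro convex_Times convex_cball)
      show "?S \<noteq> {}" using \<rho> by (auto simp: less_imp_le)
      show "continuous_on ?S ?f"
        by (intro continuous_on_Pair continuous_on_mult continuous_on_const
            continuous_on_compose2[OF cont(1)[of U] continuous_on_snd[OF continuous_on_id]]
            continuous_on_compose2[OF cont(1)[of V] continuous_on_fst[OF continuous_on_id]]) auto
      show "?f \<in> ?S \<rightarrow> ?S" using zF[OF KF(1)] zF[OF KF(2)] by auto
    qed blast
    then obtain x where x: "x \<in> ?S" "?f x = x" by blast
    define w1 w2 where "w1 = fst x" and "w2 = snd x"
    have w12: "w1 \<in> cball 0 \<rho>" "w2 \<in> cball 0 \<rho>"
      using x(1) unfolding w1_def w2_def mem_Times_iff by blast+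
    have w1: "w1 = z * ?F U w2"
      using arg_cong[OF x(2), of fst, unfolded fst_conv, symmetric] unfolding w1_def w2_def .
    have w2: "w2 = z * ?F V w1"
      using arg_cong[OF x(2), of snd, unfolded snd_conv, symmetric] unfolding w1_def w2_def .
    note w = w12 w1 w2
    define mU mV pU pV where "mU = ?m U w2" "mV = ?m V w1" "pU = ?p U w2" "pV = ?p V w1"
    note defs = this
    have nz: "mU \<noteq> 0" "mV \<noteq> 0" using in_ball w12 by (auto simp: defs)
    have eq: "w1 * mU = z * pU" "w2 * mV = z * pV" 
      using arg_cong[OF w(3), of "\<lambda>t. t * ?m U w2"] arg_cong[OF w(4), of "\<lambda>t. t * ?m V w1"] nz
      unfolding defs by simp_all
    have m: "mU = 1 + w2 * pU" "mV = 1 + w1 * pV"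
      unfolding defs by (intro psi_resolvent in_ball w)+
    \<comment> \<open>The fixed point does not impose this equality. For \<open>z \<noteq> 0\<close>
      both numbers solve \<open>(w1 * w2 - z) * m = - z\<close>, where
      \<open>w1 * w2 \<noteq> z\<close>; for \<open>z = 0\<close> both are 1.\<close>
    have "mU = mV"
    proof (cases "z = 0")
      case True
      then show ?thesis using eq nz m by simp
    next
      case False
      have 1: "w1 * w2 * mU = z * (mU - 1)" "w1 * w2 * mV = z * (mV - 1)"
        using arg_cong[OF eq(1), of "\<lambda>t. w2 * t"] arg_cong[OF eq(2), of "\<lambda>t. w1 * t"] m
        by (simp_all add: algebra_simps)
      have "w1 * w2 \<noteq> z" using 1(1) False by (auto simp: algebra_simps)
      moreover have "(w1 * w2 - z) * (mU - mV) = 0"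
      proof -
        have "(w1 * w2 - z) * (mU - mV) = w1 * w2 * mU - w1 * w2 * mV - z * mU + z * mV"
          by (simp add: algebra_simps)
        also have "\<dots> = 0" unfolding 1 by (simp add: algebra_simps)
        finally show ?thesis .
      qed
      ultimately show ?thesis by simp
    qed
    moreover have "norm ((z / mU\<^sup>2) *\<^sub>C ((U * resolvent U w2 - pU *\<^sub>C 1) * (V * resolvent V w1 - pV *\<^sub>C 1))) < 1"
    proof -
      have "norm ((z / mU\<^sup>2) *\<^sub>C ((U * resolvent U w2 - pU *\<^sub>C 1) * (V * resolvent V w1 - pV *\<^sub>C 1)))
        \<le> cmod (z / mU\<^sup>2) * (norm (U * resolvent U w2 - pU *\<^sub>C 1) * norm (V * resolvent V w1 - pV *\<^sub>C 1))"
        unfolding norm_cop_scaleC by (intro mult_left_mono norm_mult_ineq) simp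
      also have "\<dots> = cmod z * (?N U w2 * ?N V w1)"
        using nz \<open>mU = mV\<close> by (simp add: defs norm_divide norm_mult power2_eq_square)
      also have "\<dots> \<le> cmod z * (K * K)"
        using KF w12 K0 by (intro mult_left_mono mult_mono) auto
      also have "\<dots> < 1" using zK(2) by (simp add: power2_eq_square)
      finally show ?thesis .
    qed
    ultimately have "subordinate U V z w1 w2"
      using in_ball w12 nz eq unfolding subordinate_def defs by auto
    then show "\<exists>w1 w2. cmod w1 \<le> r \<and> cmod w2 \<le> r \<and> subordinate U V z w1 w2"
      using w12 \<rho>(2) by (intro exI[of _ w1] exI[of _ w2]) auto
  qed
qed

section \<open>Moments for a fixed solution of the subordination equations\<close>

context
  fixes U V :: "'h cop" and z w1 w2 :: complex
  assumes U: "U \<in> AU" and V: "V \<in> AV" and zUV: "norm (z *\<^sub>C (U * V)) < 1"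
    and sub: "subordinate U V z w1 w2"
begin

definition "a = resolvent U w2"
definition "b = resolvent V w1"
definition "m = \<psi> a"
definition "p0 = U * a - \<psi> (U * a) *\<^sub>C 1"
definition "q0 = V * b - \<psi> (V * b) *\<^sub>C 1"
definition "\<kappa> = z / m\<^sup>2"
definition "S = q0 * op_inv (1 - \<kappa> *\<^sub>C (p0 * q0))"

lemma sub_facts:
  shows small: "norm (w1 *\<^sub>C V) < 1" "norm (w2 *\<^sub>C U) < 1" "norm (\<kappa> *\<^sub>C (p0 * q0)) < 1"
    and m: "m \<noteq> 0" "\<psi> b = m" "w1 * m = z * \<psi> (U * a)" "w2 * m = z * \<psi> (V * b)"
  using sub by (auto simp: subordinate_def a_def b_def m_def p0_def q0_def \<kappa>_def)

lemma mem: "a \<in> AU" "b \<in> AV"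
  unfolding a_def b_def
  by (intro subalgebra_op_inv AU AV subalgebra_intros[OF AU(1)] subalgebra_intros[OF AV(1)] U V small)+

lemma centered_p0_q0: "centered True p0" "centered False q0"
  unfolding p0_def q0_def
  by (intro centered_diff; simp add: alg_def subalgebra_mult[OF AU(1)] subalgebra_mult[OF AV(1)] mem U V)+

lemma a_eq: "a = m *\<^sub>C 1 + w2 *\<^sub>C p0" and b_eq: "b = m *\<^sub>C 1 + w1 *\<^sub>C q0"
proof -
  have a: "a = 1 + w2 *\<^sub>C (U * a)" unfolding a_def by (rule resolvent_eq[OF small(2)])
  have b: "b = 1 + w1 *\<^sub>C (V * b)" unfolding b_def by (rule resolvent_eq[OF small(1)])
  have "m = 1 + w2 * \<psi> (U * a)" unfolding m_def a_def by (rule psi_resolvent[OF small(2)])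
  then show "a = m *\<^sub>C 1 + w2 *\<^sub>C p0"
    by (subst a) (simp add: p0_def scaleC_diff_right scaleC_scaleC scaleC_add_left)
  have "m = 1 + w1 * \<psi> (V * b)"
    unfolding m(2)[symmetric] b_def by (rule psi_resolvent[OF small(1)])
  then show "b = m *\<^sub>C 1 + w1 *\<^sub>C q0"
    by (subst b) (simp add: q0_def scaleC_diff_right scaleC_scaleC scaleC_add_left)
qed

lemma m_minus_1: "w2 * \<psi> (U * a) = m - 1" "w1 * \<psi> (V * b) = m - 1"
  using psi_resolvent[OF small(2)] psi_resolvent[OF small(1)] m(2) by (simp_all add: m_def a_def b_def)

text \<open>The expansion in \<open>1\<close>, \<open>p0\<close>, \<open>q0\<close> and
  \<open>p0 * q0\<close> has coefficients governed by \<open>subordinate\<close> and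
  \<open>m_minus_1\<close>; the constant one is \<open>m * m - m * (m - 1) = m\<close>.\<close>

lemma resolvent_factorization:
  "a * (1 - z *\<^sub>C (U * V)) * b = m *\<^sub>C (1 - \<kappa> *\<^sub>C (p0 * q0))"
proof -
  define P Q where "P = \<psi> (U * a)" and "Q = \<psi> (V * b)"
  note m' = m[folded P_def Q_def] and m_minus_1' = m_minus_1[folded P_def Q_def]
  have aU: "a * U = P *\<^sub>C 1 + p0"
    using resolvent_commute[OF small(2)] by (simp add: a_def p0_def P_def)
  have Vb: "V * b = Q *\<^sub>C 1 + q0" by (simp add: q0_def Q_def)
  have "a * (1 - z *\<^sub>C (U * V)) * b = a * b - z *\<^sub>C ((a * U) * (V * b))"
    by (simp add: algebra_simps)
  also have "\<dots> = (m * m - z * P * Q) *\<^sub>C 1 + (m * w2 - z * Q) *\<^sub>C p0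
      + (m * w1 - z * P) *\<^sub>C q0 + (w1 * w2 - z) *\<^sub>C (p0 * q0)"
    unfolding aU Vb unfolding a_eq b_eq
    by (simp add: algebra_simps scaleC_add_left scaleC_diff_left scaleC_add_right scaleC_diff_right scaleC_scaleC)
  also have "m * m - z * P * Q = m"
  proof -
    have "z * P * Q = (w1 * m) * Q" using m'(3) by simp
    also have "\<dots> = m * (w1 * Q)" by simp
    finally show ?thesis unfolding m_minus_1' by (simp add: algebra_simps)
  qed
  also have "m * w2 - z * Q = 0" using m'(4) by (simp add: mult.commute)
  also have "m * w1 - z * P = 0" using m'(3) by (simp add: mult.commute)
  also have "w1 * w2 - z = - (m * \<kappa>)"
  proof -
    have "m * (w1 * w2) = w2 * (w1 * m)" by simp
    also have "\<dots> = z * (w2 * P)" unfolding m'(3) by simp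
    also have "\<dots> = z * (m - 1)" unfolding m_minus_1' ..
    finally show ?thesis using m'(1) by (simp add: \<kappa>_def field_simps power2_eq_square)
  qed
  finally show ?thesis by (simp add: scaleC_diff_right scaleC_scaleC)
qed

definition "g = inverse m *\<^sub>C a"

text \<open>The right side is multiplied by \<open>?E\<close> from the right:
  \<open>g * ?E = ?K * ?b'\<close> by the factorization, \<open>S * ?K = q0\<close>, and since
  \<open>g = 1 + (\<kappa> * ?Q) *\<^sub>C p0\<close> the products \<open>p0 * q0\<close> cancel in
  \<open>?Q *\<^sub>C ?K + g * q0 = V * b\<close>.\<close>

lemma V_resolvent:
  "V * op_inv (1 - z *\<^sub>C (U * V)) = \<psi> (V * b) *\<^sub>C g + g * S * g"
proof -
  let ?Q = "\<psi> (V * b)" and ?E = "1 - z *\<^sub>C (U * V)" and ?K = "1 - \<kappa> *\<^sub>C (p0 * q0)"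
  let ?b' = "1 - w1 *\<^sub>C V"
  have bb: "b * ?b' = 1" unfolding b_def by (rule neumann_series(2)[OF small(1)])
  have "g * ?E * b = ?K"
    using resolvent_factorization m(1) by (simp add: g_def scaleC_scaleC)
  then have "g * ?E * (b * ?b') = ?K * ?b'" by (simp only: mult.assoc[symmetric])
  then have gE: "g * ?E = ?K * ?b'" by (simp only: bb mult_1_right)
  have g: "g = 1 + (\<kappa> * ?Q) *\<^sub>C p0"
  proof -
    have "inverse m * w2 = \<kappa> * ?Q"
      using m(1) m(4) by (simp add: \<kappa>_def field_simps power2_eq_square)
    then show ?thesis
      unfolding g_def using m(1) by (subst a_eq) (simp add: scaleC_add_right scaleC_scaleC)
  qed
  have SK: "S * ?K = q0"
    using neumann_series(2)[OF small(3)] by (simp add: S_def mult.assoc)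
  have "(?Q *\<^sub>C g + g * S * g) * ?E = (?Q *\<^sub>C ?K + g * (S * ?K)) * ?b'"
    by (simp only: distrib_right mult.assoc gE cop_scale_mult)
  also have "?Q *\<^sub>C ?K + g * (S * ?K) = V * b"
    unfolding SK by (subst g)
      (simp add: q0_def scaleC_diff_right scaleC_scaleC distrib_right mult.commute[of \<kappa>])
  also have "V * b * ?b' = V" using bb by (simp add: mult.assoc)
  finally have "(?Q *\<^sub>C g + g * S * g) * (?E * op_inv ?E) = V * op_inv ?E"
    by (simp only: mult.assoc[symmetric])
  then show ?thesis using neumann_series(1)[OF zUV] by simp
qed

lemma mem_g: "g \<in> AU" unfolding g_def by (intro subalgebra_intros[OF AU(1)] mem)

text \<open>The first summand of \<open>V_resolvent\<close> factors by freeness; the second is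
  \<open>series_moment\<close> with \<open>r = f * g\<close> and \<open>r' = g * f\<close>. For
  \<open>f = U * op_inv (1 - U)\<close> and \<open>h = V ^ k\<close> these are, up to the factor
  \<open>z\<close>, the moments that determine the conditional expectation.\<close>

lemma moment_two_sided:
  assumes h: "h \<in> AV" and f: "f \<in> AU"
  shows "\<psi> (h * (f * (V * op_inv (1 - z *\<^sub>C (U * V))) * f))
    = \<psi> (V * resolvent V w1) * \<psi> h * (\<psi> (f * resolvent U w2 * f) / \<psi> (resolvent U w2))
      + \<psi> (f * resolvent U w2) * \<psi> (resolvent U w2 * f) / (\<psi> (resolvent U w2))\<^sup>2
        * (\<psi> (h * (V * resolvent V w1)) - \<psi> (V * resolvent V w1) * \<psi> h)"
proof -
  have "h * (f * (V * op_inv (1 - z *\<^sub>C (U * V))) * f)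
      = \<psi> (V * b) *\<^sub>C (h * (f * g * f)) + h * (f * g) * S * (g * f)"
    unfolding V_resolvent by (simp add: algebra_simps)
  moreover have "\<psi> (h * (f * g * f)) = \<psi> h * \<psi> (f * g * f)"
    by (intro product_moment h subalgebra_intros[OF AU(1)] f mem_g)
  moreover have "\<psi> (h * (f * g) * S * (g * f)) = \<psi> (f * g) * \<psi> (g * f) * \<psi> (h * q0)"
    unfolding S_def
    by (intro series_moment centered_p0_q0 small h subalgebra_intros[OF AU(1)] f mem_g)
  moreover have "\<psi> (h * q0) = \<psi> (h * (V * b)) - \<psi> (V * b) * \<psi> h"
    by (simp add: q0_def right_diff_distrib)
  ultimately have "\<psi> (h * (f * (V * op_inv (1 - z *\<^sub>C (U * V))) * f))
    = \<psi> (V * b) * \<psi> h * (\<psi> (f * a * f) / m)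
      + \<psi> (f * a) * \<psi> (a * f) / m\<^sup>2 * (\<psi> (h * (V * b)) - \<psi> (V * b) * \<psi> h)"
    using m(1) by (simp add: g_def divide_inverse power2_eq_square)
  then show ?thesis unfolding m_def a_def b_def .
qed

text \<open>With \<open>h = 1\<close> the series contributes the factor
  \<open>\<psi> q0 = 0\<close>. As the first left side is the moment of the sandwiched product,
  \<open>w1\<close> and \<open>w2\<close> satisfy the same moment identities as the subordination
  functions.\<close>

lemma moment_subordinate:
  "z * \<psi> (U * (V * op_inv (1 - z *\<^sub>C (U * V)))) = \<psi> (Psi U w2)"
  "\<psi> (Psi V w1) = \<psi> (Psi U w2)"
proof -
  have "U * (V * op_inv (1 - z *\<^sub>C (U * V)))
      = \<psi> (V * b) *\<^sub>C (U * g) + 1 * (U * g) * S * g"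
    unfolding V_resolvent by (simp add: algebra_simps)
  moreover have "\<psi> (1 * (U * g) * S * g) = \<psi> (U * g) * \<psi> g * \<psi> (1 * q0)"
    unfolding S_def
    by (intro series_moment centered_p0_q0 small subalgebra_intros[OF AU(1)] subalgebra_one[OF AV(1)] U mem_g)
  moreover have "\<psi> q0 = 0" using centered_p0_q0(2) by (simp add: centered_def)
  ultimately have "\<psi> (U * (V * op_inv (1 - z *\<^sub>C (U * V)))) = \<psi> (V * b) * \<psi> (U * g)" by simp
  then have "z * \<psi> (U * (V * op_inv (1 - z *\<^sub>C (U * V)))) = (w2 * m) * (inverse m * \<psi> (U * a))"
    unfolding m(4) by (simp add: g_def)
  also have "\<dots> = w2 * \<psi> (U * a)" using m(1) by simp
  finally show "z * \<psi> (U * (V * op_inv (1 - z *\<^sub>C (U * V)))) = \<psi> (Psi U w2)"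
    by (simp add: Psi_eq a_def)
  show "\<psi> (Psi V w1) = \<psi> (Psi U w2)"
    using m_minus_1 by (simp add: Psi_eq a_def b_def)
qed

end

section \<open>Local injectivity and derivative of the moment function\<close>

text \<open>By the resolvent identity two values differ by \<open>(w - w') * ?h (w, w')\<close>, and
  the second factor tends to \<open>\<psi> X \<noteq> 0\<close> at the origin.\<close>

lemma Psi_moment_injective:
  fixes X :: "'h cop"
  assumes "\<psi> X \<noteq> 0"
  obtains r where "r > 0" "\<And>w w'. cmod w \<le> r \<Longrightarrow> cmod w' \<le> r \<Longrightarrow> \<psi> (Psi X w) = \<psi> (Psi X w') \<Longrightarrow> w = w'"
proof -
  let ?h = "\<lambda>x. \<psi> (resolvent X (fst x) * X * resolvent X (snd x))"
  have f: "filterlim fst (nhds (0::complex)) (nhds (0::complex, 0::complex))"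
    using tendsto_fst[OF filterlim_ident[of "nhds (0::complex, 0::complex)"]] by simp
  have s: "filterlim snd (nhds (0::complex)) (nhds (0::complex, 0::complex))"
    using tendsto_snd[OF filterlim_ident[of "nhds (0::complex, 0::complex)"]] by simp
  have r0: "(resolvent X \<longlongrightarrow> resolvent X 0) (nhds 0)" by (rule tendsto_resolvent) simp
  have "(?h \<longlongrightarrow> \<psi> (resolvent X 0 * X * resolvent X 0)) (nhds (0, 0))"
    by (intro bounded_linear.tendsto[OF bounded] tendsto_mult tendsto_const
        filterlim_compose[OF r0 f] filterlim_compose[OF r0 s])
  moreover have "resolvent X 0 = 1" using resolvent_eq[of 0 X] by simp
  ultimately have "(?h \<longlongrightarrow> \<psi> X) (nhds (0, 0))" by simp
  then have "\<forall>\<^sub>F x in nhds (0, 0). ?h x \<noteq> 0" using assms by (rule tendsto_imp_eventually_ne)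
  then obtain d where d: "d > 0" "\<And>x. dist x (0, 0) < d \<Longrightarrow> ?h x \<noteq> 0"
    unfolding eventually_nhds_metric by blast
  have "\<forall>\<^sub>F w in nhds 0. norm (w *\<^sub>C X) < 1" by (rule eventually_resolvent) simp
  then obtain e where e: "e > 0" "\<And>w. dist w 0 < e \<Longrightarrow> norm (w *\<^sub>C X) < 1"
    unfolding eventually_nhds_metric by blast
  show thesis
  proof (rule that[of "min (d / 4) (e / 2)"])
    show "0 < min (d / 4) (e / 2)" using d e by simp
    fix w w' :: complex
    assume w: "cmod w \<le> min (d / 4) (e / 2)" "cmod w' \<le> min (d / 4) (e / 2)"
      and eq: "\<psi> (Psi X w) = \<psi> (Psi X w')"
    have small: "norm (w *\<^sub>C X) < 1" "norm (w' *\<^sub>C X) < 1" using e w by auto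
    have "dist (w, w') (0, 0) \<le> cmod w + cmod w'"
      by (simp add: dist_Pair_Pair sqrt_sum_squares_le_sum)
    also have "\<dots> < d" using w d(1) by auto
    finally have nz: "?h (w, w') \<noteq> 0" by (rule d(2))
    have "resolvent X w - resolvent X w' = (w - w') *\<^sub>C (resolvent X w * X * resolvent X w')"
      by (rule resolvent_diff[OF small])
    then have "(w - w') * ?h (w, w') = \<psi> (resolvent X w) - \<psi> (resolvent X w')"
      by (metis fst_conv psi_simps(2) scale snd_conv)
    also have "\<dots> = 0" using eq by (simp add: resolvent_eq_Psi small)
    finally show "w = w'" using nz by simp
  qed
qed

lemma DERIV_psi_resolvent:
  fixes X :: "'h cop"
  assumes "norm (w0 *\<^sub>C X) < 1"
  shows "((\<lambda>w. \<psi> (resolvent X w)) has_field_derivative \<psi> (resolvent X w0 * X * resolvent X w0)) (at w0)"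
  unfolding has_field_derivative_iff
proof (rule Lim_transform_eventually)
  have "(resolvent X \<longlongrightarrow> resolvent X w0) (at w0)"
    by (rule tendsto_mono[OF at_within_le_nhds tendsto_resolvent[OF assms]])
  then show "((\<lambda>w. \<psi> (resolvent X w * X * resolvent X w0)) \<longlongrightarrow> \<psi> (resolvent X w0 * X * resolvent X w0)) (at w0)"
    by (intro bounded_linear.tendsto[OF bounded] tendsto_mult tendsto_const)
  have "\<forall>\<^sub>F w in at w0. norm (w *\<^sub>C X) < 1"
    using eventually_resolvent[OF assms] by (rule filter_leD[OF at_within_le_nhds])
  moreover have "\<forall>\<^sub>F w in at w0. w \<noteq> w0" by (rule eventually_neq_at_within)
  ultimately show "\<forall>\<^sub>F w in at w0. \<psi> (resolvent X w * X * resolvent X w0)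
      = (\<psi> (resolvent X w) - \<psi> (resolvent X w0)) / (w - w0)"
  proof eventually_elim
    case (elim w)
    have "\<psi> (resolvent X w) - \<psi> (resolvent X w0) = (w - w0) * \<psi> (resolvent X w * X * resolvent X w0)"
      unfolding psi_simps(2)[symmetric] resolvent_diff[OF elim(1) assms] by simp
    then show ?case using elim(2) by simp
  qed
qed

end

section \<open>The two-sided resolvent formula\<close>

text \<open>The series starts with exponent 1, so a factor \<open>z\<close> splits off and leaves a
  power series that is continuous at 0.\<close>

lemma power_series_tendsto_zero:
  fixes \<omega> :: "complex \<Rightarrow> complex"
  assumes "\<forall>\<^sub>F z in nhds 0. (\<lambda>k. c k * z ^ (k + 1)) sums \<omega> z"
  shows "(\<omega> \<longlongrightarrow> 0) (nhds 0)"
proof -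
  obtain d where d: "d > 0" "\<And>z. dist z 0 < d \<Longrightarrow> (\<lambda>k. c k * z ^ (k + 1)) sums \<omega> z"
    using assms unfolding eventually_nhds_metric by blast
  \<comment> \<open>A nonzero point of convergence gives the divided series a positive
    radius.\<close>
  define z0 where "z0 = complex_of_real (d / 2)"
  have z0: "z0 \<noteq> 0" "dist z0 0 < d" using d(1) by (auto simp: z0_def)
  have "summable (\<lambda>k. inverse z0 * (c k * z0 ^ (k + 1)))"
    by (intro summable_mult sums_summable[OF d(2)] z0)
  then have "summable (\<lambda>k. c k * z0 ^ k)" using z0(1) by (simp add: field_simps)
  then have "isCont (\<lambda>z. \<Sum>k. c k * z ^ k) 0"
    by (rule isCont_powser) (use z0 in simp)
  then have lim: "((\<lambda>z. \<Sum>k. c k * z ^ k) \<longlongrightarrow> (\<Sum>k. c k * 0 ^ k)) (nhds 0)"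
    unfolding isCont_def tendsto_at_iff_tendsto_nhds[of "\<lambda>z. \<Sum>k. c k * z ^ k" 0] .
  have "((\<lambda>z. z * (\<Sum>k. c k * z ^ k)) \<longlongrightarrow> 0 * (\<Sum>k. c k * 0 ^ k)) (nhds 0)"
    by (intro tendsto_mult lim filterlim_ident)
  moreover have "\<forall>\<^sub>F z in nhds 0. z * (\<Sum>k. c k * z ^ k) = \<omega> z"
    using assms
  proof eventually_elim
    case (elim z)
    show ?case
    proof (cases "z = 0")
      case True
      then show ?thesis using elim sums_unique[OF elim] by simp
    next
      case False
      have "(\<lambda>k. inverse z * (c k * z ^ (k + 1))) sums (inverse z * \<omega> z)"
        by (intro sums_mult elim)
      then have "(\<lambda>k. c k * z ^ k) sums (inverse z * \<omega> z)" using False by (simp add: field_simps)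
      then show ?thesis using False by (simp add: sums_iff)
    qed
  qed
  ultimately show ?thesis using Lim_transform_eventually by force
qed

lemma Psi_sandwich:
  assumes "R * R = X" "norm (z *\<^sub>C (R * Y * R)) < 1" "norm (z *\<^sub>C (X * Y)) < 1"
  shows "Psi (R * Y * R) z = z *\<^sub>C (R * (Y * op_inv (1 - z *\<^sub>C (X * Y))) * R)"
proof -
  have "op_inv (1 - z *\<^sub>C (X * Y)) * R = R * op_inv (1 - z *\<^sub>C (R * Y * R))"
    using assms by (intro intertwine_op_inv) (auto simp: algebra_simps)
  then show ?thesis by (simp add: Psi_eq mult.assoc)
qed

lemma eventually_small: "\<forall>\<^sub>F z in nhds 0. norm (z *\<^sub>C X) < 1" for X :: "'h::chilbert_space cop"
  by (rule eventually_resolvent) simp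

text \<open>With \<open>D = E L - R\<close>, normality upgrades agreement on powers of
  \<open>V\<close> to \<open>\<phi> (adj D * L) = \<phi> (adj D * R)\<close>. The bimodule property
  and invariance of \<phi> replace \<open>L\<close> by \<open>E L\<close>, so
  \<open>\<phi> (adj D * D) = 0\<close>, and faithfulness gives \<open>D = 0\<close>.\<close>

lemma conditional_expectation_eqI:
  fixes M :: "'h::chilbert_space cop set"
  assumes M: "tracial_W_star_prob_space M \<phi>" and V: "self_adjoint V" "V \<in> M"
    and E: "conditional_expectation M \<phi> (vn_generated {V}) E"
    and L: "L \<in> M" and R: "R \<in> vn_generated {V}"
    and eq: "\<And>k. \<phi> (V ^ k * L) = \<phi> (V ^ k * R)"
  shows "E L = R"
proof -
  let ?N = "vn_generated {V}"
  have vn: "von_neumann_algebra M" and st: "state_on M \<phi>" and normal: "normal_on M \<phi>"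
    and faithful: "faithful_on M \<phi>"
    using M by (auto simp: tracial_W_star_prob_space_def)
  note cM = von_neumann_closed_subalgebra[OF vn] and cN = closed_subalgebra_vn_generated[of "{V}"]
  have NM: "?N \<subseteq> M" by (rule vn_generated_subset[OF vn]) (use V in simp)
  have add: "\<phi> (A + B) = \<phi> A + \<phi> B" and scale: "\<phi> (c *\<^sub>C A) = c * \<phi> A" if "A \<in> M" "B \<in> M" for A B c
    using st that by (auto simp: state_on_def)
  have diff: "\<phi> (A - B) = \<phi> A - \<phi> B" if "A \<in> M" "B \<in> M" for A B
    using add[of A "(- 1) *\<^sub>C B"] scale[of B B "- 1"] that subalgebra_scaleC[OF cM, of B "- 1"] by simp
  define D where "D = E L - R"
  have EL: "E L \<in> ?N" using E L by (auto simp: conditional_expectation_def)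
  have D: "adj D \<in> ?N" "adj D \<in> M"
    unfolding D_def using NM vn_generated_adj[OF subalgebra_diff[OF cN EL R]] by auto
  have mem: "L \<in> M" "R \<in> M" "E L \<in> M" using L R EL NM by auto
  have "\<phi> (adj D * (L - R)) = 0"
  proof (rule normal_on_vn_generated_zero[OF cM normal _ V D])
    show "L - R \<in> M" by (intro subalgebra_intros[OF cM] mem)
    show "\<phi> (V ^ k * (L - R)) = 0" for k
      using eq[of k] by (simp add: right_diff_distrib diff subalgebra_intros[OF cM] mem V)
  qed (use scale in blast)
  then have z: "\<phi> (adj D * L) = \<phi> (adj D * R)"
    by (simp add: right_diff_distrib diff subalgebra_intros[OF cM] mem D)
  have "E (adj D * L * 1) = adj D * E L * 1"
    using E L D(1) subalgebra_one[OF cN] unfolding conditional_expectation_def by blast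
  moreover have "\<phi> (E (adj D * L)) = \<phi> (adj D * L)"
    using E subalgebra_mult[OF cM D(2) L] unfolding conditional_expectation_def by blast
  ultimately have "\<phi> (adj D * E L) = \<phi> (adj D * R)" using z by simp
  moreover have "adj D * D = adj D * E L - adj D * R" by (simp only: D_def right_diff_distrib)
  ultimately have "\<phi> (adj D * D) = 0"
    by (simp add: diff subalgebra_intros[OF cM] mem D)
  moreover have "D \<in> M" unfolding D_def by (intro subalgebra_intros[OF cM] mem)
  ultimately have "D = 0" using faithful by (auto simp: faithful_on_def)
  then show ?thesis by (simp add: D_def)
qed

lemma eta_eq:
  assumes "moment_transform \<phi> X w = m - 1" "m \<noteq> 0"
  shows "eta \<phi> X w = 1 - 1 / m"
  using assms by (simp add: eta_def diff_divide_distrib)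

theorem proposition3p7:
  fixes M :: "'h::chilbert_space cop set" and \<phi> :: "'h cop \<Rightarrow> complex"
    and U V :: "'h cop" and EU EV :: "'h cop \<Rightarrow> 'h cop" and \<omega>1 \<omega>2 :: "complex \<Rightarrow> complex"
  assumes "tracial_W_star_prob_space M \<phi>"
    and "U \<in> M" and "V \<in> M" and "free_elements \<phi> U V"
    and "self_adjoint U" and "op_spectrum U \<subseteq> complex_of_real ` {0..<1}"
    and "positive_op V"
    and "conditional_expectation M \<phi> (vn_generated {U}) EU"
    and "conditional_expectation M \<phi> (vn_generated {V}) EV"
    and "subordination_functions \<phi> EU EV U V \<omega>1 \<omega>2"
  shows "\<forall>\<^sub>F z in nhds 0.
      moment_transform \<phi> (sandwich U V) z = moment_transform \<phi> V (\<omega>1 z) \<and>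
      moment_transform \<phi> (sandwich U V) z = moment_transform \<phi> U (\<omega>2 z) \<and>
      (let A = (eta \<phi> U (\<omega>2 z) - eta \<phi> U 1) / (\<omega>2 z - 1) * \<phi> (op_inv (1 - U));
           B = \<omega>2 z * (eta \<phi> U (\<omega>2 z) - eta \<phi> U 1 - (\<omega>2 z - 1) * deriv (eta \<phi> U) 1)
                 / (\<omega>2 z - 1)\<^sup>2 * (\<phi> (op_inv (1 - U)))\<^sup>2
       in EV (op_inv (1 - U) * op_sqrt U * Psi (sandwich U V) z * op_sqrt U * op_inv (1 - U))
            = B *\<^sub>C 1 + (z * A\<^sup>2) *\<^sub>C (V * (1 + Psi V (\<omega>1 z))))"
proof -
  have vn: "von_neumann_algebra M" and st: "state_on M \<phi>" and normal: "normal_on M \<phi>"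
    and faithful: "faithful_on M \<phi>" and tracial: "tracial_on M \<phi>"
    using assms(1) by (auto simp: tracial_W_star_prob_space_def)
  note cM = von_neumann_closed_subalgebra[OF vn]
  obtain \<psi> where \<psi>: "bounded_linear \<psi>" "\<And>c A. \<psi> (c *\<^sub>C A) = c * \<psi> A" "\<And>A. A \<in> M \<Longrightarrow> \<psi> A = \<phi> A"
    by (rule normal_on_extension[OF normal]) blast
  have \<psi>1: "\<psi> 1 = 1" using \<psi>(3)[OF subalgebra_one[OF cM]] st by (simp add: state_on_def)
  define AU AV where "AU = closure (unital_algebra {U})" and "AV = closure (unital_algebra {V})"
  have cAU: "closed_subalgebra AU" and cAV: "closed_subalgebra AV"
    by (simp_all add: AU_def AV_def closed_subalgebra_closure)
  have UAU: "U \<in> AU" and VAV: "V \<in> AV"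
    using closure_subset unital_algebra.gen unfolding AU_def AV_def by blast+
  have AUM: "AU \<subseteq> M" and AVM: "AV \<subseteq> M"
    unfolding AU_def AV_def by (intro unital_algebra_subset cM; simp add: assms)+
  have alg_diff: "A - c *\<^sub>C 1 \<in> unital_algebra {X}" if "A \<in> unital_algebra {X}" for A X :: "'h cop" and c
    using unital_algebra.add[OF that unital_algebra.scale[OF unital_algebra.one, of "- c"]] by simp
  have sub_closure: "unital_algebra {X} \<subseteq> closure (unital_algebra {X})" for X :: "'h cop"
    by (rule closure_subset)
  \<comment> \<open>All letters and their products lie in \<open>M\<close>, where \<psi> and \<phi>
    agree.\<close>
  have "free_algebras \<psi> (unital_algebra {U}) (unital_algebra {V})"
    unfolding free_algebras_def
  proof (intro allI impI, elim conjE)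
    fix Xs assume Xs: "Xs \<noteq> []" "\<forall>X\<in>set Xs. \<psi> X = 0"
      and alt: "alternates_in (unital_algebra {U}) (unital_algebra {V}) Xs \<or>
        alternates_in (unital_algebra {V}) (unital_algebra {U}) Xs"
    have XM: "X \<in> M" if X: "X \<in> set Xs" for X
    proof -
      obtain i where "i < length Xs" "X = Xs ! i" using X by (auto simp: in_set_conv_nth)
      then have "X \<in> unital_algebra {U} \<or> X \<in> unital_algebra {V}"
        using alt unfolding alternates_in_def by (metis (full_types))
      then show ?thesis using AUM AVM sub_closure unfolding AU_def AV_def by blast
    qed
    have "\<forall>X\<in>set Xs. \<phi> X = 0" using Xs(2) XM \<psi>(3) by auto
    then have "\<phi> (prod_list Xs) = 0"
      using assms(4) Xs(1) alt unfolding free_elements_def free_algebras_def by blast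
    moreover have "prod_list Xs \<in> M"
      using XM by (induction Xs) (auto intro: subalgebra_intros[OF cM])
    ultimately show "\<psi> (prod_list Xs) = 0" using \<psi>(3) by simp
  qed
  then have free: "free_algebras \<psi> AU AV"
    unfolding AU_def AV_def
    by (intro free_algebras_closure \<psi>(1) alg_diff) (simp_all add: \<psi>(2) \<psi>1)
  interpret free_pair M AU AV \<psi>
  proof (rule free_pair.intro)
    show "\<psi> (A * B) = \<psi> (B * A)" if "A \<in> M" "B \<in> M" for A B
      using that tracial by (simp add: \<psi>(3) subalgebra_mult[OF cM] tracial_on_def)
  qed (fact cM cAU AUM cAV AVM \<psi>(1,2) \<psi>1 free)+

  have Upos: "positive_op U" and Unorm: "norm U < 1"
    using spectrum_unit_interval[OF assms(5,6)] by auto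
  define R S where "R = op_sqrt U" and "S = op_sqrt V"
  have R: "positive_op R" "R * R = U" "R \<in> AU" "R \<in> M"
    using op_sqrt[OF Upos] cAU UAU AUM by (auto simp: R_def)
  have S: "positive_op S" "S * S = V" "S \<in> AV" "S \<in> M"
    using op_sqrt[OF assms(7)] cAV VAV AVM by (auto simp: S_def)
  have Vsa: "self_adjoint V" using assms(7) positive_op_iff by blast
  \<comment> \<open>Faithfulness applies because \<open>X\<close> is the square of its self-adjoint
    root.\<close>
  have pos_nz: "\<psi> X \<noteq> 0" if X: "X \<in> M" "positive_op X" "X \<noteq> 0" for X
  proof -
    have T: "positive_op (op_sqrt X)" "op_sqrt X * op_sqrt X = X" "op_sqrt X \<in> M"
      using op_sqrt[OF X(2)] cM X(1) by auto
    have sa: "adj (op_sqrt X) = op_sqrt X" using T(1) by (simp add: positive_op_iff self_adjoint_def)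
    have "op_sqrt X \<noteq> 0" using T(2) X(3) by auto
    then have "\<phi> X \<noteq> 0" using faithful T sa unfolding faithful_on_def by metis
    then show ?thesis using \<psi>(3) X(1) by simp
  qed

  \<comment> \<open>The outer factors in the expectation absorb the square roots of the sandwich and
    become \<open>f\<close>. The scalars \<sigma> and \<nu> will be the value and the derivative of
    the mean of \<open>resolvent U\<close> at 1.\<close>
  define s where "s = op_inv (1 - U)"
  define f where "f = U * s"
  define \<sigma> \<nu> where "\<sigma> = \<psi> s" and "\<nu> = \<psi> (f * s)"
  have s1: "(1 - U) * s = 1" "s * (1 - U) = 1"
    unfolding s_def by (rule neumann_series(1,2)[OF Unorm])+
  have sAU: "s \<in> AU" unfolding s_def by (rule subalgebra_op_inv[OF cAU UAU Unorm])
  have fAU: "f \<in> AU" unfolding f_def by (intro subalgebra_mult[OF cAU] UAU sAU)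
  have sU: "s * U = f"
    using resolvent_commute[of 1 U] Unorm by (simp add: s_def f_def)
  \<comment> \<open>Positivity of \<open>s\<close>, which gives \<sigma> \<noteq> 0, follows from
    that of the form of \<open>1 - U\<close> at \<open>cop_apply s x\<close>.\<close>
  have spos: "positive_op s"
    unfolding positive_op_iff self_adjoint_iff
  proof (intro conjI allI)
    have app: "x = cop_apply (1 - U) (cop_apply s x)" for x
      using arg_cong[OF s1(1), of "\<lambda>T. cop_apply T x"] by simp
    have sa: "cop_apply (1 - U) x \<bullet> y = x \<bullet> cop_apply (1 - U) y" for x y
      using assms(5) by (simp add: self_adjoint_iff inner_simps)
    show "cop_apply s x \<bullet> y = x \<bullet> cop_apply s y" for x y
      by (metis app sa)
    show "0 \<le> x \<bullet> cop_apply s x" for x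
    proof -
      let ?y = "cop_apply s x"
      have "?y \<bullet> cop_apply U ?y \<le> norm ?y * (norm U * norm ?y)"
        by (meson norm_cauchy_schwarz norm_cop_apply mult_left_mono norm_ge_zero order_trans)
      also have "\<dots> \<le> norm ?y * (1 * norm ?y)"
        using Unorm by (intro mult_left_mono mult_right_mono) auto
      finally have "0 \<le> cop_apply (1 - U) ?y \<bullet> ?y"
        by (simp add: inner_simps dot_square_norm power2_eq_square inner_commute)
      then show ?thesis using app[of x] by simp
    qed
  qed
  have "s \<noteq> 0" using s1 by auto
  then have \<sigma>0: "\<sigma> \<noteq> 0" unfolding \<sigma>_def using pos_nz spos sAU AUM by blast

  have Psi_mem: "Psi X w \<in> M" if "X \<in> M" "norm (w *\<^sub>C X) < 1" for X w
    unfolding Psi_eq by (intro subalgebra_intros[OF cM] subalgebra_op_inv[OF cM] that)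
  have mt: "moment_transform \<phi> X w = \<psi> (resolvent X w) - 1" if "X \<in> M" "norm (w *\<^sub>C X) < 1" for X w
    using \<psi>(3)[OF Psi_mem[OF that]] by (simp add: moment_transform_def resolvent_eq_Psi that)
  have mtPsi: "moment_transform \<phi> X w = \<psi> (Psi X w)" if "X \<in> M" "norm (w *\<^sub>C X) < 1" for X w
    using \<psi>(3)[OF Psi_mem[OF that]] by (simp add: moment_transform_def)
  have eta1: "eta \<phi> U 1 = 1 - 1 / \<sigma>"
    using Unorm \<sigma>0 assms(2) by (intro eta_eq) (simp_all add: mt \<sigma>_def s_def)
  have deriv1: "deriv (eta \<phi> U) 1 = \<nu> / \<sigma>\<^sup>2"
  proof (rule DERIV_imp_deriv)
    have n1: "norm (1 *\<^sub>C U) < 1" using Unorm by simp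
    have r1: "resolvent U 1 = s" by (simp add: s_def)
    have "((\<lambda>w. \<psi> (resolvent U w)) has_field_derivative \<nu>) (at 1)"
      using DERIV_psi_resolvent[OF n1] unfolding r1 sU \<nu>_def .
    then have "((\<lambda>w. 1 - 1 / \<psi> (resolvent U w)) has_field_derivative \<nu> / \<sigma>\<^sup>2) (at 1)"
      using \<sigma>0 by (auto intro!: derivative_eq_intros simp: r1 s_def[symmetric] \<sigma>_def power2_eq_square)
    moreover have "\<forall>\<^sub>F w in nhds 1. eta \<phi> U w = 1 - 1 / \<psi> (resolvent U w)"
    proof -
      have "((\<lambda>w. \<psi> (resolvent U w)) \<longlongrightarrow> \<psi> (resolvent U 1)) (nhds 1)"
        by (intro bounded_linear.tendsto[OF bounded] tendsto_resolvent n1)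
      then have "\<forall>\<^sub>F w in nhds 1. \<psi> (resolvent U w) \<noteq> 0"
        using \<sigma>0 unfolding r1 \<sigma>_def by (rule tendsto_imp_eventually_ne)
      with eventually_resolvent[OF n1] show ?thesis
        by eventually_elim (intro eta_eq mt assms(2))
    qed
    ultimately show "(eta \<phi> U has_field_derivative \<nu> / \<sigma>\<^sup>2) (at 1)"
      by (subst DERIV_cong_ev[OF refl _ refl])
  qed

  \<comment> \<open>For \<open>U = 0\<close> the injectivity requirement is vacuous and the radius 1
    is arbitrary.\<close>
  obtain rU where rU: "rU > 0"
    "U \<noteq> 0 \<Longrightarrow> cmod w \<le> rU \<Longrightarrow> cmod w' \<le> rU \<Longrightarrow> \<psi> (Psi U w) = \<psi> (Psi U w') \<Longrightarrow> w = w'" for w w'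
  proof (cases "U = 0")
    case True
    then show ?thesis using that[of 1] by simp
  next
    case False
    show ?thesis
      by (rule Psi_moment_injective[OF pos_nz[OF assms(2) Upos False]]) (rule that)
  qed
  obtain rV where rV: "rV > 0"
    "V \<noteq> 0 \<Longrightarrow> cmod w \<le> rV \<Longrightarrow> cmod w' \<le> rV \<Longrightarrow> \<psi> (Psi V w) = \<psi> (Psi V w') \<Longrightarrow> w = w'" for w w'
  proof (cases "V = 0")
    case True
    then show ?thesis using that[of 1] by simp
  next
    case False
    show ?thesis
      by (rule Psi_moment_injective[OF pos_nz[OF assms(3,7) False]]) (rule that)
  qed
  obtain e where e: "e > 0" "\<And>w. dist w 0 < e \<Longrightarrow> norm (w *\<^sub>C U) < 1 \<and> norm (w *\<^sub>C V) < 1"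
    using eventually_conj[OF eventually_small[of U] eventually_small[of V]]
    unfolding eventually_nhds_metric by blast
  \<comment> \<open>The bound \<open>1 / 2\<close> keeps \<open>w2\<close> away from 1, where the
    formulas for \<open>A\<close> and \<open>B\<close> would divide by zero.\<close>
  define r where "r = min (min rU rV) (min (e / 2) (1 / 2))"
  have r: "r > 0" "r \<le> rU" "r \<le> rV" "r < e" "r < 1" using rU(1) rV(1) e(1) by (auto simp: r_def)
  obtain \<delta> where \<delta>: "\<delta> > 0"
    "\<And>z. cmod z < \<delta> \<Longrightarrow> \<exists>w1 w2. cmod w1 \<le> r \<and> cmod w2 \<le> r \<and> subordinate U V z w1 w2"
    by (rule subordinate_exists[OF r(1), of U V]) blast

  note sub = assms(10)[unfolded subordination_functions_def]
  have "(\<omega>1 \<longlongrightarrow> 0) (nhds 0)"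
    by (rule power_series_tendsto_zero[where c = "\<lambda>k. boolean_cumulant \<phi> (alternating_list U V (2 * k + 1))"])
       (rule eventually_mono[OF sub], elim conjE, assumption)
  moreover have "(\<omega>2 \<longlongrightarrow> 0) (nhds 0)"
    by (rule power_series_tendsto_zero[where c = "\<lambda>k. boolean_cumulant \<phi> (alternating_list V U (2 * k + 1))"])
       (rule eventually_mono[OF sub], elim conjE, assumption)
  ultimately have "((\<lambda>z. cmod (\<omega>1 z)) \<longlongrightarrow> 0) (nhds 0)" "((\<lambda>z. cmod (\<omega>2 z)) \<longlongrightarrow> 0) (nhds 0)"
    by (simp_all add: tendsto_norm_zero_iff)
  then have ev\<omega>: "\<forall>\<^sub>F z in nhds 0. cmod (\<omega>1 z) < r" "\<forall>\<^sub>F z in nhds 0. cmod (\<omega>2 z) < r"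
    using r(1) by (auto intro: order_tendstoD(2))
  have ev\<delta>: "\<forall>\<^sub>F z in nhds 0. cmod z < \<delta>"
    using \<delta>(1) unfolding eventually_nhds_metric by (auto simp: dist_norm)
  show ?thesis
    using sub ev\<omega> ev\<delta> eventually_small[of "U * V"] eventually_small[of "V * U"]
      eventually_small[of "R * V * R"] eventually_small[of "S * U * S"]
  proof eventually_elim
    case (elim z)
    have EV: "EV (Psi (S * U * S) z) = Psi V (\<omega>1 z)" and EU: "EU (Psi (R * V * R) z) = Psi U (\<omega>2 z)"
      using elim(1) by (simp_all add: sandwich_def R_def S_def)
    have \<omega>r: "cmod (\<omega>1 z) \<le> r" "cmod (\<omega>2 z) \<le> r" using elim(2,3) by simp_all
    note nUV = elim(5) and nVU = elim(6) and nR = elim(7) and nS = elim(8)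
    have small: "norm (w *\<^sub>C U) < 1" "norm (w *\<^sub>C V) < 1" if "cmod w \<le> r" for w
      using e(2)[of w] that r(4) by auto
    obtain w1 w2 where w: "cmod w1 \<le> r" "cmod w2 \<le> r" and subw: "subordinate U V z w1 w2"
      using \<delta>(2)[OF elim(4)] by blast
    define G where "G = op_inv (1 - z *\<^sub>C (U * V))"
    define Y where "Y = V * G"
    have GM: "G \<in> M" unfolding G_def
      by (intro subalgebra_op_inv[OF cM] subalgebra_intros[OF cM] assms(2,3) nUV)
    have YM: "Y \<in> M" unfolding Y_def by (intro subalgebra_mult[OF cM] assms(3) GM)
    have PR: "Psi (R * V * R) z = z *\<^sub>C (R * Y * R)"
      unfolding Y_def G_def by (rule Psi_sandwich[OF R(2) nR nUV])
    \<comment> \<open>This inverse belongs to the opposite product \<open>V * U\<close>; through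
      \<open>G' * V = Y\<close> and the trace, both sandwiched products have the moment
      \<open>z * \<psi> (U * Y)\<close>.\<close>
    define G' where "G' = op_inv (1 - z *\<^sub>C (V * U))"
    have G'M: "G' \<in> M" unfolding G'_def
      by (intro subalgebra_op_inv[OF cM] subalgebra_intros[OF cM] assms(2,3) nVU)
    have PS: "Psi (S * U * S) z = z *\<^sub>C (S * (U * G') * S)"
      unfolding G'_def by (rule Psi_sandwich[OF S(2) nS nVU])
    have G'V: "G' * V = Y"
      unfolding G'_def Y_def G_def by (rule intertwine_op_inv[OF nUV nVU]) (simp add: algebra_simps)
    have "\<psi> ((R * Y) * R) = \<psi> (R * (R * Y))"
      by (intro trace subalgebra_mult[OF cM] R YM)
    then have mR: "\<psi> (Psi (R * V * R) z) = z * \<psi> (U * Y)"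
      unfolding PR by (simp add: R(2) mult.assoc[symmetric])
    have "\<psi> ((S * (U * G')) * S) = \<psi> (S * (S * (U * G')))"
      by (intro trace subalgebra_mult[OF cM] S assms(2) G'M)
    also have "\<dots> = \<psi> (V * (U * G'))" by (simp add: S(2) mult.assoc[symmetric])
    also have "\<dots> = \<psi> ((U * G') * V)"
      by (intro trace subalgebra_mult[OF cM] assms(2,3) G'M)
    finally have mS: "\<psi> (Psi (S * U * S) z) = z * \<psi> (U * Y)"
      unfolding PS by (simp add: mult.assoc G'V)
    have PRM: "Psi (R * V * R) z \<in> M" unfolding PR by (intro subalgebra_intros[OF cM] R YM)
    have PSM: "Psi (S * U * S) z \<in> M" unfolding PS by (intro subalgebra_intros[OF cM] S assms(2) G'M)
    have mtUV: "moment_transform \<phi> (sandwich U V) z = z * \<psi> (U * Y)"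
      using \<psi>(3)[OF PRM] mR by (simp add: moment_transform_def sandwich_def R_def)
    have mtV: "moment_transform \<phi> V (\<omega>1 z) = z * \<psi> (U * Y)"
      using assms(9) PSM \<psi>(3)[OF PSM] mS EV[symmetric]
      by (simp add: moment_transform_def conditional_expectation_def)
    have mtU: "moment_transform \<phi> U (\<omega>2 z) = z * \<psi> (U * Y)"
      using assms(8) PRM \<psi>(3)[OF PRM] mR EU[symmetric]
      by (simp add: moment_transform_def conditional_expectation_def)
    note core = moment_subordinate[OF UAU VAV nUV subw]
    note core = core[folded G_def, folded Y_def]
    \<comment> \<open>Both parameters lie in the disc of injectivity and give the same
      moment.\<close>
    have \<omega>2: "\<omega>2 z = w2" if "U \<noteq> 0"
    proof (rule rU(2)[OF that])
      show "\<psi> (Psi U (\<omega>2 z)) = \<psi> (Psi U w2)"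
        using mtU core(1) mtPsi[OF assms(2) small(1)[OF \<omega>r(2)]] by simp
    qed (use \<omega>r(2) w(2) r(2) in linarith)+
    have \<omega>1: "\<omega>1 z = w1" if "V \<noteq> 0"
    proof (rule rV(2)[OF that])
      show "\<psi> (Psi V (\<omega>1 z)) = \<psi> (Psi V w1)"
        using mtV core mtPsi[OF assms(3) small(2)[OF \<omega>r(1)]] by simp
    qed (use \<omega>r(1) w(1) r(3) in linarith)+
    define L where "L = op_inv (1 - U) * op_sqrt U * Psi (sandwich U V) z * op_sqrt U * op_inv (1 - U)"
    have L: "L = z *\<^sub>C (f * Y * f)"
    proof -
      have "L = z *\<^sub>C ((s * (R * R)) * Y * ((R * R) * s))"
        unfolding L_def sandwich_def R_def[symmetric] s_def[symmetric] PR by (simp add: mult.assoc)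
      then show ?thesis by (simp add: R(2) sU f_def)
    qed
    define A where "A = (eta \<phi> U (\<omega>2 z) - eta \<phi> U 1) / (\<omega>2 z - 1) * \<phi> (op_inv (1 - U))"
    define B where "B = \<omega>2 z * (eta \<phi> U (\<omega>2 z) - eta \<phi> U 1 - (\<omega>2 z - 1) * deriv (eta \<phi> U) 1)
                 / (\<omega>2 z - 1)\<^sup>2 * (\<phi> (op_inv (1 - U)))\<^sup>2"
    have "EV L = B *\<^sub>C 1 + (z * A\<^sup>2) *\<^sub>C (V * (1 + Psi V (\<omega>1 z)))"
    proof (cases "U = 0")
      case True
      \<comment> \<open>Here \<open>\<omega>2 z\<close> and \<open>w2\<close> are not compared;
        \<open>L\<close> and both coefficients vanish.\<close>
      have "eta \<phi> U = (\<lambda>_. 0)"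
      proof
        fix w
        have "\<phi> 0 = 0" using \<psi>(3)[OF subalgebra_zero[OF cM]] by simp
        then show "eta \<phi> U w = 0" by (simp add: True eta_def moment_transform_def Psi_def)
      qed
      then have "A = 0" "B = 0" by (simp_all add: A_def B_def)
      moreover have "EV (0 *\<^sub>C 0) = 0 *\<^sub>C EV 0"
        using assms(9) subalgebra_zero[OF cM] unfolding conditional_expectation_def by blast
      ultimately show ?thesis by (simp add: L f_def True)
    next
      case False
      define a b where "a = resolvent U w2" and "b = resolvent V w1"
      define m where "m = \<psi> a"
      define \<zeta> \<tau> where "\<zeta> = \<psi> (a * f)" and "\<tau> = \<psi> (f * a * f)"
      note w2 = \<omega>2[OF False]
      have m0: "m \<noteq> 0" and zq: "w2 * m = z * \<psi> (V * b)"
        using subw by (auto simp: subordinate_def m_def a_def b_def)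
      have w21: "w2 - 1 \<noteq> 0" using w(2) r(5) by auto
      \<comment> \<open>The resolvent identity for the parameters \<open>w2\<close> and 1 produces
        the difference quotients from which \<open>A\<close> and \<open>B\<close> are built;
        multiplied by \<open>f\<close>, it gives the second order quotient in
        \<open>B\<close>.\<close>
      have as: "a - s = (w2 - 1) *\<^sub>C (a * f)"
        using resolvent_diff[of w2 U 1] small(1)[OF w(2)] Unorm
        by (simp add: a_def s_def f_def mult.assoc)
      have m\<sigma>: "m - \<sigma> = (w2 - 1) * \<zeta>"
        using arg_cong[OF as, of \<psi>] by (simp add: m_def \<sigma>_def \<zeta>_def)
      have aAU: "a \<in> AU" unfolding a_def
        by (intro subalgebra_op_inv[OF cAU] subalgebra_intros[OF cAU] UAU small(1) w)
      have fa: "\<psi> (f * a) = \<zeta>"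
        unfolding \<zeta>_def using fAU aAU AUM by (intro trace) auto
      have \<tau>: "(w2 - 1) * \<tau> = \<zeta> - \<nu>"
        using arg_cong[OF arg_cong[OF as, of "\<lambda>T. f * T"], of \<psi>] fa
        by (simp add: \<tau>_def \<nu>_def right_diff_distrib mult.assoc)
      have \<phi>s: "\<phi> (op_inv (1 - U)) = \<sigma>"
        using \<psi>(3) sAU AUM by (auto simp: \<sigma>_def s_def)
      have \<eta>: "eta \<phi> U w2 = 1 - 1 / m"
        using mt[OF assms(2) small(1)[OF w(2)]] m0 by (intro eta_eq) (simp_all add: m_def a_def)
      have d\<eta>: "eta \<phi> U w2 - eta \<phi> U 1 = (w2 - 1) * \<zeta> / (m * \<sigma>)"
        unfolding \<eta> eta1 m\<sigma>[symmetric] using m0 \<sigma>0 by (simp add: field_simps)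
      have A: "A = \<zeta> / m"
        unfolding A_def w2 d\<eta> \<phi>s using w21 m0 \<sigma>0 by (simp add: field_simps)
      have B: "B = w2 * (\<tau> - \<zeta>\<^sup>2 / m)"
      proof -
        have "B = w2 * ((w2 - 1) * \<zeta> / (m * \<sigma>) - (w2 - 1) * (\<nu> / \<sigma>\<^sup>2)) / (w2 - 1)\<^sup>2 * \<sigma>\<^sup>2"
          unfolding B_def w2 d\<eta> \<phi>s deriv1 ..
        also have "\<dots> = w2 * (\<sigma> * \<zeta> / m - \<nu>) / (w2 - 1)"
          using w21 m0 \<sigma>0 by (simp add: divide_simps power2_eq_square) (simp add: algebra_simps)
        also have "\<sigma> * \<zeta> / m - \<nu> = (w2 - 1) * (\<tau> - \<zeta>\<^sup>2 / m)"
        proof -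
          have "(w2 - 1) * (\<tau> - \<zeta>\<^sup>2 / m) = (w2 - 1) * \<tau> - ((w2 - 1) * \<zeta>) * \<zeta> / m"
            by (simp add: right_diff_distrib power2_eq_square)
          also have "\<dots> = \<zeta> - \<nu> - (m - \<sigma>) * \<zeta> / m" unfolding \<tau> m\<sigma> ..
          also have "\<dots> = \<sigma> * \<zeta> / m - \<nu>" using m0 by (simp add: field_simps)
          finally show ?thesis ..
        qed
        also have "w2 * ((w2 - 1) * (\<tau> - \<zeta>\<^sup>2 / m)) / (w2 - 1) = w2 * (\<tau> - \<zeta>\<^sup>2 / m)"
          using w21 by simp
        finally show ?thesis .
      qed
      \<comment> \<open>The equality of \<open>\<omega>1 z\<close> and \<open>w1\<close> is
        available only for \<open>V \<noteq> 0\<close>; otherwise both sides are 0.\<close>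
      have Vb: "V * (1 + Psi V (\<omega>1 z)) = V * b"
      proof (cases "V = 0")
        case False
        then show ?thesis using \<omega>1 small(2)[OF w(1)] by (simp add: b_def resolvent_eq_Psi)
      qed simp
      let ?Q = "\<psi> (V * b)"
      show ?thesis
        unfolding Vb
      proof (rule conditional_expectation_eqI[OF assms(1) Vsa assms(3,9)])
        show "L \<in> M" unfolding L using fAU AUM YM by (intro subalgebra_intros[OF cM]) auto
        have VN: "V \<in> vn_generated {V}" using vn_generated_superset by blast
        note cN = closed_subalgebra_vn_generated[of "{V}"]
        show "B *\<^sub>C 1 + (z * A\<^sup>2) *\<^sub>C (V * b) \<in> vn_generated {V}"
          unfolding b_def by (intro subalgebra_intros[OF cN] subalgebra_op_inv[OF cN] VN small(2) w)
        fix k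
        have h: "V ^ k \<in> AV" by (intro subalgebra_power[OF cAV] VAV)
        have bAV: "b \<in> AV" unfolding b_def
          by (intro subalgebra_op_inv[OF cAV] subalgebra_intros[OF cAV] VAV small(2) w)
        have "\<psi> (V ^ k * L) = z * \<psi> (V ^ k * (f * Y * f))" by (simp add: L)
        also have "\<psi> (V ^ k * (f * Y * f)) = ?Q * \<psi> (V ^ k) * (\<tau> / m)
            + (\<zeta> / m)\<^sup>2 * (\<psi> (V ^ k * (V * b)) - ?Q * \<psi> (V ^ k))"
          using moment_two_sided[OF UAU VAV nUV subw h fAU]
          unfolding a_def[symmetric] b_def[symmetric] G_def[symmetric] Y_def[symmetric] fa
            m_def[symmetric] \<zeta>_def[symmetric] \<tau>_def[symmetric]
          by (simp add: power_divide power2_eq_square)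
        also have "z * (?Q * \<psi> (V ^ k) * (\<tau> / m) + (\<zeta> / m)\<^sup>2 * (\<psi> (V ^ k * (V * b)) - ?Q * \<psi> (V ^ k)))
            = (z * ?Q) * (\<tau> / m - (\<zeta> / m)\<^sup>2) * \<psi> (V ^ k) + z * A\<^sup>2 * \<psi> (V ^ k * (V * b))"
          unfolding A by (simp add: algebra_simps)
        \<comment> \<open>The equation \<open>w2 * m = z * ?Q\<close> turns the coefficient of
          \<open>\<psi> (V ^ k)\<close> into \<open>B\<close>.\<close>
        also have "(z * ?Q) * (\<tau> / m - (\<zeta> / m)\<^sup>2) = B"
          unfolding zq[symmetric] B using m0 by (simp add: field_simps power2_eq_square)
        also have "B * \<psi> (V ^ k) + z * A\<^sup>2 * \<psi> (V ^ k * (V * b))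
            = \<psi> (V ^ k * (B *\<^sub>C 1 + (z * A\<^sup>2) *\<^sub>C (V * b)))"
          by (simp add: distrib_left)
        finally have "\<psi> (V ^ k * L) = \<psi> (V ^ k * (B *\<^sub>C 1 + (z * A\<^sup>2) *\<^sub>C (V * b)))" .
        moreover have "V ^ k * L \<in> M" "V ^ k * (B *\<^sub>C 1 + (z * A\<^sup>2) *\<^sub>C (V * b)) \<in> M"
          unfolding L using fAU AUM bAV AVM h YM assms(3) by (auto intro!: subalgebra_intros[OF cM])
        ultimately show "\<phi> (V ^ k * L) = \<phi> (V ^ k * (B *\<^sub>C 1 + (z * A\<^sup>2) *\<^sub>C (V * b)))"
          using \<psi>(3) by simp
      qed
    qed
    then show ?case
      using mtUV mtV mtU unfolding Let_def A_def B_def L_def by simp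
  qed
qed

end
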